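(* Let $V=\bigotimes_{i=1}^nV_i$ with $V_i$ a complex Hilbert space of dimension $d_i$. The $\mathrm{GL}_{\mathbf d}$ orbits in $\mathrm{End}(V)^{\oplus m}$ of $m$-tuples of density matrices are closed, so they can be separated by polynomial invariants (i.e. if two $m$-tuples of density matrices lie in distinct $\mathrm{GL}_{\mathbf d}$ orbits, some $f\in\mathbb C[\mathrm{End}(V)^{\oplus m}]^{\mathrm{GL}_{\mathbf d}}$ takes different values on them). Moreover, two Hermitian matrices in $\mathrm{End}(V)$ are in the same $\mathrm{GL}_{\mathbf d}$ orbit if and only if they are in the same $\mathrm{U}_{\mathbf d}$ orbit.
   Context: $\mathrm{GL}_{\mathbf d}=\times_{i=1}^n\mathrm{GL}(\mathbb C^{d_i})$ and $\mathrm{U}_{\mathbf d}=\times_{i=1}^n\mathrm{U}(\mathbb C^{d_i})$ act on $\mathrm{End}(V)=\bigotimes_i\mathrm{End}(V_i)$ by conjugation by $\bigotimes_ig_i$, and on $\mathrm{End}(V)^{\oplus m}$ by simultaneous conjugation. "Closed" means Zariski closed. Polynomial invariants are elements of the polynomial ring on $\mathrm{End}(V)^{\oplus m}$ viewed as a complex vector space (no complex conjugates of coordinates) that are invariant under the group. A density matrix is a positive semidefinite Hermitian operator of trace 1. *)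

theory Defs
  imports
    "Jordan_Normal_Form.Schur_Decomposition"
    "Jordan_Normal_Form.Gauss_Jordan_Elimination"
begin

text \<open>
  The local dimensions are given by a list \<open>ds = [d\<^sub>1, \<dots>, d\<^sub>n]\<close>.  Orthonormal bases of the \<open>V\<^sub>i\<close>
  are fixed, so that \<open>V\<^sub>i\<close> is \<open>\<complex>\<close> to the power \<open>d\<^sub>i\<close> with its standard inner product.  The product
  basis of \<open>V = V\<^sub>1 \<otimes> \<dots> \<otimes> V\<^sub>n\<close>, ordered lexicographically, identifies End(V) with the
  square matrices of size \<open>prod_list ds\<close>, and tensor products of operators with Kronecker products.
\<close>

definition kron :: "'a::semiring_1 mat \<Rightarrow> 'a mat \<Rightarrow> 'a mat" where
  "kron A B = mat (dim_row A * dim_row B) (dim_col A * dim_col B)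
     (\<lambda>(i, j). A $$ (i div dim_row B, j div dim_col B) * B $$ (i mod dim_row B, j mod dim_col B))"

fun tensor :: "'a::semiring_1 mat list \<Rightarrow> 'a mat" where
  "tensor [] = 1\<^sub>m 1"
| "tensor (A # As) = kron A (tensor As)"

definition End_V :: "nat list \<Rightarrow> complex mat set" where
  "End_V ds = carrier_mat (prod_list ds) (prod_list ds)"

definition End_V_tuples :: "nat list \<Rightarrow> nat \<Rightarrow> complex mat list set" where
  "End_V_tuples ds m = {X. length X = m \<and> set X \<subseteq> End_V ds}"


definition GL :: "nat \<Rightarrow> complex mat set" where
  "GL d = {g \<in> carrier_mat d d. invertible_mat g}"

definition U :: "nat \<Rightarrow> complex mat set" where
  "U d = {u \<in> carrier_mat d d. mat_adjoint u * u = 1\<^sub>m d}"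

definition GL_prod :: "nat list \<Rightarrow> complex mat list set" where
  "GL_prod ds = listset (map GL ds)"

definition U_prod :: "nat list \<Rightarrow> complex mat list set" where
  "U_prod ds = listset (map U ds)"

text \<open>
  \<^const>\<open>mat_inverse\<close> returns an option; it is not \<^const>\<open>None\<close> for invertible matrices, and only these
  occur below.
\<close>

definition conj_act :: "complex mat list \<Rightarrow> complex mat \<Rightarrow> complex mat" where
  "conj_act gs A = tensor gs * A * the (mat_inverse (tensor gs))"

definition orbit :: "complex mat list set \<Rightarrow> complex mat \<Rightarrow> complex mat set" where
  "orbit G A = {conj_act gs A | gs. gs \<in> G}"

definition tuple_orbit :: "complex mat list set \<Rightarrow> complex mat list \<Rightarrow> complex mat list set" where
  "tuple_orbit G X = {map (conj_act gs) X | gs. gs \<in> G}"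


text \<open>
  The polynomial ring on the complex vector space of \<open>m\<close>-tuples of operators: as \<open>\<complex>\<close> is infinite,
  it is the algebra of polynomial functions, generated by the matrix entries of the components.
\<close>

inductive_set poly_ring :: "nat list \<Rightarrow> nat \<Rightarrow> (complex mat list \<Rightarrow> complex) set"
  for ds :: "nat list" and m :: nat where
  const: "(\<lambda>X. c) \<in> poly_ring ds m"
| coord: "k < m \<Longrightarrow> i < prod_list ds \<Longrightarrow> j < prod_list ds \<Longrightarrow> (\<lambda>X. (X ! k) $$ (i, j)) \<in> poly_ring ds m"
| add: "f \<in> poly_ring ds m \<Longrightarrow> g \<in> poly_ring ds m \<Longrightarrow> (\<lambda>X. f X + g X) \<in> poly_ring ds m"
| mult: "f \<in> poly_ring ds m \<Longrightarrow> g \<in> poly_ring ds m \<Longrightarrow> (\<lambda>X. f X * g X) \<in> poly_ring ds m"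

definition GL_invariants :: "nat list \<Rightarrow> nat \<Rightarrow> (complex mat list \<Rightarrow> complex) set" where
  "GL_invariants ds m = {f \<in> poly_ring ds m.
     \<forall>gs \<in> GL_prod ds. \<forall>X \<in> End_V_tuples ds m. f (map (conj_act gs) X) = f X}"

definition zariski_closed :: "nat list \<Rightarrow> nat \<Rightarrow> complex mat list set \<Rightarrow> bool" where
  "zariski_closed ds m S \<longleftrightarrow>
     (\<exists>F \<subseteq> poly_ring ds m. S = {X \<in> End_V_tuples ds m. \<forall>f \<in> F. f X = 0})"


definition hermitian :: "complex mat \<Rightarrow> bool" where
  "hermitian A \<longleftrightarrow> mat_adjoint A = A"

definition pos_semidef :: "complex mat \<Rightarrow> bool" where
  "pos_semidef A \<longleftrightarrow> hermitian A \<and> (\<forall>v \<in> carrier_vec (dim_row A). 0 \<le> Re ((A *\<^sub>v v) \<bullet>c v))"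

definition mat_trace :: "complex mat \<Rightarrow> complex" where
  "mat_trace A = (\<Sum>i < dim_row A. A $$ (i, i))"

definition density_matrices :: "nat list \<Rightarrow> complex mat set" where
  "density_matrices ds = {\<rho> \<in> End_V ds. pos_semidef \<rho> \<and> mat_trace \<rho> = 1}"

definition density_tuples :: "nat list \<Rightarrow> nat \<Rightarrow> complex mat list set" where
  "density_tuples ds m = {\<rho>. length \<rho> = m \<and> set \<rho> \<subseteq> density_matrices ds}"

end

theory Submission
  imports
    Defs
    "HOL-Library.Function_Algebras"
    "HOL-Computational_Algebra.Fundamental_Theorem_Algebra"
    "HOL-Analysis.Function_Topology"
    "HOL-Analysis.Topology_Euclidean_Space"
    "HOL-Analysis.Continuum_Not_Denumerable"
begin

text \<open>
  Everything is reduced to the compact group \<open>U\<^sub>d\<close>, which is Zariski dense in \<open>GL\<^sub>d\<close> (Cayley curves) and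
  which preserves Hermitian tuples, on which \<open>D X Y = \<Sum>\<^sub>k tr (X\<^sub>k - Y\<^sub>k)\<^sup>2\<close> is both a polynomial and the
  squared distance.  Instead of Haar measure, an invariant mean on the unitary group is obtained from
  almost minimal averages in finite-dimensional unitary representations.  The mean over \<open>t\<close> of
  \<open>(1 - D X (t \<rho>) / C)\<^sup>n\<close> is an invariant polynomial in \<open>X\<close>; for large \<open>n\<close> it separates \<open>\<rho>\<close> from every
  Hermitian tuple off its unitary orbit.

  For closedness, let \<open>X\<close> lie in the Zariski closure of the orbit of \<open>\<rho>\<close>, and consider the ideal generated by
  the entries of \<open>t \<rho> - X\<close> in the algebra of representative functions of \<open>t\<close>.  If it is proper, the
  Nullstellensatz gives a character of that algebra, which is evaluation at some \<open>g\<close> in \<open>GL\<^sub>d\<close> with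
  \<open>g \<rho> = X\<close>.  Otherwise averaging a relation \<open>\<Sum>\<^sub>i (t \<rho> - X)\<^sub>i h\<^sub>i t = 1\<close> against the kernels above yields a
  polynomial that is \<open>1\<close> on the orbit and \<open>0\<close> at \<open>X\<close>, a contradiction.
\<close>

text \<open>A Hermitian tuple has the least norm in its \<open>GL\<close> orbit, so Kempf-Ness
  theory would be the usual route; here compactness of the unitary group takes its place. Positivity
  is the only source of estimates, and it is available only where both tuples are Hermitian. This
  makes the two arguments differ. For separation both tuples are Hermitian, so the kernel means at
  the two tuples can be compared directly as \<open>n\<close> grows. A point \<open>X\<close> in the
  closure of an orbit need not be Hermitian, so no estimate at \<open>X\<close> is possible. It
  enters only algebraically, through polynomials that vanish at \<open>X\<close> by construction,
  and the group element carrying \<open>\<rho>\<close> to \<open>X\<close>, in general not unitary,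
  has to come from algebra. The Nullstellensatz applies in its elementary form for uncountable
  fields because representative functions are spanned by countably many monomials. Separation ends
  with a unitary element, not merely an invertible one. The last claim is therefore the case of
  tuples of length one: Hermitian matrices in one \<open>GL\<close> orbit share all invariants and
  so are unitarily equivalent.\<close>

section \<open>Algebras of functions and functions of two variables that separate\<close>

definition fun_alg :: "('a \<Rightarrow> complex) set \<Rightarrow> bool" where
  "fun_alg A \<longleftrightarrow> (\<forall>c. (\<lambda>x. c) \<in> A) \<and>
     (\<forall>f\<in>A. \<forall>g\<in>A. (\<lambda>x. f x + g x) \<in> A \<and> (\<lambda>x. f x * g x) \<in> A)"

lemma fun_algD:
  assumes "fun_alg A"
  shows fun_alg_const: "(\<lambda>x. c) \<in> A"
    and fun_alg_add: "f \<in> A \<Longrightarrow> g \<in> A \<Longrightarrow> (\<lambda>x. f x + g x) \<in> A"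
    and fun_alg_mult: "f \<in> A \<Longrightarrow> g \<in> A \<Longrightarrow> (\<lambda>x. f x * g x) \<in> A"
  using assms by (auto simp: fun_alg_def)

lemma fun_alg_sum:
  assumes "fun_alg A" "\<And>i. i \<in> I \<Longrightarrow> f i \<in> A"
  shows "(\<lambda>x. \<Sum>i\<in>I. f i x) \<in> A"
  using assms(2)
proof (induction I rule: infinite_finite_induct)
  case (insert i I)
  then show ?case using fun_alg_add[OF assms(1), of "f i" "\<lambda>x. \<Sum>i\<in>I. f i x"] by simp
qed (auto intro: fun_alg_const[OF assms(1)])

lemma fun_alg_sum_list:
  assumes "fun_alg A" "\<And>i. i \<in> set is \<Longrightarrow> f i \<in> A"
  shows "(\<lambda>x. \<Sum>i\<leftarrow>is. f i x) \<in> A"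
  using assms(2)
proof (induction "is")
  case (Cons i "is")
  then show ?case using fun_alg_add[OF assms(1), of "f i" "\<lambda>x. \<Sum>i\<leftarrow>is. f i x"] by simp
qed (auto intro: fun_alg_const[OF assms(1)])

lemma fun_alg_prod:
  assumes "fun_alg A" "\<And>i. i \<in> I \<Longrightarrow> f i \<in> A"
  shows "(\<lambda>x. \<Prod>i\<in>I. f i x) \<in> A"
  using assms(2)
proof (induction I rule: infinite_finite_induct)
  case (insert i I)
  then show ?case using fun_alg_mult[OF assms(1), of "f i" "\<lambda>x. \<Prod>i\<in>I. f i x"] by simp
qed (auto intro: fun_alg_const[OF assms(1)])

lemma fun_alg_power:
  assumes "fun_alg A" "f \<in> A"
  shows "(\<lambda>x. f x ^ n) \<in> A"
  by (induction n) (auto intro: fun_alg_const fun_alg_mult assms)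

lemma fun_alg_cmult:
  assumes "fun_alg A" "f \<in> A"
  shows "(\<lambda>x. c * f x) \<in> A"
  by (intro fun_alg_const fun_alg_mult assms)

lemma fun_alg_diff:
  assumes "fun_alg A" "f \<in> A" "g \<in> A"
  shows "(\<lambda>x. f x - g x) \<in> A"
  using fun_alg_add[OF assms(1,2) fun_alg_cmult[OF assms(1,3), of "-1"]] by simp

text \<open>On \<open>X\<close> times \<open>Y\<close>, \<open>F\<close> lies in the image of the
  algebraic tensor product of \<open>A\<close> and \<open>B\<close>. Applying a functional in the
  second variable leaves an element of \<open>A\<close>, which is how averages over the group stay
  polynomial (\<open>mean_sep\<close>). The same notion expresses the coproduct of the group
  (\<open>reg_comult\<close>).\<close>

definition sep ::
  "('a \<Rightarrow> complex) set \<Rightarrow> ('b \<Rightarrow> complex) set \<Rightarrow> 'a set \<Rightarrow> 'b set \<Rightarrow> ('a \<Rightarrow> 'b \<Rightarrow> complex) \<Rightarrow> bool" where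
  "sep A B X Y F \<longleftrightarrow>
     (\<exists>ps. set ps \<subseteq> A \<times> B \<and> (\<forall>x\<in>X. \<forall>y\<in>Y. F x y = (\<Sum>(a, b)\<leftarrow>ps. a x * b y)))"

lemma sep_cong:
  "sep A B X Y F \<Longrightarrow> (\<And>x y. x \<in> X \<Longrightarrow> y \<in> Y \<Longrightarrow> F x y = G x y) \<Longrightarrow> sep A B X Y G"
  by (auto simp: sep_def)

lemma sep_left: "a \<in> A \<Longrightarrow> fun_alg B \<Longrightarrow> sep A B X Y (\<lambda>x y. a x)"
  unfolding sep_def by (intro exI[of _ "[(a, \<lambda>_. 1)]"]) (auto intro: fun_alg_const)

lemma sep_right: "b \<in> B \<Longrightarrow> fun_alg A \<Longrightarrow> sep A B X Y (\<lambda>x y. b y)"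
  unfolding sep_def by (intro exI[of _ "[(\<lambda>_. 1, b)]"]) (auto intro: fun_alg_const)

lemma sep_const: "fun_alg A \<Longrightarrow> fun_alg B \<Longrightarrow> sep A B X Y (\<lambda>x y. c)"
  by (rule sep_left) (auto intro: fun_alg_const)

lemma sep_add:
  assumes "sep A B X Y F" "sep A B X Y G"
  shows "sep A B X Y (\<lambda>x y. F x y + G x y)"
proof -
  obtain ps where "set ps \<subseteq> A \<times> B" "\<forall>x\<in>X. \<forall>y\<in>Y. F x y = (\<Sum>(a, b)\<leftarrow>ps. a x * b y)"
    using assms(1) by (auto simp: sep_def)
  moreover obtain qs where "set qs \<subseteq> A \<times> B" "\<forall>x\<in>X. \<forall>y\<in>Y. G x y = (\<Sum>(a, b)\<leftarrow>qs. a x * b y)"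
    using assms(2) by (auto simp: sep_def)
  ultimately show ?thesis unfolding sep_def by (intro exI[of _ "ps @ qs"]) auto
qed

lemma sum_list_product:
  fixes f :: "'a \<Rightarrow> 'c::semiring_0"
  shows "(\<Sum>x\<leftarrow>xs. f x) * (\<Sum>y\<leftarrow>ys. g y) = (\<Sum>(x, y)\<leftarrow>List.product xs ys. f x * g y)"
  by (induction xs) (simp_all add: distrib_right sum_list_const_mult o_def)

lemma sep_mult:
  assumes A: "fun_alg A" and B: "fun_alg B" and "sep A B X Y F" "sep A B X Y G"
  shows "sep A B X Y (\<lambda>x y. F x y * G x y)"
proof -
  obtain ps where ps: "set ps \<subseteq> A \<times> B" "\<forall>x\<in>X. \<forall>y\<in>Y. F x y = (\<Sum>(a, b)\<leftarrow>ps. a x * b y)"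
    using assms(3) by (auto simp: sep_def)
  obtain qs where qs: "set qs \<subseteq> A \<times> B" "\<forall>x\<in>X. \<forall>y\<in>Y. G x y = (\<Sum>(a, b)\<leftarrow>qs. a x * b y)"
    using assms(4) by (auto simp: sep_def)
  let ?rs = "map (\<lambda>((a, b), (a', b')). ((\<lambda>x. a x * a' x), (\<lambda>y. b y * b' y))) (List.product ps qs)"
  have "set ?rs \<subseteq> A \<times> B" using ps(1) qs(1) by (force intro: fun_alg_mult[OF A] fun_alg_mult[OF B])
  moreover have "F x y * G x y = (\<Sum>(a, b)\<leftarrow>?rs. a x * b y)" if "x \<in> X" "y \<in> Y" for x y
    using that ps(2) qs(2)
    by (simp add: sum_list_product o_def case_prod_unfold algebra_simps)
  ultimately show ?thesis unfolding sep_def by (intro exI[of _ ?rs]) blast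
qed

lemma sep_sum:
  assumes A: "fun_alg A" and B: "fun_alg B" and "\<And>i. i \<in> I \<Longrightarrow> sep A B X Y (F i)"
  shows "sep A B X Y (\<lambda>x y. \<Sum>i\<in>I. F i x y)"
  using assms(3)
proof (induction I rule: infinite_finite_induct)
  case (insert i I)
  then show ?case using sep_add[of A B X Y "F i" "\<lambda>x y. \<Sum>i\<in>I. F i x y"] by simp
qed (auto intro: sep_const A B)

lemma sep_power:
  assumes A: "fun_alg A" and B: "fun_alg B" and "sep A B X Y F"
  shows "sep A B X Y (\<lambda>x y. F x y ^ n)"
  by (induction n) (auto intro: sep_const sep_mult assms)

section \<open>Invariant means\<close>

text \<open>Convex combinations of point evaluations with dyadic weights. Midpoints are all that the
  parallelogram argument of \<open>gram_almost_invariant\<close> asks for.\<close>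

inductive_set averages :: "'a set \<Rightarrow> (('a \<Rightarrow> complex) \<Rightarrow> complex) set" for S where
  eval: "s \<in> S \<Longrightarrow> (\<lambda>f. f s) \<in> averages S"
| mid: "E \<in> averages S \<Longrightarrow> E' \<in> averages S \<Longrightarrow> (\<lambda>f. (E f + E' f) / 2) \<in> averages S"

context
  fixes S :: "'a set" and E assumes E: "E \<in> averages S"
begin

lemma averages_add: "E (\<lambda>s. f s + g s) = E f + E g"
  using E by induction (auto simp: field_simps)

lemma averages_cmult: "E (\<lambda>s. c * f s) = c * E f"
  using E by induction (auto simp: field_simps)

lemma averages_const: "E (\<lambda>s. c) = c"
  using E by induction auto

lemma averages_cnj: "E (\<lambda>s. cnj (f s)) = cnj (E f)"
  using E by induction (auto simp: field_simps)

lemma averages_cong: "(\<And>s. s \<in> S \<Longrightarrow> f s = g s) \<Longrightarrow> E f = E g"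
  using E by induction auto

text \<open>The form in which positivity is recorded. It bounds a mean from above (constant
  \<open>g\<close>) and from below (constant \<open>f\<close>), and it is a closed condition, so it
  survives the passage to a limit.\<close>

lemma averages_norm_le:
  assumes "\<And>s. s \<in> S \<Longrightarrow> norm (f s) \<le> Re (g s)"
  shows "norm (E f) \<le> Re (E g)"
  using E
proof induction
  case (mid E E')
  have "norm ((E f + E' f) / 2) \<le> (norm (E f) + norm (E' f)) / 2"
    by (simp add: norm_divide divide_right_mono norm_triangle_ineq)
  then show ?case using mid by simp
qed (use assms in auto)

lemma averages_sum_list: "E (\<lambda>s. \<Sum>v\<leftarrow>vs. F v s) = (\<Sum>v\<leftarrow>vs. E (F v))"
  by (induction vs) (simp_all add: averages_const averages_add)

lemma averages_translate:
  assumes "t \<in> S" "\<And>s. s \<in> S \<Longrightarrow> mul t s \<in> S"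
  shows "(\<lambda>f. E (\<lambda>s. f (mul t s))) \<in> averages S"
  using E by induction (auto intro: averages.intros assms)

end

section \<open>Matrix coefficients of unitary representations and almost invariant averages\<close>

text \<open>The members of \<open>vs\<close> are the coordinates of a map from \<open>S\<close> into
  a Hilbert space, and left translation preserves the inner products of its values. This encodes an
  orbit in a finite-dimensional unitary representation without naming the representation.\<close>

definition gram_inv :: "('a \<Rightarrow> 'a \<Rightarrow> 'a) \<Rightarrow> 'a set \<Rightarrow> ('a \<Rightarrow> complex) list \<Rightarrow> bool" where
  "gram_inv mul S vs \<longleftrightarrow> (\<forall>t\<in>S. \<forall>s\<in>S. \<forall>s'\<in>S.
     (\<Sum>v\<leftarrow>vs. v (mul t s) * cnj (v (mul t s'))) = (\<Sum>v\<leftarrow>vs. v s * cnj (v s')))"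

text \<open>Matrix coefficients: linear functionals of such an orbit map.\<close>

definition gram_fun :: "('a \<Rightarrow> 'a \<Rightarrow> 'a) \<Rightarrow> 'a set \<Rightarrow> ('a \<Rightarrow> complex) \<Rightarrow> bool" where
  "gram_fun mul S f \<longleftrightarrow>
     (\<exists>ps. gram_inv mul S (map snd ps) \<and> (\<forall>s\<in>S. f s = (\<Sum>(a, v)\<leftarrow>ps. a * v s)))"

lemma gram_inv_append: "gram_inv mul S vs \<Longrightarrow> gram_inv mul S ws \<Longrightarrow> gram_inv mul S (vs @ ws)"
  by (auto simp: gram_inv_def)

lemma gram_fun_const: "gram_fun mul S (\<lambda>_. c)"
  unfolding gram_fun_def by (intro exI[of _ "[(c, \<lambda>_. 1)]"]) (auto simp: gram_inv_def)

lemma gram_fun_add: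
  assumes "gram_fun mul S f" "gram_fun mul S g"
  shows "gram_fun mul S (\<lambda>s. f s + g s)"
proof -
  obtain ps where "gram_inv mul S (map snd ps)" "\<forall>s\<in>S. f s = (\<Sum>(a, v)\<leftarrow>ps. a * v s)"
    using assms(1) by (auto simp: gram_fun_def)
  moreover obtain qs where "gram_inv mul S (map snd qs)" "\<forall>s\<in>S. g s = (\<Sum>(a, v)\<leftarrow>qs. a * v s)"
    using assms(2) by (auto simp: gram_fun_def)
  ultimately show ?thesis unfolding gram_fun_def
    by (intro exI[of _ "ps @ qs"]) (auto simp: gram_inv_append)
qed

text \<open>The functions \<open>\<lambda>s. v s * w s\<close> are coordinates in the tensor product
  of the two representations, and their Gram kernel is the product of the two Gram kernels.\<close>

lemma gram_fun_mult:
  assumes "gram_fun mul S f" "gram_fun mul S g"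
  shows "gram_fun mul S (\<lambda>s. f s * g s)"
proof -
  obtain ps where ps: "gram_inv mul S (map snd ps)" "\<forall>s\<in>S. f s = (\<Sum>(a, v)\<leftarrow>ps. a * v s)"
    using assms(1) by (auto simp: gram_fun_def)
  obtain qs where qs: "gram_inv mul S (map snd qs)" "\<forall>s\<in>S. g s = (\<Sum>(a, v)\<leftarrow>qs. a * v s)"
    using assms(2) by (auto simp: gram_fun_def)
  let ?rs = "map (\<lambda>((a, v), (b, w)). (a * b, \<lambda>s. v s * w s)) (List.product ps qs)"
  have gram: "(\<Sum>v\<leftarrow>map snd ?rs. v s * cnj (v s')) =
      (\<Sum>v\<leftarrow>map snd ps. v s * cnj (v s')) * (\<Sum>v\<leftarrow>map snd qs. v s * cnj (v s'))" for s s'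
    by (simp add: sum_list_product o_def case_prod_unfold mult_ac)
  have "gram_inv mul S (map snd ?rs)"
    unfolding gram_inv_def gram
    by (intro ballI arg_cong2[where f = "(*)"]) (use ps(1) qs(1) in \<open>auto simp only: gram_inv_def\<close>)
  moreover have "f s * g s = (\<Sum>(a, v)\<leftarrow>?rs. a * v s)" if "s \<in> S" for s
    using that ps(2) qs(2) by (simp add: sum_list_product o_def case_prod_unfold mult_ac)
  ultimately show ?thesis unfolding gram_fun_def by (intro exI[of _ ?rs]) blast
qed

text \<open>The squared length of an averaged vector depends on the Gram kernel alone, so an average
  and its translate have equal length (\<open>averages_gram_translate\<close>).\<close>

lemma averages_gram:
  assumes E: "E \<in> averages S"
  shows "complex_of_real (\<Sum>v\<leftarrow>vs. (norm (E v))\<^sup>2) = E (\<lambda>s. E (\<lambda>s'. \<Sum>v\<leftarrow>vs. v s * cnj (v s')))"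
proof -
  have "E (\<lambda>s. E (\<lambda>s'. \<Sum>v\<leftarrow>vs. v s * cnj (v s'))) = E (\<lambda>s. \<Sum>v\<leftarrow>vs. cnj (E v) * v s)"
    by (simp add: averages_sum_list[OF E] averages_cmult[OF E] averages_cnj[OF E] mult.commute)
  also have "\<dots> = (\<Sum>v\<leftarrow>vs. cnj (E v) * E v)"
    by (simp add: averages_sum_list[OF E] averages_cmult[OF E])
  also have "\<dots> = complex_of_real (\<Sum>v\<leftarrow>vs. (norm (E v))\<^sup>2)"
    by (induction vs) (simp_all add: complex_norm_square[symmetric] mult.commute)
  finally show ?thesis by simp
qed

context
  fixes S :: "'a set" and mul :: "'a \<Rightarrow> 'a \<Rightarrow> 'a"
  assumes ne: "S \<noteq> {}" and closed_mul: "\<And>s t. s \<in> S \<Longrightarrow> t \<in> S \<Longrightarrow> mul s t \<in> S"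
begin

lemma averages_gram_translate:
  assumes E: "E \<in> averages S" and vs: "gram_inv mul S vs" and t: "t \<in> S"
  shows "(\<Sum>v\<leftarrow>vs. (norm (E (\<lambda>s. v (mul t s))))\<^sup>2) = (\<Sum>v\<leftarrow>vs. (norm (E v))\<^sup>2)"
proof -
  let ?F = "\<lambda>f. E (\<lambda>s. f (mul t s))"
  have F: "?F \<in> averages S" using averages_translate[OF E t] closed_mul t by blast
  have "complex_of_real (\<Sum>v\<leftarrow>vs. (norm (?F v))\<^sup>2) =
      E (\<lambda>s. E (\<lambda>s'. \<Sum>v\<leftarrow>vs. v (mul t s) * cnj (v (mul t s'))))"
    by (subst averages_gram[OF F]) simp
  also have "\<dots> = E (\<lambda>s. E (\<lambda>s'. \<Sum>v\<leftarrow>vs. v s * cnj (v s')))"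
    using vs t unfolding gram_inv_def by (intro averages_cong[OF E]) blast
  also have "\<dots> = complex_of_real (\<Sum>v\<leftarrow>vs. (norm (E v))\<^sup>2)"
    by (rule averages_gram[OF E, symmetric])
  finally show ?thesis using of_real_eq_iff by blast
qed

text \<open>An average that almost minimises the invariant quadratic form is close to its translates,
  by the parallelogram law.\<close>

lemma gram_almost_invariant:
  assumes vs: "gram_inv mul S vs" and e: "\<epsilon> > 0"
  shows "\<exists>E\<in>averages S. \<forall>t\<in>S. (\<Sum>v\<leftarrow>vs. (norm (E (\<lambda>s. v (mul t s)) - E v))\<^sup>2) \<le> \<epsilon>"
proof -
  define Q where "Q E = (\<Sum>v\<leftarrow>vs. (norm (E v :: complex))\<^sup>2)" for E :: "('a \<Rightarrow> complex) \<Rightarrow> complex"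
  define \<delta> where "\<delta> = Inf (Q ` averages S)"
  have bdd: "bdd_below (Q ` averages S)"
    by (rule bdd_belowI[of _ 0]) (auto simp: Q_def intro!: sum_list_nonneg)
  have "averages S \<noteq> {}" using ne by (auto intro: averages.eval)
  \<comment> \<open>By the parallelogram law, the squared difference of two vectors of equal length
    is four times the excess of their squared length over that of the midpoint; hence the fourth
    part of the tolerance.\<close>
  then obtain E where E: "E \<in> averages S" "Q E < \<delta> + \<epsilon> / 4"
    using cInf_lessD[of "Q ` averages S" "\<delta> + \<epsilon> / 4"] e unfolding \<delta>_def by auto
  have "(\<Sum>v\<leftarrow>vs. (norm (E (\<lambda>s. v (mul t s)) - E v))\<^sup>2) \<le> \<epsilon>" if t: "t \<in> S" for t
  proof -
    let ?F = "\<lambda>f. E (\<lambda>s. f (mul t s))"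
    let ?H = "\<lambda>f. (?F f + E f) / 2"
    have "?F \<in> averages S" using averages_translate[OF E(1) t] closed_mul t by blast
    then have "?H \<in> averages S" using E(1) by (rule averages.mid)
    then have "\<delta> \<le> Q ?H" unfolding \<delta>_def by (intro cInf_lower bdd) auto
    have par: "(norm (x - y))\<^sup>2 = 2 * (norm x)\<^sup>2 + 2 * (norm y)\<^sup>2 - 4 * (norm ((x + y) / 2))\<^sup>2"
      for x y :: complex
      unfolding cmod_power2 by (simp add: power2_eq_square field_simps)
    have "(\<Sum>v\<leftarrow>ws. (norm (?F v - E v))\<^sup>2) =
        2 * (\<Sum>v\<leftarrow>ws. (norm (?F v))\<^sup>2) + 2 * (\<Sum>v\<leftarrow>ws. (norm (E v))\<^sup>2) - 4 * (\<Sum>v\<leftarrow>ws. (norm (?H v))\<^sup>2)" for ws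
      by (induction ws) (simp_all only: list.map sum_list.Nil sum_list.Cons par, simp_all add: algebra_simps)
    then have "(\<Sum>v\<leftarrow>vs. (norm (?F v - E v))\<^sup>2) = 4 * Q E - 4 * Q ?H"
      using averages_gram_translate[OF E(1) vs t] unfolding Q_def by simp
    then show ?thesis using \<open>\<delta> \<le> Q ?H\<close> E(2) by simp
  qed
  then show ?thesis using E(1) by blast
qed

text \<open>One average must serve finitely many functions at once. Concatenating their Gram lists
  gives a single quadratic form that controls all of them, and the constants add up.\<close>

lemma gram_funs_dominated:
  assumes "finite F" "\<And>f. f \<in> F \<Longrightarrow> gram_fun mul S f"
  shows "\<exists>vs C. gram_inv mul S vs \<and> C \<ge> 0 \<and> (\<forall>f\<in>F. \<forall>E\<in>averages S. \<forall>t\<in>S.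
    norm (E (\<lambda>s. f (mul t s)) - E f) \<le> C * sqrt (\<Sum>v\<leftarrow>vs. (norm (E (\<lambda>s. v (mul t s)) - E v))\<^sup>2))"
  using assms
proof (induction F)
  case empty
  show ?case by (intro exI[of _ "[]"] exI[of _ 0]) (auto simp: gram_inv_def)
next
  case (insert f F)
  define N where "N E t vs = sqrt (\<Sum>v\<leftarrow>vs. (norm (E (\<lambda>s. v (mul t s)) - E v :: complex))\<^sup>2)"
    for E :: "('a \<Rightarrow> complex) \<Rightarrow> complex" and t and vs :: "('a \<Rightarrow> complex) list"
  obtain vs C where vs: "gram_inv mul S vs" "C \<ge> 0"
    "\<And>g E t. g \<in> F \<Longrightarrow> E \<in> averages S \<Longrightarrow> t \<in> S \<Longrightarrow> norm (E (\<lambda>s. g (mul t s)) - E g) \<le> C * N E t vs"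
    using insert unfolding N_def by auto
  obtain ps where ps: "gram_inv mul S (map snd ps)" "\<forall>s\<in>S. f s = (\<Sum>(a, v)\<leftarrow>ps. a * v s)"
    using insert.prems[of f] by (auto simp: gram_fun_def)
  define C' where "C' = (\<Sum>(a, v)\<leftarrow>ps. norm a)"
  have C': "C' \<ge> 0" by (auto simp: C'_def intro!: sum_list_nonneg)
  have nn: "(\<Sum>v\<leftarrow>ws. (norm (E (\<lambda>s. v (mul t s)) - E v :: complex))\<^sup>2) \<ge> 0" for E t ws
    by (auto intro!: sum_list_nonneg)
  have mono: "N E t ws \<le> N E t (ws @ ws')" "N E t ws' \<le> N E t (ws @ ws')" "N E t ws \<ge> 0" for E t ws ws'
    unfolding N_def using nn by (auto intro!: real_sqrt_le_mono)
  have f: "norm (E (\<lambda>s. f (mul t s)) - E f) \<le> C' * N E t (map snd ps)"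
    if E: "E \<in> averages S" and t: "t \<in> S" for E t
  proof -
    have *: "E (\<lambda>s. \<Sum>(a, v)\<leftarrow>qs. a * v (g s)) = (\<Sum>(a, v)\<leftarrow>qs. a * E (\<lambda>s. v (g s)))"
      for qs and g :: "'a \<Rightarrow> 'a"
      by (simp add: case_prod_unfold averages_sum_list[OF E] averages_cmult[OF E])
    have "E (\<lambda>s. f (mul t s)) = E (\<lambda>s. \<Sum>(a, v)\<leftarrow>ps. a * v (mul t s))"
      by (rule averages_cong[OF E]) (use ps(2) closed_mul t in auto)
    moreover have "E f = E (\<lambda>s. \<Sum>(a, v)\<leftarrow>ps. a * v s)"
      by (rule averages_cong[OF E]) (use ps(2) in auto)
    ultimately have eq: "E (\<lambda>s. f (mul t s)) - E f = (\<Sum>(a, v)\<leftarrow>ps. a * (E (\<lambda>s. v (mul t s)) - E v))"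
      using *[of "mul t" ps] *[of "\<lambda>s. s" ps]
      by (simp add: case_prod_unfold right_diff_distrib sum_list_subtractf)
    have "norm (\<Sum>(a, v)\<leftarrow>qs. a * (E (\<lambda>s. v (mul t s)) - E v)) \<le> (\<Sum>(a, v)\<leftarrow>qs. norm a) * N E t (map snd ps)"
      if "set qs \<subseteq> set ps" for qs
      using that
    proof (induction qs)
      case (Cons p qs)
      obtain a v where p: "p = (a, v)" by (cases p)
      have "(norm (E (\<lambda>s. v (mul t s)) - E v))\<^sup>2
          \<in> set (map (\<lambda>v. (norm (E (\<lambda>s. v (mul t s)) - E v))\<^sup>2) (map snd ps))"
        using Cons.prems p by force
      then have "(norm (E (\<lambda>s. v (mul t s)) - E v))\<^sup>2 \<le> (\<Sum>v\<leftarrow>map snd ps. (norm (E (\<lambda>s. v (mul t s)) - E v))\<^sup>2)"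
        by (intro member_le_sum_list) auto
      then have "norm (E (\<lambda>s. v (mul t s)) - E v) \<le> N E t (map snd ps)"
        unfolding N_def by (rule real_le_rsqrt)
      then have "norm (a * (E (\<lambda>s. v (mul t s)) - E v)) \<le> norm a * N E t (map snd ps)"
        by (simp add: norm_mult mult_left_mono)
      moreover have "norm (\<Sum>(a, v)\<leftarrow>qs. a * (E (\<lambda>s. v (mul t s)) - E v))
          \<le> (\<Sum>(a, v)\<leftarrow>qs. norm a) * N E t (map snd ps)"
        using Cons by simp
      ultimately show ?case
        by (simp add: p distrib_right del: norm_mult norm_mult_ineq)
          (rule order_trans[OF norm_triangle_ineq], linarith)
    qed simp
    from this[of ps] show ?thesis by (simp add: eq C'_def)
  qed
  have "norm (E (\<lambda>s. g (mul t s)) - E g) \<le> (C + C') * N E t (vs @ map snd ps)"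
    if g: "g \<in> insert f F" and E: "E \<in> averages S" and t: "t \<in> S" for g E t
  proof (cases "g = f")
    case True
    then have "norm (E (\<lambda>s. g (mul t s)) - E g) \<le> C' * N E t (map snd ps)" using f E t by simp
    also have "\<dots> \<le> (C + C') * N E t (vs @ map snd ps)" using vs(2) C' mono by (intro mult_mono) auto
    finally show ?thesis .
  next
    case False
    then have "norm (E (\<lambda>s. g (mul t s)) - E g) \<le> C * N E t vs" using vs(3) g E t by simp
    also have "\<dots> \<le> (C + C') * N E t (vs @ map snd ps)" using vs(2) C' mono by (intro mult_mono) auto
    finally show ?thesis .
  qed
  moreover have "gram_inv mul S (vs @ map snd ps)" using vs(1) ps(1) by (rule gram_inv_append)
  ultimately show ?case using vs(2) C' unfolding N_def by (intro exI[of _ "vs @ map snd ps"] exI[of _ "C + C'"]) auto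
qed

lemma gram_funs_almost_invariant:
  assumes "finite F" "\<And>f. f \<in> F \<Longrightarrow> gram_fun mul S f" and e: "\<epsilon> > 0"
  shows "\<exists>E\<in>averages S. \<forall>f\<in>F. \<forall>t\<in>S. norm (E (\<lambda>s. f (mul t s)) - E f) \<le> \<epsilon>"
proof -
  obtain vs C where vs: "gram_inv mul S vs" "C \<ge> 0"
    "\<And>f E t. f \<in> F \<Longrightarrow> E \<in> averages S \<Longrightarrow> t \<in> S \<Longrightarrow> 
    norm (E (\<lambda>s. f (mul t s)) - E f) \<le> C * sqrt (\<Sum>v\<leftarrow>vs. (norm (E (\<lambda>s. v (mul t s)) - E v))\<^sup>2)"
    using gram_funs_dominated[OF assms(1,2)] by blast
  \<comment> \<open>The tolerance is squared because the form is a sum of squares;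
    \<open>C + 1\<close> avoids a division by zero.\<close>
  obtain E where E: "E \<in> averages S"
    "\<And>t. t \<in> S \<Longrightarrow> (\<Sum>v\<leftarrow>vs. (norm (E (\<lambda>s. v (mul t s)) - E v))\<^sup>2) \<le> (\<epsilon> / (C + 1))\<^sup>2"
    using gram_almost_invariant[OF vs(1), of "(\<epsilon> / (C + 1))\<^sup>2"] e vs(2) by fastforce
  have "norm (E (\<lambda>s. f (mul t s)) - E f) \<le> \<epsilon>" if "f \<in> F" "t \<in> S" for f t
  proof -
    have "norm (E (\<lambda>s. f (mul t s)) - E f) \<le> C * sqrt ((\<epsilon> / (C + 1))\<^sup>2)"
      using vs(3)[OF that(1) E(1) that(2)] E(2)[OF that(2)] vs(2)
      by (meson mult_left_mono order_trans real_sqrt_le_mono)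
    also have "\<dots> = C * (\<epsilon> / (C + 1))" using e vs(2) by simp
    also have "\<dots> \<le> \<epsilon>" using e vs(2) by (simp add: field_simps)
    finally show ?thesis .
  qed
  then show ?thesis using E(1) by blast
qed

end

section \<open>From almost invariant averages to an invariant mean\<close>

lemma bounded_image_add:
  fixes f g :: "'a \<Rightarrow> complex"
  assumes "bounded (f ` S)" "bounded (g ` S)"
  shows "bounded ((\<lambda>s. f s + g s) ` S)"
proof -
  obtain a b where "\<forall>s\<in>S. norm (f s) \<le> a" "\<forall>s\<in>S. norm (g s) \<le> b"
    using assms by (auto simp: bounded_iff)
  then have "\<forall>s\<in>S. norm (f s + g s) \<le> a + b" by (meson add_mono norm_triangle_le)
  then show ?thesis by (auto simp: bounded_iff)
qed

lemma bounded_image_mult: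
  fixes f g :: "'a \<Rightarrow> complex"
  assumes "bounded (f ` S)" "bounded (g ` S)"
  shows "bounded ((\<lambda>s. f s * g s) ` S)"
proof -
  obtain a b where *: "\<forall>s\<in>S. norm (f s) \<le> a" "\<forall>s\<in>S. norm (g s) \<le> b"
    using assms by (auto simp: bounded_iff)
  have "norm (f s * g s) \<le> a * b" if "s \<in> S" for s
    unfolding norm_mult by (rule mult_mono') (use * that in auto)
  then show ?thesis by (auto simp: bounded_iff)
qed

lemma bounded_image_const: "bounded ((\<lambda>s. c :: complex) ` S)"
  by (auto simp: bounded_iff)

lemma bounded_image_cmult:
  fixes f :: "'a \<Rightarrow> complex"
  shows "bounded (f ` S) \<Longrightarrow> bounded ((\<lambda>s. c * f s) ` S)"
  by (intro bounded_image_mult bounded_image_const)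

lemma compact_PiE_complex:
  fixes B :: "'b \<Rightarrow> real"
  shows "compact {M. \<forall>f. norm (M f :: complex) \<le> B f}"
proof -
  have "compactin (product_topology (\<lambda>_. euclidean) UNIV) (PiE UNIV (\<lambda>f. cball (0 :: complex) (B f)))"
    unfolding compactin_PiE by (simp add: compactin_euclidean_iff)
  moreover have "PiE UNIV (\<lambda>f. cball (0 :: complex) (B f)) = {M. \<forall>f. norm (M f) \<le> B f}"
    by (auto simp: PiE_def Pi_def)
  ultimately show ?thesis by (simp add: euclidean_product_topology compactin_euclidean_iff)
qed

text \<open>Invariance is demanded only for matrix coefficients. For all bounded functions it would
  fail: unitary groups of size at least two contain free subgroups, hence are not amenable as
  discrete groups.\<close>

definition invariant_mean ::
  "('a \<Rightarrow> 'a \<Rightarrow> 'a) \<Rightarrow> 'a set \<Rightarrow> (('a \<Rightarrow> complex) \<Rightarrow> complex) \<Rightarrow> bool" where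
  "invariant_mean mul S M \<longleftrightarrow> M (\<lambda>_. 1) = 1 \<and>
     (\<forall>f g. bounded (f ` S) \<longrightarrow> bounded (g ` S) \<longrightarrow> M (\<lambda>s. f s + g s) = M f + M g) \<and>
     (\<forall>c f. bounded (f ` S) \<longrightarrow> M (\<lambda>s. c * f s) = c * M f) \<and>
     (\<forall>f g. bounded (f ` S) \<longrightarrow> bounded (g ` S) \<longrightarrow> (\<forall>s\<in>S. norm (f s) \<le> Re (g s)) \<longrightarrow>
        norm (M f) \<le> Re (M g)) \<and>
     (\<forall>f t. gram_fun mul S f \<longrightarrow> bounded (f ` S) \<longrightarrow> t \<in> S \<longrightarrow> M (\<lambda>s. f (mul t s)) = M f)"

text \<open>Tychonoff's theorem turns the almost invariant averages into a single invariant functional.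
  Functionals are cut off to \<open>0\<close> on unbounded functions, so that they form a compact set.\<close>

lemma invariant_mean_exists:
  fixes S :: "'a set"
  assumes ne: "S \<noteq> {}" and closed_mul: "\<And>s t. s \<in> S \<Longrightarrow> t \<in> S \<Longrightarrow> mul s t \<in> S"
  shows "\<exists>M. invariant_mean mul S M"
proof -
  define bd where "bd f = bounded (f ` S)" for f :: "'a \<Rightarrow> complex"
  have bd_add: "bd (\<lambda>s. f s + g s)" if "bd f" "bd g" for f g
    using that bounded_image_add by (auto simp: bd_def)
  have bd_cmult: "bd (\<lambda>s. c * f s)" if "bd f" for c f
    using that bounded_image_cmult by (auto simp: bd_def)
  have "\<forall>f. \<exists>B. bd f \<longrightarrow> (\<forall>s\<in>S. norm (f s) \<le> B) \<and> B \<ge> 0"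
  proof
    fix f
    show "\<exists>B. bd f \<longrightarrow> (\<forall>s\<in>S. norm (f s) \<le> B) \<and> B \<ge> 0"
    proof (cases "bd f")
      case True
      then obtain b where "\<forall>s\<in>S. norm (f s) \<le> b" by (auto simp: bd_def bounded_iff)
      then show ?thesis by (intro exI[of _ "max b 0"]) auto
    qed auto
  qed
  then obtain B0 where B0: "\<And>f s. bd f \<Longrightarrow> s \<in> S \<Longrightarrow> norm (f s) \<le> B0 f" "\<And>f. bd f \<Longrightarrow> B0 f \<ge> 0"
    by metis
  define B where "B f = (if bd f then B0 f else 0)" for f
  \<comment> \<open>Each condition involves only finitely many values of \<open>M\<close>, hence is
    closed in the product topology.\<close>
  define K where "K = {M. \<forall>f. norm (M f) \<le> B f} \<inter>
     ({M. M (\<lambda>_. 1) = 1} \<inter>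
      (\<Inter>(f, g)\<in>{(f, g). bd f \<and> bd g}. {M. M (\<lambda>s. f s + g s) = M f + M g}) \<inter>
      (\<Inter>(c, f)\<in>{(c, f). bd f}. {M. M (\<lambda>s. c * f s) = c * M f}) \<inter>
      (\<Inter>(f, g)\<in>{(f, g). bd f \<and> bd g \<and> (\<forall>s\<in>S. norm (f s) \<le> Re (g s))}. {M. norm (M f) \<le> Re (M g)}))"
  note cont = continuous_on_product_coordinates continuous_intros
  have "compact K" unfolding K_def
    by (intro compact_Int_closed compact_PiE_complex closed_Int closed_INT ballI)
      (auto intro!: closed_Collect_eq closed_Collect_le cont)
  define I where "I = {(f, t, \<epsilon>). gram_fun mul S f \<and> bd f \<and> t \<in> S \<and> \<epsilon> > (0::real)}"
  define T where "T = (\<lambda>(f, t, \<epsilon>). {M :: ('a \<Rightarrow> complex) \<Rightarrow> complex. norm (M (\<lambda>s. f (mul t s)) - M f) \<le> \<epsilon>})"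
  have "K \<inter> (\<Inter>i\<in>I. T i) \<noteq> {}"
  proof (rule compact_imp_fip_image[OF \<open>compact K\<close>])
    show "closed (T i)" for i
      unfolding T_def by (cases i) (auto intro!: closed_Collect_le cont)
  next
    fix I' assume I': "finite I'" "I' \<subseteq> I"
    \<comment> \<open>\<open>insert 1\<close> yields a positive tolerance also for an empty family
      of conditions.\<close>
    define \<epsilon> where "\<epsilon> = Min (insert 1 ((snd \<circ> snd) ` I'))"
    have "\<epsilon> > 0" "\<And>i. i \<in> I' \<Longrightarrow> \<epsilon> \<le> snd (snd i)"
      using I' by (auto simp: \<epsilon>_def I_def)
    have "gram_fun mul S f" if "f \<in> fst ` I'" for f using I' that by (auto simp: I_def)
    from gram_funs_almost_invariant[OF ne closed_mul finite_imageI[OF I'(1)] this \<open>\<epsilon> > 0\<close>]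
    obtain E where E: "E \<in> averages S"
      "\<And>f t. f \<in> fst ` I' \<Longrightarrow> t \<in> S \<Longrightarrow> norm (E (\<lambda>s. f (mul t s)) - E f) \<le> \<epsilon>" by blast
    \<comment> \<open>Sums, multiples and translates of bounded functions are bounded, so the
      cut-off never meets the conditions to be checked.\<close>
    define M where "M f = (if bd f then E f else 0)" for f
    have "norm (E f) \<le> B0 f" if "bd f" for f
      using averages_norm_le[OF E(1), of f "\<lambda>_. complex_of_real (B0 f)"] B0(1)[OF that]
      by (simp add: averages_const[OF E(1)])
    moreover have "bd (\<lambda>_. 1)" unfolding bd_def by (rule bounded_image_const)
    ultimately have "M \<in> K"
      unfolding K_def M_def B_def
      by (auto simp: averages_const[OF E(1)] averages_add[OF E(1)] averages_cmult[OF E(1)] bd_add bd_cmult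
        intro: averages_norm_le[OF E(1)])
    moreover have "M \<in> T i" if i: "i \<in> I'" for i
    proof -
      obtain f t e where fte: "i = (f, t, e)" by (cases i)
      have *: "gram_fun mul S f" "bd f" "t \<in> S" "f \<in> fst ` I'" "\<epsilon> \<le> e"
        using I' i fte \<open>\<And>i. i \<in> I' \<Longrightarrow> \<epsilon> \<le> snd (snd i)\<close>[OF i] by (force simp: I_def)+
      have "bd (\<lambda>s. f (mul t s))"
        using *(2,3) closed_mul unfolding bd_def bounded_iff by auto
      then show ?thesis using E(2)[OF *(4,3)] * by (simp add: T_def fte M_def)
    qed
    ultimately show "K \<inter> (\<Inter>i\<in>I'. T i) \<noteq> {}" by blast
  qed
  then obtain M where M: "M \<in> K" "\<And>i. i \<in> I \<Longrightarrow> M \<in> T i" by blast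
  have "M (\<lambda>s. f (mul t s)) = M f" if "gram_fun mul S f" "bounded (f ` S)" "t \<in> S" for f t
  proof -
    have "norm (M (\<lambda>s. f (mul t s)) - M f) \<le> e" if "e > 0" for e
      using M(2)[of "(f, t, e)"] that \<open>gram_fun mul S f\<close> \<open>bounded (f ` S)\<close> \<open>t \<in> S\<close>
      by (simp add: I_def T_def bd_def)
    then have "norm (M (\<lambda>s. f (mul t s)) - M f) \<le> 0" by (rule field_le_epsilon[of _ 0, simplified])
    then show ?thesis by simp
  qed
  then have "invariant_mean mul S M"
    using M(1) unfolding invariant_mean_def K_def bd_def by auto
  then show ?thesis by blast
qed

section \<open>Calculus with an invariant mean\<close>

context
  fixes mul :: "'a \<Rightarrow> 'a \<Rightarrow> 'a" and S M
  assumes M: "invariant_mean mul S M"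
begin

lemma mean_one: "M (\<lambda>_. 1) = 1"
  and mean_add: "bounded (f ` S) \<Longrightarrow> bounded (g ` S) \<Longrightarrow> M (\<lambda>s. f s + g s) = M f + M g"
  and mean_cmult: "bounded (f ` S) \<Longrightarrow> M (\<lambda>s. c * f s) = c * M f"
  and mean_norm_le: "bounded (f ` S) \<Longrightarrow> bounded (g ` S) \<Longrightarrow> (\<And>s. s \<in> S \<Longrightarrow> norm (f s) \<le> Re (g s)) \<Longrightarrow>
        norm (M f) \<le> Re (M g)"
  and mean_translate: "gram_fun mul S f \<Longrightarrow> bounded (f ` S) \<Longrightarrow> t \<in> S \<Longrightarrow> M (\<lambda>s. f (mul t s)) = M f"
  using M[unfolded invariant_mean_def] by simp_all

lemma mean_const: "M (\<lambda>_. c) = c"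
  using mean_cmult[OF bounded_image_const, of c 1] mean_one by simp

lemma mean_diff:
  assumes "bounded (f ` S)" "bounded (g ` S)"
  shows "M (\<lambda>s. f s - g s) = M f - M g"
  using mean_add[OF assms(1) bounded_image_cmult[OF assms(2), of "-1"]] mean_cmult[OF assms(2), of "-1"]
  by simp

text \<open>A mean takes functions on the whole type. That only their values on \<open>S\<close>
  matter follows from the norm bound with right-hand side \<open>0\<close>, applied to the
  difference.\<close>

lemma mean_cong:
  assumes "bounded (f ` S)" "\<And>s. s \<in> S \<Longrightarrow> f s = g s"
  shows "M f = M g"
proof -
  have g: "bounded (g ` S)" using assms by (metis image_cong)
  have "norm (M (\<lambda>s. f s - g s)) \<le> Re (M (\<lambda>_. 0))"
    using assms(2) bounded_image_add[OF assms(1) bounded_image_cmult[OF g, of "-1"]]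
    by (intro mean_norm_le bounded_image_const) auto
  then show ?thesis using mean_diff[OF assms(1) g] by (simp add: mean_const)
qed

lemma mean_sum_list:
  assumes "\<And>i. i \<in> set is \<Longrightarrow> bounded (f i ` S)"
  shows "M (\<lambda>s. \<Sum>i\<leftarrow>is. f i s) = (\<Sum>i\<leftarrow>is. M (f i)) \<and> bounded ((\<lambda>s. \<Sum>i\<leftarrow>is. f i s) ` S)"
  using assms
proof (induction "is")
  case (Cons i "is")
  then show ?case using mean_add[of "f i" "\<lambda>s. \<Sum>i\<leftarrow>is. f i s"] bounded_image_add[of "f i" S "\<lambda>s. \<Sum>i\<leftarrow>is. f i s"]
    by simp
qed (auto simp: mean_const bounded_image_const)

text \<open>Averaging out the second variable of a finite sum of products replaces the second
  factors by constants. With \<open>A\<close> the polynomial ring, averaged kernels are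
  polynomials.\<close>

lemma mean_sep:
  assumes A: "fun_alg A" and B: "\<And>b. b \<in> B \<Longrightarrow> bounded (b ` S)" and F: "sep A B X S F"
  shows "\<exists>a\<in>A. \<forall>x\<in>X. M (F x) = a x"
proof -
  obtain ps where ps: "set ps \<subseteq> A \<times> B" "\<And>x y. x \<in> X \<Longrightarrow> y \<in> S \<Longrightarrow> F x y = (\<Sum>(a, b)\<leftarrow>ps. a x * b y)"
    using F by (auto simp: sep_def)
  have bdd: "bounded ((\<lambda>y. (case i of (a, b) \<Rightarrow> a x * b y)) ` S)" if "i \<in> set ps" for i x
  proof (cases i)
    case (Pair a b)
    then have "b \<in> B" using that ps(1) by auto
    then show ?thesis using B by (simp add: Pair bounded_image_cmult)
  qed
  have "M (F x) = (\<Sum>(a, b)\<leftarrow>ps. M b * a x)" if x: "x \<in> X" for x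
  proof -
    have "M (\<lambda>y. \<Sum>i\<leftarrow>ps. case i of (a, b) \<Rightarrow> a x * b y) = (\<Sum>i\<leftarrow>ps. M (\<lambda>y. case i of (a, b) \<Rightarrow> a x * b y))"
      "bounded ((\<lambda>y. \<Sum>i\<leftarrow>ps. case i of (a, b) \<Rightarrow> a x * b y) ` S)"
      using mean_sum_list[of ps "\<lambda>i y. case i of (a, b) \<Rightarrow> a x * b y", OF bdd] by auto
    moreover have "(\<Sum>i\<leftarrow>ps. M (\<lambda>y. case i of (a, b) \<Rightarrow> a x * b y)) = (\<Sum>(a, b)\<leftarrow>ps. M b * a x)"
      using ps(1) B by (intro arg_cong[where f = sum_list] map_cong refl) (auto simp: mean_cmult)
    moreover have "M (F x) = M (\<lambda>y. \<Sum>i\<leftarrow>ps. case i of (a, b) \<Rightarrow> a x * b y)"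
      by (rule mean_cong[symmetric]) (use calculation(2) ps(2)[OF x] in simp_all)
    ultimately show ?thesis by simp
  qed
  moreover have "(\<lambda>x. \<Sum>i\<leftarrow>ps. M (snd i) * fst i x) \<in> A"
    using ps(1) by (intro fun_alg_sum_list[OF A] fun_alg_cmult[OF A]) auto
  ultimately show ?thesis
    by (intro bexI[of _ "\<lambda>x. \<Sum>i\<leftarrow>ps. M (snd i) * fst i x"]) (simp_all add: case_prod_unfold)
qed

end

section \<open>A Nullstellensatz for function algebras of countable dimension\<close>

interpretation fs: vector_space "\<lambda>c f x. c * f x :: complex"
  by unfold_locales (auto simp: fun_eq_iff algebra_simps)

lemma sum_fun_apply: "(\<Sum>i\<in>I. f i) x = (\<Sum>i\<in>I. f i x :: 'b::comm_monoid_add)"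
  by (induction I rule: infinite_finite_induct) auto

text \<open>Finite-dimensional function spaces are closed under pointwise convergence. The functions
  are compared on \<open>X\<close> only and may differ elsewhere, so no norm is at hand; instead the
  dimension is lowered by prescribing the value at one point of \<open>X\<close>. The bound on
  independent sets plays the part of the dimension.\<close>

lemma finite_dim_closed_aux:
  assumes "fs.subspace V" "\<And>I. I \<subseteq> V \<Longrightarrow> fs.independent I \<Longrightarrow> finite I \<and> card I \<le> r"
    and "\<And>n. w n \<in> V" "\<And>k. k \<in> X \<Longrightarrow> (\<lambda>n. w n k) \<longlonglongrightarrow> u k"
  shows "\<exists>v\<in>V. \<forall>k\<in>X. v k = u k"
  using assms
proof (induction r arbitrary: V w u rule: less_induct)
  case (less r)
  show ?case
  proof (cases "\<exists>v\<in>V. \<exists>k\<in>X. v k \<noteq> 0")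
    case False
    then have "u k = 0" if "k \<in> X" for k
    proof -
      have "(\<lambda>n. w n k) = (\<lambda>n. 0)" using False less.prems(3) that by blast
      then show ?thesis using less.prems(4)[OF that] by (simp add: LIMSEQ_const_iff)
    qed
    then show ?thesis using fs.subspace_0[OF less.prems(1)] by (intro bexI[of _ 0]) auto
  next
    case True
    then obtain v k0 where v: "v \<in> V" "k0 \<in> X" "v k0 \<noteq> 0" by blast
    define V1 where "V1 = V \<inter> {f. f k0 = 0}"
    have V1: "fs.subspace V1"
      unfolding V1_def by (intro fs.subspace_inter less.prems(1)) (auto simp: fs.subspace_def)
    \<comment> \<open>Adjoining \<open>v\<close> to an independent subset of \<open>V1\<close> keeps
      it independent, so the bound drops by at least one.\<close>
    have card: "finite I \<and> card I < r" if I: "I \<subseteq> V1" "fs.independent I" for I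
    proof -
      have "v \<notin> V1" using v(3) by (simp add: V1_def)
      then have "v \<notin> fs.span I" using fs.span_minimal[OF I(1) V1] by blast
      then have "fs.independent (insert v I)" "v \<notin> I"
        using I(2) fs.independent_insertI fs.span_base by blast+
      then show ?thesis
        using less.prems(2)[of "insert v I"] I v(1) by (auto simp: V1_def)
    qed
    have r: "r - 1 < r" using card[OF empty_subsetI fs.independent_empty] by simp
    \<comment> \<open>The multiple of \<open>v\<close> that cancels the value at \<open>k0\<close>;
      its coefficient converges because \<open>k0\<close> belongs to \<open>X\<close>.\<close>
    define w' where "w' n = w n - (\<lambda>x. (w n k0 / v k0) * v x)" for n
    have "w' n \<in> V1" for n
    proof -
      have "w' n \<in> V" unfolding w'_def
        by (intro fs.subspace_diff fs.subspace_scale less.prems(1,3) v(1))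
      then show ?thesis using v(3) by (simp add: V1_def w'_def)
    qed
    moreover have "(\<lambda>n. w' n k) \<longlonglongrightarrow> u k - (u k0 / v k0) * v k" if "k \<in> X" for k
      unfolding w'_def fun_diff_def by (intro tendsto_intros less.prems(4) that v(2,3))
    moreover have "finite I \<and> card I \<le> r - 1" if "I \<subseteq> V1" "fs.independent I" for I
      using card[OF that] by auto
    ultimately obtain v' where v': "v' \<in> V1" "\<forall>k\<in>X. v' k = u k - (u k0 / v k0) * v k"
      using less.IH[OF r V1, of w' "\<lambda>k. u k - (u k0 / v k0) * v k"] by blast
    have "v' + (\<lambda>x. (u k0 / v k0) * v x) \<in> V"
      using v'(1) by (intro fs.subspace_add fs.subspace_scale less.prems(1) v(1)) (auto simp: V1_def)
    then show ?thesis using v'(2) by (intro bexI) auto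
  qed
qed

lemma finite_dim_closed:
  assumes "fs.subspace V" "finite B" "V \<subseteq> fs.span B"
    and "\<And>n. w n \<in> V" "\<And>k. k \<in> X \<Longrightarrow> (\<lambda>n. w n k) \<longlonglongrightarrow> u k"
  shows "\<exists>v\<in>V. \<forall>k\<in>X. v k = u k"
  using assms(1) fs.independent_span_bound[OF assms(2)] assms(3,4,5)
  by (intro finite_dim_closed_aux[where r = "card B"]) blast+

section \<open>Maximal ideals and characters\<close>

definition alg_ideal :: "('a \<Rightarrow> complex) set \<Rightarrow> ('a \<Rightarrow> complex) set \<Rightarrow> bool" where
  "alg_ideal R I \<longleftrightarrow> I \<subseteq> R \<and> (\<lambda>_. 0) \<in> I \<and> (\<forall>f\<in>I. \<forall>g\<in>I. (\<lambda>x. f x + g x) \<in> I) \<and>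
     (\<forall>f\<in>R. \<forall>g\<in>I. (\<lambda>x. f x * g x) \<in> I)"

lemma maximal_ideal_exists:
  assumes "alg_ideal R I" "(\<lambda>_. 1) \<notin> I"
  shows "\<exists>M. alg_ideal R M \<and> I \<subseteq> M \<and> (\<lambda>_. 1) \<notin> M \<and>
    (\<forall>J. alg_ideal R J \<longrightarrow> M \<subseteq> J \<longrightarrow> (\<lambda>_. 1) \<notin> J \<longrightarrow> J = M)"
proof -
  define \<A> where "\<A> = {J. alg_ideal R J \<and> I \<subseteq> J \<and> (\<lambda>_. 1) \<notin> J}"
  have "I \<in> \<A>" using assms by (simp add: \<A>_def)
  have "\<Union>\<C> \<in> \<A>" if ne: "\<C> \<noteq> {}" and chain: "subset.chain \<A> \<C>" for \<C>
  proof -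
    have sub: "\<C> \<subseteq> \<A>" and lin: "\<And>J J'. J \<in> \<C> \<Longrightarrow> J' \<in> \<C> \<Longrightarrow> J \<subseteq> J' \<or> J' \<subseteq> J"
      using chain by (auto simp: subset_chain_def)
    have "(\<lambda>x. f x + g x) \<in> \<Union>\<C>" if fg: "f \<in> \<Union>\<C>" "g \<in> \<Union>\<C>" for f g
    proof -
      obtain J J' where "J \<in> \<C>" "f \<in> J" "J' \<in> \<C>" "g \<in> J'" using fg by blast
      then obtain J0 where "J0 \<in> \<C>" "f \<in> J0" "g \<in> J0" using lin[of J J'] by blast
      moreover have "alg_ideal R J0" using \<open>J0 \<in> \<C>\<close> sub by (auto simp: \<A>_def)
      ultimately show ?thesis unfolding alg_ideal_def by blast
    qed
    moreover have "(\<lambda>x. f x * g x) \<in> \<Union>\<C>" if "f \<in> R" "g \<in> \<Union>\<C>" for f g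
      using that sub unfolding \<A>_def alg_ideal_def by blast
    moreover have "\<Union>\<C> \<subseteq> R" "(\<lambda>_. 0) \<in> \<Union>\<C>" "I \<subseteq> \<Union>\<C>" "(\<lambda>_. 1) \<notin> \<Union>\<C>"
      using ne sub unfolding \<A>_def alg_ideal_def by blast+
    ultimately show ?thesis unfolding \<A>_def alg_ideal_def by blast
  qed
  then obtain M where "M \<in> \<A>" "\<forall>J\<in>\<A>. M \<subseteq> J \<longrightarrow> J = M"
    using subset_Zorn_nonempty[of \<A>] \<open>I \<in> \<A>\<close> by blast
  then show ?thesis unfolding \<A>_def by (intro exI[of _ M]) auto
qed

text \<open>The classical argument for uncountable fields: if \<open>t - c\<close> were invertible modulo a maximal
  ideal for all \<open>c\<close>, the uncountably many inverses would satisfy a linear relation, and clearing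
  denominators would make \<open>t\<close> algebraic.\<close>

lemma nullstellensatz:
  fixes R :: "('a \<Rightarrow> complex) set"
  assumes R: "fun_alg R" and B: "countable B" "R \<subseteq> fs.span B"
    and I: "alg_ideal R I" "(\<lambda>_. 1) \<notin> I"
  shows "\<exists>\<phi>. (\<forall>c. \<phi> (\<lambda>_. c) = c) \<and> (\<forall>f\<in>R. \<forall>g\<in>R. \<phi> (\<lambda>x. f x + g x) = \<phi> f + \<phi> g) \<and>
    (\<forall>f\<in>R. \<forall>g\<in>R. \<phi> (\<lambda>x. f x * g x) = \<phi> f * \<phi> g) \<and> (\<forall>f\<in>I. \<phi> f = 0)"
proof -
  obtain M where M: "alg_ideal R M" "I \<subseteq> M" "(\<lambda>_. 1) \<notin> M"
    and max: "\<And>J. alg_ideal R J \<Longrightarrow> M \<subseteq> J \<Longrightarrow> (\<lambda>_. 1) \<notin> J \<Longrightarrow> J = M"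
    using maximal_ideal_exists[OF I] by blast
  have MR: "f \<in> R" if "f \<in> M" for f using M(1) that by (auto simp: alg_ideal_def)
  have M0: "(\<lambda>_. 0) \<in> M" using M(1) by (auto simp: alg_ideal_def)
  have Madd: "(\<lambda>x. f x + g x) \<in> M" if "f \<in> M" "g \<in> M" for f g
    using M(1) that by (auto simp: alg_ideal_def)
  have Mmult: "(\<lambda>x. f x * g x) \<in> M" if "f \<in> R" "g \<in> M" for f g
    using M(1) that by (auto simp: alg_ideal_def)
  have Mcmult: "(\<lambda>x. c * g x) \<in> M" if "g \<in> M" for g c
    using Mmult[OF fun_alg_const[OF R] that] .
  have Mdiff: "(\<lambda>x. f x - g x) \<in> M" if "f \<in> M" "g \<in> M" for f g
    using Madd[OF that(1) Mcmult[OF that(2), of "-1"]] by simp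
  have Msum: "(\<lambda>x. \<Sum>i\<in>D. f i x) \<in> M" if "\<And>i. i \<in> D \<Longrightarrow> f i \<in> M" for D :: "real set" and f
    using that
  proof (induction D rule: infinite_finite_induct)
    case (insert i D)
    then show ?case using Madd[of "f i" "\<lambda>x. \<Sum>i\<in>D. f i x"] by simp
  qed (simp_all add: M0)
  have Mconst: "c = 0" if "(\<lambda>_. c) \<in> M" for c
    using Mcmult[OF that, of "1 / c"] M(3) by (cases "c = 0") simp_all
  \<comment> \<open>By maximality the ideal generated by \<open>M\<close> and \<open>t\<close>
    contains \<open>1\<close>, so \<open>t\<close> is invertible modulo \<open>M\<close>.\<close>
  have inv: "\<exists>s\<in>R. (\<lambda>x. s x * t x - 1) \<in> M" if t: "t \<in> R" "t \<notin> M" for t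
  proof -
    define J where "J = {(\<lambda>x. m x + s x * t x) | m s. m \<in> M \<and> s \<in> R}"
    have J_memI: "g \<in> J" if "m \<in> M" "s \<in> R" "g = (\<lambda>x. m x + s x * t x)" for m s g
      using that unfolding J_def by blast
    have "M \<subseteq> J"
    proof
      fix m assume "m \<in> M"
      then show "m \<in> J" by (rule J_memI[of _ "\<lambda>_. 0"]) (auto intro: fun_alg_const[OF R])
    qed
    have "t \<in> J"
      by (rule J_memI[of "\<lambda>_. 0" "\<lambda>_. 1"]) (auto intro: M0 fun_alg_const[OF R])
    have "alg_ideal R J"
      unfolding alg_ideal_def
    proof (intro conjI ballI)
      show "J \<subseteq> R" unfolding J_def using MR t(1) by (auto intro: fun_alg_add[OF R] fun_alg_mult[OF R])
      show "(\<lambda>_. 0) \<in> J" using M0 \<open>M \<subseteq> J\<close> by blast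
    next
      fix f g assume "f \<in> J" "g \<in> J"
      then obtain m s m' s' where *: "m \<in> M" "s \<in> R" "m' \<in> M" "s' \<in> R"
        "f = (\<lambda>x. m x + s x * t x)" "g = (\<lambda>x. m' x + s' x * t x)" unfolding J_def by blast
      show "(\<lambda>x. f x + g x) \<in> J"
        by (rule J_memI[of "\<lambda>x. m x + m' x" "\<lambda>x. s x + s' x"])
          (use * in \<open>auto simp: algebra_simps intro: Madd fun_alg_add[OF R]\<close>)
    next
      fix f g assume "f \<in> R" "g \<in> J"
      then obtain m s where *: "m \<in> M" "s \<in> R" "g = (\<lambda>x. m x + s x * t x)" unfolding J_def by blast
      show "(\<lambda>x. f x * g x) \<in> J"
        by (rule J_memI[of "\<lambda>x. f x * m x" "\<lambda>x. f x * s x"])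
          (use * \<open>f \<in> R\<close> in \<open>auto simp: algebra_simps intro: Mmult fun_alg_mult[OF R]\<close>)
    qed
    then have "(\<lambda>_. 1) \<in> J" using max[OF _ \<open>M \<subseteq> J\<close>] t(2) \<open>t \<in> J\<close> by blast
    then obtain m s where ms: "m \<in> M" "s \<in> R" "(\<lambda>_. 1) = (\<lambda>x. m x + s x * t x)" unfolding J_def by blast
    then have "(\<lambda>x. s x * t x - 1) = (\<lambda>x. -1 * m x)" by (auto simp: fun_eq_iff algebra_simps)
    then show ?thesis using Mcmult[OF ms(1), of "-1"] ms(2) by (intro bexI[of _ s]) simp_all
  qed
  have polyR: "(\<lambda>x. poly p (t x)) \<in> R" if "t \<in> R" for t p
  proof (induction p)
    case 0
    show ?case using fun_alg_const[OF R, of 0] by simp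
  next
    case (pCons a p)
    then show ?case
      using fun_alg_add[OF R fun_alg_const[OF R, of a] fun_alg_mult[OF R that pCons.IH]] by simp
  qed
  \<comment> \<open>Induction on the degree: split off a root \<open>z\<close> of \<open>p\<close>.
    If \<open>t - z\<close> is not in \<open>M\<close>, its inverse modulo \<open>M\<close> cancels
    that factor and leaves a polynomial of smaller degree.\<close>
  have alg: "\<exists>c. (\<lambda>x. t x - c) \<in> M" if "t \<in> R" "p \<noteq> 0" "(\<lambda>x. poly p (t x)) \<in> M" for t p
    using that
  proof (induction "degree p" arbitrary: p rule: less_induct)
    case less
    show ?case
    proof (cases "degree p = 0")
      case True
      then obtain c where "p = [:c:]" by (metis degree_eq_zeroE)
      then show ?thesis using less.prems Mconst[of c] by simp
    next
      case False
      then obtain z where "poly p z = 0"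
        using fundamental_theorem_of_algebra[of p] by (auto simp: constant_degree)
      then obtain q where q: "p = [:- z, 1:] * q" by (metis dvdE poly_eq_0_iff_dvd)
      then have q0: "q \<noteq> 0" using less.prems by auto
      then have deg: "degree q < degree p" unfolding q by (subst degree_mult_eq) auto
      show ?thesis
      proof (cases "(\<lambda>x. t x - z) \<in> M")
        case False
        then obtain s where s: "s \<in> R" "(\<lambda>x. s x * (t x - z) - 1) \<in> M"
          using inv[OF fun_alg_diff[OF R less.prems(1) fun_alg_const[OF R]]] by blast
        have "(\<lambda>x. s x * poly p (t x) - poly q (t x) * (s x * (t x - z) - 1)) \<in> M"
          by (rule Mdiff[OF Mmult[OF s(1) less.prems(3)] Mmult[OF polyR[OF less.prems(1)] s(2)]])
        also have "(\<lambda>x. s x * poly p (t x) - poly q (t x) * (s x * (t x - z) - 1)) = (\<lambda>x. poly q (t x))"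
          by (auto simp: q algebra_simps)
        finally show ?thesis using less.hyps[OF deg less.prems(1) q0] by blast
      qed blast
    qed
  qed
  have ex: "\<exists>c. (\<lambda>x. t x - c) \<in> M" if t: "t \<in> R" for t
  proof (rule ccontr)
    assume no: "\<not> ?thesis"
    \<comment> \<open>Real shifts are already uncountably many.\<close>
    have "\<forall>r::real. \<exists>s\<in>R. (\<lambda>x. s x * (t x - of_real r) - 1) \<in> M"
    proof
      fix r :: real
      have "(\<lambda>x. t x - of_real r) \<in> R" by (intro fun_alg_diff[OF R] t fun_alg_const[OF R])
      then show "\<exists>s\<in>R. (\<lambda>x. s x * (t x - of_real r) - 1) \<in> M" using inv no by blast
    qed
    then obtain s where s: "\<And>r. s r \<in> R" "\<And>r::real. (\<lambda>x. s r x * (t x - of_real r) - 1) \<in> M" by metis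
    \<comment> \<open>If the inverses for two different shifts agreed, subtracting the two
      congruences would put this inverse, and then \<open>1\<close>, into \<open>M\<close>.\<close>
    have "inj s"
    proof (rule injI, rule ccontr)
      fix r r' assume eq: "s r = s r'" "r \<noteq> r'"
      have "(\<lambda>x. (s r x * (t x - of_real r') - 1) - (s r x * (t x - of_real r) - 1)) \<in> M"
        using Mdiff[OF s(2)[of r'] s(2)[of r]] eq(1) by simp
      also have "(\<lambda>x. (s r x * (t x - of_real r') - 1) - (s r x * (t x - of_real r) - 1)) =
          (\<lambda>x. of_real (r - r') * s r x)"
        by (auto simp: algebra_simps)
      finally have "(\<lambda>x. (1 / of_real (r - r')) * (of_real (r - r') * s r x)) \<in> M" by (rule Mcmult)
      then have "s r \<in> M" using eq(2) by simp
      then have "(\<lambda>x. (t x - of_real r) * s r x - (s r x * (t x - of_real r) - 1)) \<in> M"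
        using Mdiff[OF Mmult[OF fun_alg_diff[OF R t fun_alg_const[OF R]]] s(2)] by blast
      then show False using M(3) by (simp add: mult.commute)
    qed
    obtain e :: "nat \<Rightarrow> 'a \<Rightarrow> complex" where e: "B \<subseteq> range e"
      using B(1) by (metis countable_subset_image uncountable_def order_refl empty_subsetI)
    have "\<exists>n. s r \<in> fs.span (e ` {..<n})" for r
    proof -
      have "s r \<in> fs.span B" using s(1) B(2) by blast
      then obtain T a where T: "finite T" "T \<subseteq> B" "s r = (\<Sum>v\<in>T. (\<lambda>x. a v * v x))"
        unfolding fs.span_explicit by blast
      obtain n where "T \<subseteq> e ` {..<n}"
      proof -
        have "T \<subseteq> range e" using T(2) e by blast
        then obtain D where D: "finite D" "T = e ` D"
          using finite_subset_image[OF T(1)] by blast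
        then obtain n where "D \<subseteq> {..<n}" using finite_nat_iff_bounded by blast
        then show ?thesis using that D(2) by blast
      qed
      then have "s r \<in> fs.span (e ` {..<n})"
        unfolding T(3) by (intro fs.span_sum fs.span_scale fs.span_base) blast
      then show ?thesis by blast
    qed
    \<comment> \<open>The spans of the finite initial segments exhaust the span of \<open>B\<close>.
      One of these countably many spaces therefore contains \<open>s r\<close> for uncountably many
      \<open>r\<close>, which forces a linear relation.\<close>
    then have cover: "(UNIV :: real set) = (\<Union>n. {r. s r \<in> fs.span (e ` {..<n})})" by blast
    have "\<exists>n. uncountable {r. s r \<in> fs.span (e ` {..<n})}"
    proof (rule ccontr)
      assume "\<not> ?thesis"
      then have "countable (\<Union>n. {r. s r \<in> fs.span (e ` {..<n})})" by (intro countable_UN) auto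
      then show False using uncountable_UNIV_real unfolding cover[symmetric] by blast
    qed
    then obtain n where n: "infinite {r. s r \<in> fs.span (e ` {..<n})}"
      using countable_finite by blast
    have "fs.dependent (s ` {r. s r \<in> fs.span (e ` {..<n})})"
    proof (rule ccontr)
      assume "fs.independent (s ` {r. s r \<in> fs.span (e ` {..<n})})"
      then have "finite (s ` {r. s r \<in> fs.span (e ` {..<n})})"
        using fs.independent_span_bound[of "e ` {..<n}"] by auto
      then show False using n \<open>inj s\<close> finite_imageD inj_on_subset by blast
    qed
    then obtain T a v where T: "finite T" "T \<subseteq> range s" "(\<Sum>v\<in>T. (\<lambda>x. a v * v x)) = 0" "v \<in> T" "a v \<noteq> 0"
      unfolding fs.dependent_explicit by blast
    then obtain D where D: "finite D" "T = s ` D"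
      using finite_subset_image[of T s UNIV] by blast
    then obtain r0 where r0: "r0 \<in> D" "a (s r0) \<noteq> 0" using T(4,5) by blast
    define b where "b r = a (s r)" for r
    have "inj_on s D" using \<open>inj s\<close> inj_on_subset by blast
    then have "(\<Sum>r\<in>D. (\<lambda>x. b r * s r x)) = 0"
      using T(3) by (simp add: D(2) sum.reindex b_def)
    then have rel: "(\<Sum>r\<in>D. b r * s r x) = 0" for x
      by (metis (mono_tags, lifting) sum_fun_apply zero_fun_apply sum.cong)
    \<comment> \<open>Modulo \<open>M\<close> the relation reads as the vanishing of the sum of
      \<open>b r / (t - r)\<close>. Clearing denominators gives \<open>p\<close>, and at
      \<open>r0\<close> only the summand of \<open>r0\<close> survives, so \<open>p\<close> is not
      zero.\<close>
    define P where "P r = (\<Prod>r'\<in>D - {r}. [:- of_real r', 1 :: complex:])" for r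
    define p where "p = (\<Sum>r\<in>D. smult (b r) (P r))"
    have "poly (P r) (of_real r0) = 0" if "r \<in> D" "r \<noteq> r0" for r
      using that D(1) r0(1) unfolding P_def poly_prod by (intro prod_zero) auto
    then have "poly p (of_real r0) = b r0 * poly (P r0) (of_real r0)"
      unfolding p_def poly_sum using D(1) r0(1)
      by (subst sum.remove[of _ r0]) (auto intro!: sum.neutral)
    moreover have "poly (P r0) (of_real r0) \<noteq> 0"
      unfolding P_def poly_prod using D(1) by (auto simp: prod_zero_iff)
    ultimately have "poly p (of_real r0) \<noteq> 0" using r0 by (simp add: b_def)
    then have "p \<noteq> 0" by auto
    \<comment> \<open>Each summand is a multiple of a congruence for \<open>s r\<close>. Expanding,
      the parts with \<open>s r\<close> share the factor \<open>W\<close> and cancel by the linear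
      relation, which holds pointwise and not only modulo \<open>M\<close>.\<close>
    have "(\<lambda>x. \<Sum>r\<in>D. b r * (poly (P r) (t x) * (s r x * (t x - of_real r) - 1))) \<in> M"
      by (rule Msum, rule Mcmult, rule Mmult, rule polyR[OF t], rule s(2))
    moreover have "(\<Sum>r\<in>D. b r * (poly (P r) (t x) * (s r x * (t x - of_real r) - 1))) = - 1 * poly p (t x)" for x
    proof -
      define W where "W = (\<Prod>r'\<in>D. t x - of_real r')"
      have W: "W = poly (P r) (t x) * (t x - of_real r)" if "r \<in> D" for r
        unfolding P_def W_def poly_prod using D(1) that by (subst prod.remove[of D r]) auto
      have "(\<Sum>r\<in>D. b r * (poly (P r) (t x) * (s r x * (t x - of_real r) - 1))) =
          (\<Sum>r\<in>D. W * (b r * s r x) - b r * poly (P r) (t x))"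
      proof (intro sum.cong refl)
        fix r assume "r \<in> D"
        show "b r * (poly (P r) (t x) * (s r x * (t x - of_real r) - 1)) = W * (b r * s r x) - b r * poly (P r) (t x)"
          unfolding W[OF \<open>r \<in> D\<close>] by (simp add: algebra_simps)
      qed
      also have "\<dots> = - 1 * poly p (t x)"
        by (simp add: sum_subtractf sum_distrib_left[symmetric] rel p_def poly_sum)
      finally show ?thesis .
    qed
    ultimately have "(\<lambda>x. -1 * (- 1 * poly p (t x))) \<in> M" using Mcmult[of "\<lambda>x. - 1 * poly p (t x)" "-1"] by simp
    then show False using alg[OF t \<open>p \<noteq> 0\<close>] no by simp
  qed
  \<comment> \<open>The constant is unique because \<open>M\<close> contains no nonzero constant;
    this makes \<open>\<phi>\<close> additive and multiplicative.\<close>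
  define \<phi> where "\<phi> t = (SOME c. (\<lambda>x. t x - c) \<in> M)" for t
  have \<phi>: "(\<lambda>x. t x - \<phi> t) \<in> M" if "t \<in> R" for t
    unfolding \<phi>_def using someI_ex[OF ex[OF that]] .
  have \<phi>_eq: "\<phi> t = c" if "t \<in> R" "(\<lambda>x. t x - c) \<in> M" for t c
    using Mconst[of "\<phi> t - c"] Mdiff[OF that(2) \<phi>[OF that(1)]] by simp
  have "\<phi> (\<lambda>_. c) = c" for c by (rule \<phi>_eq) (auto simp: M0 fun_alg_const[OF R])
  moreover have "\<phi> (\<lambda>x. f x + g x) = \<phi> f + \<phi> g" if "f \<in> R" "g \<in> R" for f g
  proof (rule \<phi>_eq)
    show "(\<lambda>x. f x + g x - (\<phi> f + \<phi> g)) \<in> M"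
      using Madd[OF \<phi>[OF that(1)] \<phi>[OF that(2)]] by (simp add: algebra_simps)
  qed (intro fun_alg_add[OF R] that)
  moreover have "\<phi> (\<lambda>x. f x * g x) = \<phi> f * \<phi> g" if "f \<in> R" "g \<in> R" for f g
  proof (rule \<phi>_eq)
    show "(\<lambda>x. f x * g x - \<phi> f * \<phi> g) \<in> M"
      using Madd[OF Mmult[OF that(1) \<phi>[OF that(2)]] Mcmult[OF \<phi>[OF that(1)], of "\<phi> g"]]
      by (simp add: algebra_simps)
  qed (intro fun_alg_mult[OF R] that)
  moreover have "\<phi> f = 0" if "f \<in> I" for f
    by (rule \<phi>_eq) (use that M(2) MR in auto)
  ultimately show ?thesis by blast
qed

section \<open>Tensor products of matrices and the action\<close>

lemma mat_adjoint_carrier: "A \<in> carrier_mat n m \<Longrightarrow> mat_adjoint A \<in> carrier_mat m n"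
  by (auto simp: mat_adjoint_def mat_of_rows_def)

lemma dim_mat_adjoint: "dim_row (mat_adjoint A) = dim_col A" "dim_col (mat_adjoint A) = dim_row A"
  by (auto simp: mat_adjoint_def mat_of_rows_def)

lemma index_mat_adjoint:
  fixes A :: "complex mat"
  shows "i < dim_col A \<Longrightarrow> j < dim_row A \<Longrightarrow> mat_adjoint A $$ (i, j) = cnj (A $$ (j, i))"
  by (simp add: mat_adjoint_def mat_of_rows_index)

lemma index_mult_mat_sum:
  assumes "A \<in> carrier_mat n m" "B \<in> carrier_mat m k" "i < n" "j < k"
  shows "(A * B) $$ (i, j) = (\<Sum>l<m. A $$ (i, l) * B $$ (l, j))"
  using assms by (auto simp: scalar_prod_def atLeast0LessThan intro!: sum.cong)

lemma square_mult_carrier: "A \<in> carrier_mat n n \<Longrightarrow> B \<in> carrier_mat n n \<Longrightarrow> A * B \<in> carrier_mat n n"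
  by simp

lemma square_assoc:
  "A \<in> carrier_mat n n \<Longrightarrow> B \<in> carrier_mat n n \<Longrightarrow> C \<in> carrier_mat n n \<Longrightarrow> (A * B) * C = A * (B * C :: 'a::semiring_0 mat)"
  by (rule assoc_mult_mat)

lemma mat_adjoint_mult:
  fixes A B :: "complex mat"
  assumes "A \<in> carrier_mat n m" "B \<in> carrier_mat m k"
  shows "mat_adjoint (A * B) = mat_adjoint B * mat_adjoint A"
proof (rule eq_matI)
  fix i j assume "i < dim_row (mat_adjoint B * mat_adjoint A)" "j < dim_col (mat_adjoint B * mat_adjoint A)"
  then have ij: "i < k" "j < n" using assms by (auto simp: dim_mat_adjoint)
  have "mat_adjoint (A * B) $$ (i, j) = cnj ((A * B) $$ (j, i))"
    using ij assms by (subst index_mat_adjoint) auto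
  also have "\<dots> = (\<Sum>l<m. mat_adjoint B $$ (i, l) * mat_adjoint A $$ (l, j))"
    using ij assms by (subst index_mult_mat_sum[OF assms]) (auto simp: index_mat_adjoint mult.commute)
  also have "\<dots> = (mat_adjoint B * mat_adjoint A) $$ (i, j)"
    by (rule index_mult_mat_sum[OF mat_adjoint_carrier[OF assms(2)] mat_adjoint_carrier[OF assms(1)] ij, symmetric])
  finally show "mat_adjoint (A * B) $$ (i, j) = (mat_adjoint B * mat_adjoint A) $$ (i, j)" .
qed (use assms in \<open>auto simp: dim_mat_adjoint\<close>)

lemma mat_adjoint_adjoint:
  fixes A :: "complex mat"
  shows "mat_adjoint (mat_adjoint A) = A"
  by (rule eq_matI) (auto simp: dim_mat_adjoint index_mat_adjoint)

lemma mat_adjoint_one: "mat_adjoint (1\<^sub>m n :: complex mat) = 1\<^sub>m n"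
  by (rule eq_matI) (auto simp: dim_mat_adjoint index_mat_adjoint)

lemma kron_carrier:
  "A \<in> carrier_mat n m \<Longrightarrow> B \<in> carrier_mat n' m' \<Longrightarrow> kron A B \<in> carrier_mat (n * n') (m * m')"
  by (auto simp: kron_def)

lemma index_kron:
  assumes "A \<in> carrier_mat n m" "B \<in> carrier_mat n' m'" "i < n * n'" "j < m * m'"
  shows "kron A B $$ (i, j) = A $$ (i div n', j div m') * B $$ (i mod n', j mod m')"
  using assms by (auto simp: kron_def)

lemma div_mod_less:
  assumes "i < n * (m::nat)"
  shows "i div m < n" "i mod m < m"
  using assms by (simp add: less_mult_imp_div_less) (cases m, use assms in auto)

text \<open>The quotient and the remainder of \<open>k\<close> by \<open>m\<close> run
  independently; this splits the inner index of a product of Kronecker products.\<close>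

lemma sum_div_mod:
  fixes f :: "nat \<Rightarrow> nat \<Rightarrow> 'a::comm_monoid_add"
  shows "(\<Sum>k<n * m. f (k div m) (k mod m)) = (\<Sum>a<n. \<Sum>b<m. f a b)"
proof -
  have "(\<Sum>a<n. \<Sum>b<m. f a b) = (\<Sum>a<n. \<Sum>k\<in>{a * m..<a * m + m}. f (k div m) (k mod m))"
  proof (rule sum.cong[OF refl])
    fix a
    have "(\<Sum>k\<in>{a * m..<a * m + m}. f (k div m) (k mod m)) =
        (\<Sum>b\<in>{0..<m}. f ((b + a * m) div m) ((b + a * m) mod m))"
      using sum.shift_bounds_nat_ivl[of "\<lambda>k. f (k div m) (k mod m)" 0 "a * m" m] by (simp add: add.commute)
    also have "\<dots> = (\<Sum>b<m. f a b)"
      by (rule sum.cong) auto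
    finally show "(\<Sum>b<m. f a b) = (\<Sum>k\<in>{a * m..<a * m + m}. f (k div m) (k mod m))" by simp
  qed
  then show ?thesis by (simp add: sum.nat_group)
qed

lemma kron_mult:
  fixes A B C D :: "'a::comm_semiring_1 mat"
  assumes A: "A \<in> carrier_mat n m" and B: "B \<in> carrier_mat n' m'"
    and C: "C \<in> carrier_mat m k" and D: "D \<in> carrier_mat m' k'"
  shows "kron A B * kron C D = kron (A * C) (B * D)"
proof (rule eq_matI)
  fix i j assume "i < dim_row (kron (A * C) (B * D))" "j < dim_col (kron (A * C) (B * D))"
  then have ij: "i < n * n'" "j < k * k'" using assms by (auto simp: kron_def)
  have "(kron A B * kron C D) $$ (i, j) = (\<Sum>l<m * m'. kron A B $$ (i, l) * kron C D $$ (l, j))"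
    by (rule index_mult_mat_sum[OF kron_carrier[OF A B] kron_carrier[OF C D] ij])
  also have "\<dots> = (\<Sum>l<m * m'. (A $$ (i div n', l div m') * C $$ (l div m', j div k')) *
      (B $$ (i mod n', l mod m') * D $$ (l mod m', j mod k')))"
    using ij by (intro sum.cong refl) (simp add: index_kron[OF A B] index_kron[OF C D] mult_ac)
  also have "\<dots> = (\<Sum>a<m. \<Sum>b<m'. (A $$ (i div n', a) * C $$ (a, j div k')) *
      (B $$ (i mod n', b) * D $$ (b, j mod k')))"
    by (rule sum_div_mod)
  also have "\<dots> = (A * C) $$ (i div n', j div k') * (B * D) $$ (i mod n', j mod k')"
    using div_mod_less[OF ij(1)] div_mod_less[OF ij(2)]
    by (simp add: index_mult_mat_sum[OF A C] index_mult_mat_sum[OF B D] sum_product)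
  also have "\<dots> = kron (A * C) (B * D) $$ (i, j)"
    using ij assms by (subst index_kron[of _ n k _ n' k']) auto
  finally show "(kron A B * kron C D) $$ (i, j) = kron (A * C) (B * D) $$ (i, j)" .
qed (use assms in \<open>auto simp: kron_def\<close>)

lemma kron_one: "kron (1\<^sub>m n) (1\<^sub>m m) = 1\<^sub>m (n * m)"
proof (rule eq_matI)
  fix i j assume "i < dim_row (1\<^sub>m (n * m))" "j < dim_col (1\<^sub>m (n * m))"
  then have ij: "i < n * m" "j < n * m" by auto
  have "i = j \<longleftrightarrow> i div m = j div m \<and> i mod m = j mod m" by (metis div_mod_decomp)
  then show "kron (1\<^sub>m n) (1\<^sub>m m) $$ (i, j) = 1\<^sub>m (n * m) $$ (i, j)"
    using ij div_mod_less[OF ij(1)] div_mod_less[OF ij(2)]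
    by (auto simp: index_kron[OF one_carrier_mat one_carrier_mat ij])
qed (auto simp: kron_def)

lemma kron_adjoint:
  fixes A B :: "complex mat"
  shows "mat_adjoint (kron A B) = kron (mat_adjoint A) (mat_adjoint B)"
proof (rule eq_matI)
  fix i j assume "i < dim_row (kron (mat_adjoint A) (mat_adjoint B))" "j < dim_col (kron (mat_adjoint A) (mat_adjoint B))"
  then have ij: "i < dim_col A * dim_col B" "j < dim_row A * dim_row B"
    by (auto simp: kron_def dim_mat_adjoint)
  then show "mat_adjoint (kron A B) $$ (i, j) = kron (mat_adjoint A) (mat_adjoint B) $$ (i, j)"
    using div_mod_less[OF ij(1)] div_mod_less[OF ij(2)]
    by (simp add: kron_def dim_mat_adjoint index_mat_adjoint)
qed (auto simp: kron_def dim_mat_adjoint)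

section \<open>Tuples of local operators and their group structure\<close>

definition square_mats :: "nat list \<Rightarrow> complex mat list set" where
  "square_mats ds = {gs. list_all2 (\<lambda>g d. g \<in> carrier_mat d d) gs ds}"

definition gmul :: "complex mat list \<Rightarrow> complex mat list \<Rightarrow> complex mat list" where
  "gmul gs hs = map2 (*) gs hs"

lemma square_mats_nth: "gs \<in> square_mats ds \<longleftrightarrow>
    length gs = length ds \<and> (\<forall>i<length ds. gs ! i \<in> carrier_mat (ds ! i) (ds ! i))"
  by (auto simp: square_mats_def list_all2_conv_all_nth)

lemma square_mats_Cons:
  "gs \<in> square_mats (d # ds) \<longleftrightarrow> (\<exists>g hs. gs = g # hs \<and> g \<in> carrier_mat d d \<and> hs \<in> square_mats ds)"
  by (auto simp: square_mats_def list_all2_Cons2)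

lemma square_mats_Nil: "gs \<in> square_mats [] \<longleftrightarrow> gs = []"
  by (auto simp: square_mats_def)

lemma tensor_carrier: "gs \<in> square_mats ds \<Longrightarrow> tensor gs \<in> carrier_mat (prod_list ds) (prod_list ds)"
proof (induction ds arbitrary: gs)
  case (Cons d ds)
  then obtain g hs where "gs = g # hs" "g \<in> carrier_mat d d" "hs \<in> square_mats ds"
    by (auto simp: square_mats_Cons)
  then show ?case using kron_carrier[of g d d "tensor hs"] Cons.IH by simp
qed (simp add: square_mats_Nil)

lemma tensor_gmul:
  "gs \<in> square_mats ds \<Longrightarrow> hs \<in> square_mats ds \<Longrightarrow> tensor (gmul gs hs) = tensor gs * tensor hs"
proof (induction ds arbitrary: gs hs)
  case (Cons d ds)
  then obtain g gs' h hs' where *: "gs = g # gs'" "hs = h # hs'" "g \<in> carrier_mat d d" "h \<in> carrier_mat d d"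
    "gs' \<in> square_mats ds" "hs' \<in> square_mats ds"
    by (auto simp: square_mats_Cons)
  show ?case
    using Cons.IH[OF *(5,6)] kron_mult[OF *(3) tensor_carrier[OF *(5)] *(4) tensor_carrier[OF *(6)]]
    by (simp add: * gmul_def)
qed (auto simp: gmul_def square_mats_Nil)

lemma tensor_ones: "tensor (map 1\<^sub>m ds) = 1\<^sub>m (prod_list ds)"
  by (induction ds) (auto simp: kron_one)

lemma tensor_adjoint:
  fixes gs :: "complex mat list"
  shows "tensor (map mat_adjoint gs) = mat_adjoint (tensor gs)"
  by (induction gs) (auto simp: kron_adjoint mat_adjoint_one)

text \<open>The positions \<open>a\<close> and \<open>b\<close> are the digits of \<open>p\<close>
  and \<open>q\<close> in the mixed radix \<open>ds\<close> and do not depend on \<open>gs\<close>.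
  So an entry of the tensor product is a fixed monomial in the entries of the factors, which later
  gives regularity, rationality along curves and the value of characters.\<close>

lemma tensor_entry:
  "p < prod_list ds \<Longrightarrow> q < prod_list ds \<Longrightarrow>
   \<exists>a b. (\<forall>i<length ds. a i < ds ! i \<and> b i < ds ! i) \<and>
     (\<forall>gs\<in>square_mats ds. tensor gs $$ (p, q) = (\<Prod>i<length ds. gs ! i $$ (a i, b i)))"
proof (induction ds arbitrary: p q)
  case Nil
  then show ?case by (auto simp: square_mats_Nil)
next
  case (Cons d ds)
  define N where "N = prod_list ds"
  have p: "p div N < d" "p mod N < N" and q: "q div N < d" "q mod N < N"
    using Cons.prems div_mod_less[of p d N] div_mod_less[of q d N] by (auto simp: N_def)
  obtain a b where ab: "\<forall>i<length ds. a i < ds ! i \<and> b i < ds ! i"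
    "\<And>gs. gs \<in> square_mats ds \<Longrightarrow> tensor gs $$ (p mod N, q mod N) = (\<Prod>i<length ds. gs ! i $$ (a i, b i))"
    using Cons.IH[of "p mod N" "q mod N"] p q by (auto simp: N_def)
  define a' where "a' i = (case i of 0 \<Rightarrow> p div N | Suc j \<Rightarrow> a j)" for i
  define b' where "b' i = (case i of 0 \<Rightarrow> q div N | Suc j \<Rightarrow> b j)" for i
  have "a' i < (d # ds) ! i \<and> b' i < (d # ds) ! i" if "i < length (d # ds)" for i
    using that ab(1) p q by (cases i) (auto simp: a'_def b'_def)
  moreover have "tensor gs $$ (p, q) = (\<Prod>i<length (d # ds). gs ! i $$ (a' i, b' i))"
    if gs: "gs \<in> square_mats (d # ds)" for gs
  proof -
    obtain g hs where *: "gs = g # hs" "g \<in> carrier_mat d d" "hs \<in> square_mats ds"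
      using gs by (auto simp: square_mats_Cons)
    have "tensor gs $$ (p, q) = g $$ (p div N, q div N) * tensor hs $$ (p mod N, q mod N)"
      using index_kron[OF *(2) tensor_carrier[OF *(3)]] Cons.prems by (simp add: * N_def)
    then show ?thesis
      using ab(2)[OF *(3)] by (simp add: * prod.lessThan_Suc_shift a'_def b'_def del: prod.lessThan_Suc)
  qed
  ultimately show ?case by blast
qed

lemma listset_map: "gs \<in> listset (map F ds) \<longleftrightarrow> list_all2 (\<lambda>g d. g \<in> F d) gs ds"
  by (induction ds arbitrary: gs) (auto simp: set_Cons_def list_all2_Cons2)

lemma GL_prod_nth: "gs \<in> GL_prod ds \<longleftrightarrow> length gs = length ds \<and> (\<forall>i<length ds. gs ! i \<in> GL (ds ! i))"
  by (auto simp: GL_prod_def listset_map list_all2_conv_all_nth)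

lemma U_prod_nth: "gs \<in> U_prod ds \<longleftrightarrow> length gs = length ds \<and> (\<forall>i<length ds. gs ! i \<in> U (ds ! i))"
  by (auto simp: U_prod_def listset_map list_all2_conv_all_nth)

lemma gmul_nth: "i < length gs \<Longrightarrow> i < length hs \<Longrightarrow> gmul gs hs ! i = gs ! i * hs ! i"
  by (simp add: gmul_def)

lemma length_gmul: "length (gmul gs hs) = min (length gs) (length hs)"
  by (simp add: gmul_def)

lemma GL_iff: "g \<in> GL d \<longleftrightarrow> g \<in> carrier_mat d d \<and> (\<exists>h\<in>carrier_mat d d. g * h = 1\<^sub>m d)"
proof (intro iffI conjI)
  assume "g \<in> GL d"
  then show "g \<in> carrier_mat d d" by (simp add: GL_def)
  then obtain h where h: "g * h = 1\<^sub>m (dim_row g)" "h * g = 1\<^sub>m (dim_row h)"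
    using \<open>g \<in> GL d\<close> by (auto simp: GL_def invertible_mat_def inverts_mat_def)
  have "dim_col h = d" using arg_cong[OF h(1), of dim_col] \<open>g \<in> carrier_mat d d\<close> by simp
  moreover have "dim_row h = d" using arg_cong[OF h(2), of dim_col] \<open>g \<in> carrier_mat d d\<close> by simp
  ultimately show "\<exists>h\<in>carrier_mat d d. g * h = 1\<^sub>m d" using h \<open>g \<in> carrier_mat d d\<close> by auto
next
  assume "g \<in> carrier_mat d d \<and> (\<exists>h\<in>carrier_mat d d. g * h = 1\<^sub>m d)"
  then obtain h where h: "g \<in> carrier_mat d d" "h \<in> carrier_mat d d" "g * h = 1\<^sub>m d" by blast
  then have "h * g = 1\<^sub>m d" by (rule mat_mult_left_right_inverse)
  then show "g \<in> GL d" using h by (auto simp: GL_def invertible_mat_def inverts_mat_def)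
qed

lemma U_right: "u \<in> U d \<Longrightarrow> u * mat_adjoint u = 1\<^sub>m d"
  by (rule mat_mult_left_right_inverse[of _ d]) (auto simp: U_def mat_adjoint_carrier)

lemma U_subset_GL: "U d \<subseteq> GL d"
proof
  fix u assume u: "u \<in> U d"
  then have "u \<in> carrier_mat d d" by (simp add: U_def)
  then show "u \<in> GL d" using U_right[OF u] mat_adjoint_carrier by (auto simp: GL_iff)
qed

lemma U_mult:
  assumes "u \<in> U d" "v \<in> U d"
  shows "u * v \<in> U d"
proof -
  have c: "u \<in> carrier_mat d d" "v \<in> carrier_mat d d" and u: "mat_adjoint u * u = 1\<^sub>m d"
    and v: "mat_adjoint v * v = 1\<^sub>m d"
    using assms by (auto simp: U_def)
  note a = mat_adjoint_carrier[OF c(1)] mat_adjoint_carrier[OF c(2)]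
  have "mat_adjoint (u * v) * (u * v) = mat_adjoint v * (mat_adjoint u * u) * v"
    using c a by (simp add: mat_adjoint_mult[OF c] square_assoc[of _ d] square_mult_carrier[of _ d])
  then show ?thesis using c a u v by (simp add: U_def)
qed

lemma GL_mult:
  assumes "g \<in> GL d" "h \<in> GL d"
  shows "g * h \<in> GL d"
proof -
  obtain g' h' where c: "g \<in> carrier_mat d d" "g' \<in> carrier_mat d d" "h \<in> carrier_mat d d" "h' \<in> carrier_mat d d"
    and i: "g * g' = 1\<^sub>m d" "h * h' = 1\<^sub>m d" using assms by (auto simp: GL_iff)
  have "(g * h) * (h' * g') = g * (h * h') * g'"
    using c by (simp add: square_assoc[of _ d] square_mult_carrier[of _ d])
  also have "\<dots> = 1\<^sub>m d" using c i by simp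
  finally show ?thesis unfolding GL_iff using c by (intro conjI bexI[of _ "h' * g'"] square_mult_carrier) auto
qed

lemma U_prod_subset: "U_prod ds \<subseteq> GL_prod ds" "GL_prod ds \<subseteq> square_mats ds"
  using subsetD[OF U_subset_GL] by (auto simp: U_prod_nth GL_prod_nth square_mats_nth GL_iff)

lemma U_prod_gmul: "us \<in> U_prod ds \<Longrightarrow> vs \<in> U_prod ds \<Longrightarrow> gmul us vs \<in> U_prod ds"
  by (auto simp: U_prod_nth gmul_nth length_gmul U_mult)

lemma GL_prod_gmul: "gs \<in> GL_prod ds \<Longrightarrow> hs \<in> GL_prod ds \<Longrightarrow> gmul gs hs \<in> GL_prod ds"
  by (auto simp: GL_prod_nth gmul_nth length_gmul GL_mult)

lemma ones_U_prod: "map 1\<^sub>m ds \<in> U_prod ds"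
  by (auto simp: U_prod_nth U_def mat_adjoint_one)

lemma U_prod_inverse:
  assumes "us \<in> U_prod ds"
  shows "map mat_adjoint us \<in> U_prod ds" "gmul us (map mat_adjoint us) = map 1\<^sub>m ds"
    "gmul (map mat_adjoint us) us = map 1\<^sub>m ds"
proof -
  have us: "length us = length ds" "\<And>i. i < length ds \<Longrightarrow> us ! i \<in> U (ds ! i)"
    using assms by (auto simp: U_prod_nth)
  show "map mat_adjoint us \<in> U_prod ds"
    unfolding U_prod_nth
  proof (intro conjI allI impI)
    fix i assume i: "i < length ds"
    show "map mat_adjoint us ! i \<in> U (ds ! i)"
      using us(1) i us(2)[OF i] U_right[OF us(2)[OF i]]
      by (simp add: U_def mat_adjoint_carrier mat_adjoint_adjoint)
  qed (simp add: us)
  show "gmul us (map mat_adjoint us) = map 1\<^sub>m ds"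
    using us U_right by (intro nth_equalityI) (auto simp: gmul_nth length_gmul)
  show "gmul (map mat_adjoint us) us = map 1\<^sub>m ds"
    using us by (intro nth_equalityI) (auto simp: gmul_nth length_gmul U_def)
qed

lemma GL_prod_inverse:
  assumes "gs \<in> GL_prod ds"
  obtains hs where "hs \<in> GL_prod ds" "gmul gs hs = map 1\<^sub>m ds" "gmul hs gs = map 1\<^sub>m ds"
proof -
  have "\<forall>i. \<exists>h. i < length ds \<longrightarrow> h \<in> carrier_mat (ds ! i) (ds ! i) \<and> gs ! i * h = 1\<^sub>m (ds ! i)"
    using assms by (auto simp: GL_prod_nth GL_iff)
  then obtain h where h: "\<And>i. i < length ds \<Longrightarrow> h i \<in> carrier_mat (ds ! i) (ds ! i)"
      "\<And>i. i < length ds \<Longrightarrow> gs ! i * h i = 1\<^sub>m (ds ! i)"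
    by metis
  have gs: "length gs = length ds" "\<And>i. i < length ds \<Longrightarrow> gs ! i \<in> carrier_mat (ds ! i) (ds ! i)"
    using assms by (auto simp: GL_prod_nth GL_iff)
  have h': "h i * gs ! i = 1\<^sub>m (ds ! i)" if "i < length ds" for i
    using mat_mult_left_right_inverse[OF gs(2)[OF that] h(1)[OF that] h(2)[OF that]] .
  show ?thesis
  proof
    show "map h [0..<length ds] \<in> GL_prod ds" using h h' gs by (auto simp: GL_prod_nth GL_iff intro!: bexI[of _ "gs ! _"])
    show "gmul gs (map h [0..<length ds]) = map 1\<^sub>m ds"
      using h gs by (intro nth_equalityI) (auto simp: gmul_nth length_gmul)
    show "gmul (map h [0..<length ds]) gs = map 1\<^sub>m ds"
      using h' gs by (intro nth_equalityI) (auto simp: gmul_nth length_gmul)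
  qed
qed

section \<open>The conjugation action\<close>

text \<open>Removes the option in \<open>conj_act\<close>: for an invertible tensor product
  \<open>mat_inverse\<close> succeeds, and its value is the given inverse \<open>T\<close>.\<close>

lemma conj_act_eq:
  assumes gs: "gs \<in> square_mats ds" and T: "T \<in> carrier_mat (prod_list ds) (prod_list ds)"
    "tensor gs * T = 1\<^sub>m (prod_list ds)"
  shows "conj_act gs A = tensor gs * A * T"
proof -
  let ?N = "prod_list ds"
  note c = tensor_carrier[OF gs]
  have left: "T * tensor gs = 1\<^sub>m ?N" using mat_mult_left_right_inverse[OF c T] .
  have "mat_inverse (tensor gs) \<noteq> None"
  proof
    assume "mat_inverse (tensor gs) = None"
    from mat_inverse(1)[OF c this, of "()"] show False
      using c T left by (auto simp: Units_def ring_mat_def)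
  qed
  then obtain B where B: "mat_inverse (tensor gs) = Some B" by blast
  have "B \<in> carrier_mat ?N ?N" "tensor gs * B = 1\<^sub>m ?N" using mat_inverse(2)[OF c B] by auto
  then have "B = T * tensor gs * B" using left by simp
  also have "\<dots> = T * (tensor gs * B)" using T c \<open>B \<in> _\<close> by (intro assoc_mult_mat) auto
  also have "\<dots> = T" using T \<open>tensor gs * B = 1\<^sub>m ?N\<close> by simp
  finally show ?thesis by (simp add: conj_act_def B)
qed

lemma conj_act_inverse:
  assumes "gs \<in> square_mats ds" "hs \<in> square_mats ds" "gmul gs hs = map 1\<^sub>m ds"
  shows "conj_act gs A = tensor gs * A * tensor hs"
  using conj_act_eq[OF assms(1) tensor_carrier[OF assms(2)]] tensor_gmul[OF assms(1,2)]
  by (simp add: assms(3) tensor_ones)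

lemma conj_act_U:
  assumes "us \<in> U_prod ds"
  shows "conj_act us A = tensor us * A * mat_adjoint (tensor us)"
proof -
  have "us \<in> square_mats ds" "map mat_adjoint us \<in> square_mats ds"
    using U_prod_inverse(1)[OF assms] assms U_prod_subset by blast+
  from conj_act_inverse[OF this U_prod_inverse(2)[OF assms]] show ?thesis by (simp add: tensor_adjoint)
qed

lemma conj_act_carrier:
  assumes "gs \<in> GL_prod ds" "A \<in> End_V ds"
  shows "conj_act gs A \<in> End_V ds"
proof -
  obtain hs where hs: "hs \<in> GL_prod ds" "gmul gs hs = map 1\<^sub>m ds" using GL_prod_inverse[OF assms(1)] .
  then have sq: "gs \<in> square_mats ds" "hs \<in> square_mats ds" using assms(1) U_prod_subset(2) by blast+
  show ?thesis
    using assms(2) sq[THEN tensor_carrier] unfolding conj_act_inverse[OF sq hs(2)] End_V_def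
    by (intro square_mult_carrier)
qed

lemma conj_act_gmul:
  assumes gs: "gs \<in> GL_prod ds" and hs: "hs \<in> GL_prod ds" and A: "A \<in> End_V ds"
  shows "conj_act (gmul gs hs) A = conj_act gs (conj_act hs A)"
proof -
  obtain gi where gi: "gi \<in> GL_prod ds" "gmul gs gi = map 1\<^sub>m ds" using GL_prod_inverse[OF gs] .
  obtain hi where hi: "hi \<in> GL_prod ds" "gmul hs hi = map 1\<^sub>m ds" using GL_prod_inverse[OF hs] .
  have sq: "gs \<in> square_mats ds" "hs \<in> square_mats ds" "gi \<in> square_mats ds" "hi \<in> square_mats ds"
    "gmul gs hs \<in> square_mats ds" "gmul hi gi \<in> square_mats ds"
    using gs hs gi(1) hi(1) GL_prod_gmul U_prod_subset(2) by blast+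
  let ?N = "prod_list ds"
  note c = sq(1-4)[THEN tensor_carrier]
  have A': "A \<in> carrier_mat ?N ?N" using A by (simp add: End_V_def)
  have inv: "tensor gs * tensor gi = 1\<^sub>m ?N" "tensor hs * tensor hi = 1\<^sub>m ?N"
    using gi hi tensor_gmul[OF sq(1,3)] tensor_gmul[OF sq(2,4)] by (auto simp: tensor_ones)
  have "(tensor gs * tensor hs) * (tensor hi * tensor gi) = tensor gs * (tensor hs * tensor hi) * tensor gi"
    using c by (simp add: square_assoc[of _ ?N] square_mult_carrier[of _ ?N])
  also have "\<dots> = 1\<^sub>m ?N" using c inv by simp
  finally have "conj_act (gmul gs hs) A = (tensor gs * tensor hs) * A * (tensor hi * tensor gi)"
    using conj_act_eq[OF sq(5) square_mult_carrier[OF c(4,3)]] by (simp add: tensor_gmul[OF sq(1,2)])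
  also have "\<dots> = tensor gs * (tensor hs * A * tensor hi) * tensor gi"
    using c A' by (simp add: square_assoc[of _ ?N] square_mult_carrier[of _ ?N])
  finally show ?thesis
    using conj_act_inverse[OF sq(1,3) gi(2)] conj_act_inverse[OF sq(2,4) hi(2)] by simp
qed

lemma conj_act_ones:
  assumes "A \<in> End_V ds"
  shows "conj_act (map 1\<^sub>m ds) A = A"
proof -
  have "map 1\<^sub>m ds \<in> square_mats ds" by (auto simp: square_mats_nth)
  from conj_act_eq[OF this, of "1\<^sub>m (prod_list ds)"] show ?thesis
    using assms by (simp add: tensor_ones End_V_def)
qed

definition tact :: "complex mat list \<Rightarrow> complex mat list \<Rightarrow> complex mat list" where
  "tact gs X = map (conj_act gs) X"

lemma tact_tuples: "gs \<in> GL_prod ds \<Longrightarrow> X \<in> End_V_tuples ds m \<Longrightarrow> tact gs X \<in> End_V_tuples ds m"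
  by (auto simp: tact_def End_V_tuples_def intro: conj_act_carrier)

lemma tact_gmul:
  assumes "gs \<in> GL_prod ds" "hs \<in> GL_prod ds" "X \<in> End_V_tuples ds m"
  shows "tact (gmul gs hs) X = tact gs (tact hs X)"
  using conj_act_gmul[OF assms(1,2)] assms(3) by (auto simp: tact_def End_V_tuples_def)

lemma tact_ones: "X \<in> End_V_tuples ds m \<Longrightarrow> tact (map 1\<^sub>m ds) X = X"
  by (auto simp: tact_def End_V_tuples_def conj_act_ones intro!: map_idI)

section \<open>Representative functions on the unitary group\<close>

text \<open>Polynomials in the entries and their conjugates. On unitary tuples the conjugates are
  the entries of the inverses, so the restrictions form the coordinate ring of the complexification
  \<open>GL_prod ds\<close>.\<close>

inductive_set reg :: "nat list \<Rightarrow> (complex mat list \<Rightarrow> complex) set" for ds :: "nat list" where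
  const: "(\<lambda>gs. c) \<in> reg ds"
| entry: "i < length ds \<Longrightarrow> a < ds ! i \<Longrightarrow> b < ds ! i \<Longrightarrow> (\<lambda>gs. gs ! i $$ (a, b)) \<in> reg ds"
| cnj_entry: "i < length ds \<Longrightarrow> a < ds ! i \<Longrightarrow> b < ds ! i \<Longrightarrow> (\<lambda>gs. cnj (gs ! i $$ (a, b))) \<in> reg ds"
| add: "f \<in> reg ds \<Longrightarrow> g \<in> reg ds \<Longrightarrow> (\<lambda>gs. f gs + g gs) \<in> reg ds"
| mult: "f \<in> reg ds \<Longrightarrow> g \<in> reg ds \<Longrightarrow> (\<lambda>gs. f gs * g gs) \<in> reg ds"

lemma fun_alg_reg: "fun_alg (reg ds)"
  by (auto simp: fun_alg_def intro: reg.intros)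

lemma fun_alg_poly_ring: "fun_alg (poly_ring ds m)"
  by (auto simp: fun_alg_def intro: poly_ring.intros)

lemma reg_cnj: "f \<in> reg ds \<Longrightarrow> (\<lambda>gs. cnj (f gs)) \<in> reg ds"
  by (induction rule: reg.induct) (auto intro: reg.intros)

lemma U_column_sum:
  assumes "u \<in> U d" "a < d" "b < d"
  shows "(\<Sum>c<d. cnj (u $$ (c, a)) * u $$ (c, b)) = (if a = b then 1 else 0)"
proof -
  have u: "u \<in> carrier_mat d d" "mat_adjoint u * u = 1\<^sub>m d" using assms(1) by (auto simp: U_def)
  have "(mat_adjoint u * u) $$ (a, b) = (\<Sum>c<d. mat_adjoint u $$ (a, c) * u $$ (c, b))"
    by (rule index_mult_mat_sum[OF mat_adjoint_carrier[OF u(1)] u(1) assms(2,3)])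
  also have "\<dots> = (\<Sum>c<d. cnj (u $$ (c, a)) * u $$ (c, b))"
    using u(1) assms(2) by (intro sum.cong refl) (auto simp: index_mat_adjoint)
  finally show ?thesis using assms(2,3) by (simp add: u(2))
qed

lemma U_entry_norm:
  assumes "u \<in> U d" "a < d" "b < d"
  shows "norm (u $$ (a, b)) \<le> 1"
proof -
  have "(\<Sum>c<d. complex_of_real ((norm (u $$ (c, b)))\<^sup>2)) = 1"
    using U_column_sum[OF assms(1,3,3)] by (simp only: complex_norm_square mult.commute) simp
  then have "(\<Sum>c<d. (norm (u $$ (c, b)))\<^sup>2) = 1"
    unfolding of_real_sum[symmetric] of_real_eq_1_iff .
  moreover have "(norm (u $$ (a, b)))\<^sup>2 \<le> (\<Sum>c<d. (norm (u $$ (c, b)))\<^sup>2)"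
    using assms(2) by (intro member_le_sum) auto
  ultimately show ?thesis by (simp add: power_le_one_iff abs_square_le_1)
qed

lemma reg_bounded: "f \<in> reg ds \<Longrightarrow> bounded (f ` U_prod ds)"
proof (induction rule: reg.induct)
  case (entry i a b)
  then show ?case unfolding bounded_iff
    by (intro exI[of _ 1]) (auto simp: U_prod_nth intro!: U_entry_norm[of _ "ds ! i"])
next
  case (cnj_entry i a b)
  then show ?case unfolding bounded_iff
    by (intro exI[of _ 1]) (auto simp: U_prod_nth intro!: U_entry_norm[of _ "ds ! i"])
qed (auto intro: bounded_image_add bounded_image_mult bounded_image_const)

lemma U_mult_gram:
  assumes t: "t \<in> U d" and x: "x \<in> carrier_mat d d" and y: "y \<in> carrier_mat d d" and b: "b < d"
  shows "(\<Sum>a<d. (t * x) $$ (a, b) * cnj ((t * y) $$ (a, b))) = (\<Sum>a<d. x $$ (a, b) * cnj (y $$ (a, b)))"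
proof -
  have gram: "(mat_adjoint w * z) $$ (b, b) = (\<Sum>a<d. z $$ (a, b) * cnj (w $$ (a, b)))"
    if "w \<in> carrier_mat d d" "z \<in> carrier_mat d d" for w z :: "complex mat"
    using b that by (subst index_mult_mat_sum[OF mat_adjoint_carrier[OF that(1)] that(2) b b])
      (auto simp: index_mat_adjoint mult.commute)
  have tc: "t \<in> carrier_mat d d" "mat_adjoint t * t = 1\<^sub>m d" using t by (auto simp: U_def)
  have "mat_adjoint (t * y) * (t * x) = mat_adjoint y * ((mat_adjoint t * t) * x)"
    using tc(1) x y mat_adjoint_carrier[OF tc(1)] mat_adjoint_carrier[OF y]
    by (simp add: mat_adjoint_mult[OF tc(1) y] square_assoc[of _ d] square_mult_carrier[of _ d])
  then have "mat_adjoint (t * y) * (t * x) = mat_adjoint y * x" using x tc(2) by simp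
  then show ?thesis using gram[of "t * y" "t * x"] gram[of y x] tc(1) x y by simp
qed

lemma gram_fun_cnj:
  assumes "gram_fun mul S f"
  shows "gram_fun mul S (\<lambda>s. cnj (f s))"
proof -
  obtain ps where ps: "gram_inv mul S (map snd ps)" "\<forall>s\<in>S. f s = (\<Sum>(a, v)\<leftarrow>ps. a * v s)"
    using assms by (auto simp: gram_fun_def)
  have cnj_sum: "cnj (\<Sum>i\<leftarrow>is. F i) = (\<Sum>i\<leftarrow>is. cnj (F i))" for F and "is" :: "'c list"
    by (induction "is") auto
  let ?qs = "map (\<lambda>(a, v). (cnj a, \<lambda>s. cnj (v s))) ps"
  have "(\<Sum>v\<leftarrow>map snd ?qs. v s * cnj (v s')) = cnj (\<Sum>v\<leftarrow>map snd ps. v s * cnj (v s'))" for s s'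
    by (simp add: cnj_sum o_def case_prod_unfold)
  then have "gram_inv mul S (map snd ?qs)" 
    using ps(1) by (simp only: gram_inv_def) (intro ballI arg_cong[where f = cnj], blast)
  moreover have "\<forall>s\<in>S. cnj (f s) = (\<Sum>(a, v)\<leftarrow>?qs. a * v s)"
    using ps(2) by (simp add: cnj_sum o_def case_prod_unfold)
  ultimately show ?thesis unfolding gram_fun_def by blast
qed

text \<open>Left multiplication by a unitary preserves inner products between corresponding columns,
  so the whole column \<open>b\<close> is an invariant list; the entry is one of its
  coordinates.\<close>

lemma gram_fun_entry:
  assumes i: "i < length ds" and a: "a < ds ! i" and b: "b < ds ! i"
  shows "gram_fun gmul (U_prod ds) (\<lambda>gs. gs ! i $$ (a, b))"
proof -
  define ps where "ps = map (\<lambda>c. (if c = a then 1 else 0 :: complex, \<lambda>gs::complex mat list. gs ! i $$ (c, b))) [0..<ds ! i]"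
  have "(\<Sum>(c, v)\<leftarrow>ps. c * v gs) = (\<Sum>c<ds ! i. (if c = a then 1 else 0) * gs ! i $$ (c, b))" for gs
    by (simp add: ps_def o_def sum_list_distinct_conv_sum_set atLeast0LessThan)
  also have "\<dots> gs = gs ! i $$ (a, b)" for gs
    using a by (simp add: if_distrib[where f = "\<lambda>x. x * _"] cong: if_cong)
  finally have "\<forall>gs\<in>U_prod ds. gs ! i $$ (a, b) = (\<Sum>(c, v)\<leftarrow>ps. c * v gs)" by simp
  moreover have "gram_inv gmul (U_prod ds) (map snd ps)"
  proof -
    have *: "(\<Sum>v\<leftarrow>map snd ps. v x * cnj (v y)) = (\<Sum>c<ds ! i. x ! i $$ (c, b) * cnj (y ! i $$ (c, b)))" for x y
      by (simp add: ps_def o_def sum_list_distinct_conv_sum_set atLeast0LessThan)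
    show ?thesis
      unfolding gram_inv_def *
    proof (intro ballI)
      fix t x y assume "t \<in> U_prod ds" "x \<in> U_prod ds" "y \<in> U_prod ds"
      then have "gmul t x ! i = t ! i * x ! i" "gmul t y ! i = t ! i * y ! i" "t ! i \<in> U (ds ! i)"
        "x ! i \<in> carrier_mat (ds ! i) (ds ! i)" "y ! i \<in> carrier_mat (ds ! i) (ds ! i)"
        using i by (auto simp: U_prod_nth gmul_nth U_def)
      then show "(\<Sum>c<ds ! i. gmul t x ! i $$ (c, b) * cnj (gmul t y ! i $$ (c, b))) =
          (\<Sum>c<ds ! i. x ! i $$ (c, b) * cnj (y ! i $$ (c, b)))"
        using U_mult_gram b by simp
    qed
  qed
  ultimately show ?thesis unfolding gram_fun_def by blast
qed

lemma reg_gram: "f \<in> reg ds \<Longrightarrow> gram_fun gmul (U_prod ds) f"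
  by (induction rule: reg.induct)
    (auto intro: gram_fun_const gram_fun_add gram_fun_mult gram_fun_entry gram_fun_cnj)

lemma U_prod_square: "us \<in> U_prod ds \<Longrightarrow> us \<in> square_mats ds"
  using U_prod_subset by blast

lemma gmul_entry:
  assumes "s \<in> square_mats ds" "t \<in> square_mats ds" "i < length ds" "a < ds ! i" "b < ds ! i"
  shows "gmul s t ! i $$ (a, b) = (\<Sum>c<ds ! i. s ! i $$ (a, c) * t ! i $$ (c, b))"
  using assms index_mult_mat_sum[of "s ! i" "ds ! i" "ds ! i" "t ! i" "ds ! i" a b]
  by (simp add: square_mats_nth gmul_nth)

text \<open>Matrix multiplication is the coproduct of representative functions: the left translates
  of one function all lie in one finite-dimensional space.\<close>

lemma reg_comult:
  "f \<in> reg ds \<Longrightarrow> sep (reg ds) (reg ds) (U_prod ds) (U_prod ds) (\<lambda>s t. f (gmul s t))"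
proof (induction rule: reg.induct)
  case (entry i a b)
  have "sep (reg ds) (reg ds) (U_prod ds) (U_prod ds) (\<lambda>s t. \<Sum>c<ds ! i. s ! i $$ (a, c) * t ! i $$ (c, b))"
    using entry by (intro sep_sum sep_mult sep_left sep_right fun_alg_reg reg.intros) auto
  then show ?case
    by (rule sep_cong) (use entry in \<open>simp add: gmul_entry[of _ ds] U_prod_square\<close>)
next
  case (cnj_entry i a b)
  have "sep (reg ds) (reg ds) (U_prod ds) (U_prod ds) (\<lambda>s t. \<Sum>c<ds ! i. cnj (s ! i $$ (a, c)) * cnj (t ! i $$ (c, b)))"
    using cnj_entry by (intro sep_sum sep_mult sep_left sep_right fun_alg_reg reg.intros) auto
  then show ?case
    by (rule sep_cong) (use cnj_entry in \<open>simp add: gmul_entry[of _ ds] U_prod_square\<close>)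
qed (auto intro: sep_const sep_add sep_mult fun_alg_reg)

section \<open>Compactness of the unitary group\<close>

text \<open>An embedding into a function space with the product topology, since lists of matrices
  carry no topology of their own; the value \<open>0\<close> fills the positions outside the
  tuple.\<close>

definition coords :: "nat list \<Rightarrow> complex mat list \<Rightarrow> nat \<times> nat \<times> nat \<Rightarrow> complex" where
  "coords ds gs = (\<lambda>(i, a, b). if i < length ds \<and> a < ds ! i \<and> b < ds ! i then gs ! i $$ (a, b) else 0)"

lemma continuous_on_coordinate: "continuous_on S (\<lambda>x :: 'b \<Rightarrow> complex. x \<alpha>)"
  by (rule continuous_on_subset[OF continuous_on_product_coordinates]) simp

lemma reg_continuous: "f \<in> reg ds \<Longrightarrow> \<exists>F. continuous_on UNIV F \<and> (\<forall>gs. f gs = F (coords ds gs))"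
proof (induction rule: reg.induct)
  case (const c)
  show ?case by (intro exI[of _ "\<lambda>_. c"]) auto
next
  case (entry i a b)
  then show ?case by (intro exI[of _ "\<lambda>x. x (i, a, b)"]) (auto simp: coords_def intro: continuous_on_coordinate)
next
  case (cnj_entry i a b)
  then show ?case
    by (intro exI[of _ "\<lambda>x. cnj (x (i, a, b))"])
      (auto simp: coords_def intro: continuous_on_coordinate continuous_on_cnj)
next
  case (add f g)
  then obtain F G where "continuous_on UNIV F" "\<forall>gs. f gs = F (coords ds gs)"
    "continuous_on UNIV G" "\<forall>gs. g gs = G (coords ds gs)" by blast
  then show ?case by (intro exI[of _ "\<lambda>x. F x + G x"]) (auto intro: continuous_on_add)
next
  case (mult f g)
  then obtain F G where "continuous_on UNIV F" "\<forall>gs. f gs = F (coords ds gs)"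
    "continuous_on UNIV G" "\<forall>gs. g gs = G (coords ds gs)" by blast
  then show ?case by (intro exI[of _ "\<lambda>x. F x * G x"]) (auto intro: continuous_on_mult)
qed

text \<open>Orthonormality of the columns is a family of closed conditions inside a product of
  discs, and conversely these conditions allow unitary matrices to be read off.\<close>

lemma compact_coords: "compact (coords ds ` U_prod ds)"
proof -
  define I where "I = {(i, a, b). i < length ds \<and> a < ds ! i \<and> b < ds ! i}"
  define J where "J = {(i, a, b). i < length ds \<and> a < ds ! i \<and> b < ds ! i}"
  define C where "C = {x. \<forall>\<alpha>. norm (x \<alpha> :: complex) \<le> (if \<alpha> \<in> I then 1 else 0)} \<inter>
    (\<Inter>(i, a, b)\<in>J. {x. (\<Sum>c<ds ! i. cnj (x (i, c, a)) * x (i, c, b)) = (if a = b then 1 else 0)})"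
  have "compact C" unfolding C_def
    by (intro compact_Int_closed compact_PiE_complex closed_INT ballI)
      (auto intro!: closed_Collect_eq continuous_on_sum continuous_on_mult continuous_on_cnj continuous_on_coordinate)
  moreover have "coords ds ` U_prod ds = C"
  proof (intro equalityI subsetI)
    fix x assume "x \<in> coords ds ` U_prod ds"
    then obtain us where us: "us \<in> U_prod ds" "x = coords ds us" by blast
    have "norm (x \<alpha>) \<le> (if \<alpha> \<in> I then 1 else 0)" for \<alpha>
      using us by (cases \<alpha>) (auto simp: coords_def I_def U_prod_nth intro: U_entry_norm)
    moreover have "(\<Sum>c<ds ! i. cnj (x (i, c, a)) * x (i, c, b)) = (if a = b then 1 else 0)"
      if "i < length ds" "a < ds ! i" "b < ds ! i" for i a b
      using U_column_sum[of "us ! i" "ds ! i" a b] us that by (simp add: coords_def U_prod_nth)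
    ultimately show "x \<in> C" by (auto simp: C_def J_def)
  next
    fix x assume x: "x \<in> C"
    define us where "us = map (\<lambda>i. Matrix.mat (ds ! i) (ds ! i) (\<lambda>(a, b). x (i, a, b))) [0..<length ds]"
    have "us ! i \<in> U (ds ! i)" if i: "i < length ds" for i
    proof -
      define u where "u = Matrix.mat (ds ! i) (ds ! i) (\<lambda>(a, b). x (i, a, b))"
      have uc: "u \<in> carrier_mat (ds ! i) (ds ! i)" by (simp add: u_def)
      have "mat_adjoint u * u = 1\<^sub>m (ds ! i)"
      proof (rule eq_matI)
        fix a b assume "a < dim_row (1\<^sub>m (ds ! i) :: complex mat)" "b < dim_col (1\<^sub>m (ds ! i) :: complex mat)"
        then have ab: "a < ds ! i" "b < ds ! i" by auto
        have "(mat_adjoint u * u) $$ (a, b) = (\<Sum>c<ds ! i. mat_adjoint u $$ (a, c) * u $$ (c, b))"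
          by (rule index_mult_mat_sum[OF mat_adjoint_carrier[OF uc] uc ab])
        also have "\<dots> = (\<Sum>c<ds ! i. cnj (x (i, c, a)) * x (i, c, b))"
          using ab uc by (intro sum.cong refl) (auto simp: index_mat_adjoint u_def)
        also have "\<dots> = (if a = b then 1 else 0)" using x i ab by (auto simp: C_def J_def)
        finally show "(mat_adjoint u * u) $$ (a, b) = 1\<^sub>m (ds ! i) $$ (a, b)" using ab by simp
      qed (use uc in \<open>auto simp: dim_mat_adjoint\<close>)
      then show ?thesis using uc i by (simp add: U_def us_def u_def)
    qed
    then have "us \<in> U_prod ds" by (simp add: U_prod_nth us_def)
    moreover have "coords ds us = x"
    proof
      fix \<alpha> :: "nat \<times> nat \<times> nat"
      obtain i a b where \<alpha>: "\<alpha> = (i, a, b)" by (cases \<alpha>)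
      \<comment> \<open>Radius \<open>0\<close> outside \<open>I\<close> forces the default value
        that \<open>coords\<close> has there.\<close>
      have "norm (x \<alpha>) \<le> (if \<alpha> \<in> I then 1 else 0)" using x unfolding C_def by blast
      then show "coords ds us \<alpha> = x \<alpha>" by (auto simp: \<alpha> coords_def us_def I_def split: if_splits)
    qed
    ultimately show "x \<in> coords ds ` U_prod ds" by blast
  qed
  ultimately show ?thesis by simp
qed

text \<open>The open sets where \<open>h s\<close> exceeds \<open>c\<close> contain their own index
  \<open>s\<close>, so they cover a compact space.\<close>

lemma reg_finite_cover:
  assumes h: "\<And>s. s \<in> U_prod ds \<Longrightarrow> h s \<in> reg ds" and c: "\<And>s. s \<in> U_prod ds \<Longrightarrow> Re (h s s) > c"
  shows "\<exists>S. finite S \<and> S \<subseteq> U_prod ds \<and> (\<forall>t\<in>U_prod ds. \<exists>s\<in>S. Re (h s t) > c)"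
proof -
  have "\<forall>s. \<exists>H. s \<in> U_prod ds \<longrightarrow> continuous_on UNIV H \<and> (\<forall>t. h s t = H (coords ds t))"
    using reg_continuous[OF h] by blast
  then obtain H where H: "\<And>s. s \<in> U_prod ds \<Longrightarrow> continuous_on UNIV (H s)"
    "\<And>s t. s \<in> U_prod ds \<Longrightarrow> h s t = H s (coords ds t)" by metis
  have op: "open {x. Re (H s x) > c}" if "s \<in> U_prod ds" for s
    using H(1)[OF that] by (intro open_Collect_less continuous_on_Re continuous_on_const) auto
  have cover: "coords ds ` U_prod ds \<subseteq> (\<Union>s\<in>U_prod ds. {x. Re (H s x) > c})"
    using c H(2) by fastforce
  obtain S where S: "S \<subseteq> U_prod ds" "finite S"
    "coords ds ` U_prod ds \<subseteq> (\<Union>s\<in>S. {x. Re (H s x) > c})"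
    using op cover by (rule compactE_image[OF compact_coords, where f = "\<lambda>s. {x. Re (H s x) > c}"])
  have "\<exists>s\<in>S. Re (h s t) > c" if t: "t \<in> U_prod ds" for t
  proof -
    obtain s where "s \<in> S" "Re (H s (coords ds t)) > c" using S(3) t by blast
    then show ?thesis using S(1) by (intro bexI[of _ s]) (auto simp: H(2) subset_iff)
  qed
  then show ?thesis using S(1,2) by blast
qed

lemma reg_attains_inf:
  assumes "h \<in> reg ds"
  shows "\<exists>s\<in>U_prod ds. \<forall>t\<in>U_prod ds. Re (h s) \<le> Re (h t)"
proof -
  obtain H where H: "continuous_on UNIV H" "\<forall>gs. h gs = H (coords ds gs)"
    using reg_continuous[OF assms] by blast
  have "continuous_on (coords ds ` U_prod ds) (\<lambda>x. Re (H x))"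
    using H(1) by (intro continuous_on_Re) (auto intro: continuous_on_subset)
  moreover have "coords ds ` U_prod ds \<noteq> {}" using ones_U_prod by blast
  ultimately obtain x where "x \<in> coords ds ` U_prod ds" "\<forall>y\<in>coords ds ` U_prod ds. Re (H x) \<le> Re (H y)"
    using continuous_attains_inf[OF compact_coords] by blast
  then show ?thesis using H(2) by auto
qed

section \<open>Polynomials along unitary orbits\<close>

lemma tensor_entry_reg:
  assumes "p < prod_list ds" "q < prod_list ds"
  shows "\<exists>f\<in>reg ds. \<forall>gs\<in>square_mats ds. tensor gs $$ (p, q) = f gs"
proof -
  obtain a b where ab: "\<forall>i<length ds. a i < ds ! i \<and> b i < ds ! i"
    "\<forall>gs\<in>square_mats ds. tensor gs $$ (p, q) = (\<Prod>i<length ds. gs ! i $$ (a i, b i))"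
    using tensor_entry[OF assms] by blast
  have "(\<lambda>gs. \<Prod>i<length ds. gs ! i $$ (a i, b i)) \<in> reg ds"
    using ab(1) by (intro fun_alg_prod[OF fun_alg_reg] reg.intros) auto
  then show ?thesis using ab(2)
    by (intro bexI[of _ "\<lambda>gs. \<Prod>i<length ds. gs ! i $$ (a i, b i)"]) simp_all
qed

lemma triple_mult_entry:
  assumes "A \<in> carrier_mat N N" "B \<in> carrier_mat N N" "C \<in> carrier_mat N N" "i < N" "j < N"
  shows "(A * B * C) $$ (i, j) = (\<Sum>q<N. \<Sum>p<N. A $$ (i, p) * B $$ (p, q) * C $$ (q, j))"
  unfolding index_mult_mat_sum[OF square_mult_carrier[OF assms(1,2)] assms(3,4,5)]
  by (intro sum.cong refl) (subst index_mult_mat_sum[OF assms(1,2,4)], auto simp: sum_distrib_right)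

lemma conj_act_U_entry:
  assumes "us \<in> U_prod ds" "A \<in> End_V ds" "i < prod_list ds" "j < prod_list ds"
  shows "conj_act us A $$ (i, j) =
    (\<Sum>q<prod_list ds. \<Sum>p<prod_list ds. tensor us $$ (i, p) * A $$ (p, q) * cnj (tensor us $$ (j, q)))"
proof -
  have T: "tensor us \<in> carrier_mat (prod_list ds) (prod_list ds)"
    using tensor_carrier assms(1) U_prod_subset by blast
  have "A \<in> carrier_mat (prod_list ds) (prod_list ds)" using assms(2) by (simp add: End_V_def)
  then show ?thesis
    unfolding conj_act_U[OF assms(1)]
    using T by (subst triple_mult_entry[OF T _ mat_adjoint_carrier[OF T] assms(3,4)])
      (auto simp: index_mat_adjoint assms(4))
qed

text \<open>For unitary \<open>us\<close> the inverse in the action is an adjoint. Hence entries of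
  the moved tuple are linear in \<open>X\<close>, with representative functions of \<open>us\<close>
  as coefficients.\<close>

lemma tact_sep:
  "f \<in> poly_ring ds m \<Longrightarrow>
   sep (poly_ring ds m) (reg ds) (End_V_tuples ds m) (U_prod ds) (\<lambda>X us. f (tact us X))"
proof (induction rule: poly_ring.induct)
  case (coord k i j)
  let ?N = "prod_list ds"
  have "\<forall>p q. \<exists>f. p < ?N \<longrightarrow> q < ?N \<longrightarrow> f \<in> reg ds \<and> (\<forall>gs\<in>square_mats ds. tensor gs $$ (p, q) = f gs)"
    using tensor_entry_reg by meson
  then obtain T where T: "\<And>p q. p < ?N \<Longrightarrow> q < ?N \<Longrightarrow> T p q \<in> reg ds"
    "\<And>p q gs. p < ?N \<Longrightarrow> q < ?N \<Longrightarrow> gs \<in> square_mats ds \<Longrightarrow> tensor gs $$ (p, q) = T p q gs"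
    by metis
  have "sep (poly_ring ds m) (reg ds) (End_V_tuples ds m) (U_prod ds)
      (\<lambda>X us. \<Sum>q<?N. \<Sum>p<?N. T i p us * X ! k $$ (p, q) * cnj (T j q us))"
  proof (intro sep_sum sep_mult fun_alg_reg fun_alg_poly_ring)
    fix q p assume "q \<in> {..<?N}" "p \<in> {..<?N}"
    then have qp: "q < ?N" "p < ?N" by auto
    show "sep (poly_ring ds m) (reg ds) (End_V_tuples ds m) (U_prod ds) (\<lambda>X. T i p)"
      "sep (poly_ring ds m) (reg ds) (End_V_tuples ds m) (U_prod ds) (\<lambda>X us. cnj (T j q us))"
      using qp coord by (intro sep_right fun_alg_poly_ring reg_cnj T(1); simp)+
    show "sep (poly_ring ds m) (reg ds) (End_V_tuples ds m) (U_prod ds) (\<lambda>X us. X ! k $$ (p, q))"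
      using qp coord by (intro sep_left fun_alg_reg poly_ring.coord)
  qed
  then show ?case
  proof (rule sep_cong)
    fix X us assume X: "X \<in> End_V_tuples ds m" and us: "us \<in> U_prod ds"
    have "us \<in> square_mats ds" using us U_prod_subset by blast
    moreover have "X ! k \<in> End_V ds" "length X = m" using X coord(1) by (auto simp: End_V_tuples_def)
    ultimately show "(\<Sum>q<?N. \<Sum>p<?N. T i p us * X ! k $$ (p, q) * cnj (T j q us)) = tact us X ! k $$ (i, j)"
      using coord T(2) by (simp add: tact_def conj_act_U_entry[OF us])
  qed
qed (auto intro: sep_const sep_add sep_mult fun_alg_poly_ring fun_alg_reg)

lemma tact_reg:
  assumes "f \<in> poly_ring ds m" "X \<in> End_V_tuples ds m"
  shows "\<exists>h\<in>reg ds. \<forall>us\<in>U_prod ds. f (tact us X) = h us"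
proof -
  obtain ps where ps: "set ps \<subseteq> poly_ring ds m \<times> reg ds"
    "\<forall>us\<in>U_prod ds. f (tact us X) = (\<Sum>(a, b)\<leftarrow>ps. a X * b us)"
    using tact_sep[OF assms(1)] assms(2) by (auto simp: sep_def)
  have "(\<lambda>us. \<Sum>i\<leftarrow>ps. fst i X * snd i us) \<in> reg ds"
    using ps(1) by (intro fun_alg_sum_list[OF fun_alg_reg] fun_alg_cmult[OF fun_alg_reg]) auto
  then show ?thesis using ps(2) by (intro bexI) (auto simp: case_prod_unfold)
qed

section \<open>Zariski density of the unitary group\<close>

text \<open>Off the roots of \<open>q\<close>, \<open>F\<close> is an element of the localisation of
  the polynomial ring at \<open>q\<close>. Values at the roots are left free, since inverses of
  matrices are meaningless there.\<close>

definition rational_off :: "complex poly \<Rightarrow> (complex \<Rightarrow> complex) \<Rightarrow> bool" where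
  "rational_off q F \<longleftrightarrow> (\<exists>p n. \<forall>z. poly q z \<noteq> 0 \<longrightarrow> F z * poly q z ^ n = poly p z)"

lemma rational_off_cong:
  "rational_off q F \<Longrightarrow> (\<And>z. poly q z \<noteq> 0 \<Longrightarrow> F z = G z) \<Longrightarrow> rational_off q G"
  by (auto simp: rational_off_def)

lemma rational_off_const: "rational_off q (\<lambda>z. c)"
  unfolding rational_off_def by (intro exI[of _ "[:c:]"] exI[of _ 0]) auto

lemma rational_off_quotient:
  assumes "r dvd q" "\<And>z. poly r z \<noteq> 0 \<Longrightarrow> F z * poly r z = poly s z"
  shows "rational_off q F"
proof -
  obtain r' where q: "q = r * r'" using assms(1) by blast
  have "F z * poly q z ^ 1 = poly (s * r') z" if "poly q z \<noteq> 0" for z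
    using assms(2)[of z] that by (simp add: q flip: mult.assoc)
  then show ?thesis unfolding rational_off_def by blast
qed

lemma rational_off_add:
  assumes "rational_off q F" "rational_off q G"
  shows "rational_off q (\<lambda>z. F z + G z)"
proof -
  obtain p n where F: "\<And>z. poly q z \<noteq> 0 \<Longrightarrow> F z * poly q z ^ n = poly p z"
    using assms(1) by (auto simp: rational_off_def)
  obtain p' n' where G: "\<And>z. poly q z \<noteq> 0 \<Longrightarrow> G z * poly q z ^ n' = poly p' z"
    using assms(2) by (auto simp: rational_off_def)
  have "(F z + G z) * poly q z ^ (n + n') = poly (p * q ^ n' + p' * q ^ n) z" if "poly q z \<noteq> 0" for z
    using F[OF that, symmetric] G[OF that, symmetric] by (simp add: power_add algebra_simps)
  then show ?thesis unfolding rational_off_def by blast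
qed

lemma rational_off_mult:
  assumes "rational_off q F" "rational_off q G"
  shows "rational_off q (\<lambda>z. F z * G z)"
proof -
  obtain p n where F: "\<And>z. poly q z \<noteq> 0 \<Longrightarrow> F z * poly q z ^ n = poly p z"
    using assms(1) by (auto simp: rational_off_def)
  obtain p' n' where G: "\<And>z. poly q z \<noteq> 0 \<Longrightarrow> G z * poly q z ^ n' = poly p' z"
    using assms(2) by (auto simp: rational_off_def)
  have "(F z * G z) * poly q z ^ (n + n') = poly (p * p') z" if "poly q z \<noteq> 0" for z
    using F[OF that, symmetric] G[OF that, symmetric] by (simp add: power_add algebra_simps)
  then show ?thesis unfolding rational_off_def by blast
qed

lemma fun_alg_rational_off: "fun_alg {F. rational_off q F}"
  by (auto simp: fun_alg_def intro: rational_off_const rational_off_add rational_off_mult)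

lemma rational_off_sum: "(\<And>i. i \<in> I \<Longrightarrow> rational_off q (F i)) \<Longrightarrow> rational_off q (\<lambda>z. \<Sum>i\<in>I. F i z)"
  using fun_alg_sum[OF fun_alg_rational_off, of I F q] by simp

lemma rational_off_prod: "(\<And>i. i \<in> I \<Longrightarrow> rational_off q (F i)) \<Longrightarrow> rational_off q (\<lambda>z. \<Prod>i\<in>I. F i z)"
  using fun_alg_prod[OF fun_alg_rational_off, of I F q] by simp

section \<open>Inverses along polynomial families and Cayley curves\<close>

lemma det_nonzero_inverse:
  fixes M :: "complex mat"
  assumes M: "M \<in> carrier_mat n n" and d: "det M \<noteq> 0"
  shows "\<exists>J\<in>carrier_mat n n. M * J = 1\<^sub>m n \<and> J * M = 1\<^sub>m n"
proof -
  let ?J = "(1 / det M) \<cdot>\<^sub>m adj_mat M"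
  have "M * ?J = 1\<^sub>m n" using adj_mat[OF M] M d
    by (simp add: mult_smult_distrib[of _ n n _ n]) (rule eq_matI, auto)
  moreover have "?J \<in> carrier_mat n n" using adj_mat[OF M] by simp
  ultimately show ?thesis using mat_mult_left_right_inverse[OF M] by blast
qed

lemma inverse_det_nonzero:
  fixes M :: "complex mat"
  assumes "M \<in> carrier_mat n n" "J \<in> carrier_mat n n" "M * J = 1\<^sub>m n"
  shows "det M \<noteq> 0"
proof
  assume "det M = 0"
  then have "det (M * J) = 0" by (simp add: det_mult[OF assms(1,2)])
  then show False by (simp add: assms(3))
qed

lemma inverse_mat_unique:
  fixes M :: "complex mat"
  assumes "M \<in> carrier_mat n n" "J \<in> carrier_mat n n" "K \<in> carrier_mat n n" "M * J = 1\<^sub>m n" "K * M = 1\<^sub>m n"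
  shows "J = K"
proof -
  have "J = (K * M) * J" using assms by simp
  also have "\<dots> = K * (M * J)" by (rule square_assoc[OF assms(3,1,2)])
  finally show ?thesis using assms by simp
qed

lemma comm_ring_hom_poly_eval: "comm_ring_hom (\<lambda>p. poly p (z :: complex))"
  by unfold_locales auto

lemma semiring_hom_poly_eval: "semiring_hom (\<lambda>p. poly p (z :: complex))"
  by unfold_locales auto

text \<open>The adjugate identity over polynomials, evaluated at \<open>z\<close>: inverses depend
  rationally on the parameter, with the determinant as denominator.\<close>

lemma poly_mat_inverse:
  fixes P :: "complex poly mat"
  assumes P: "P \<in> carrier_mat d d" and z: "poly (det P) z \<noteq> 0"
  defines "ev \<equiv> map_mat (\<lambda>p. poly p z)"
  shows "((1 / poly (det P) z) \<cdot>\<^sub>m ev (adj_mat P)) * ev P = 1\<^sub>m d"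
proof -
  have "ev (adj_mat P * P) = ev (adj_mat P) * ev P"
    unfolding ev_def using adj_mat(1)[OF P] P by (rule semiring_hom.mat_hom_mult[OF semiring_hom_poly_eval])
  moreover have "ev (det P \<cdot>\<^sub>m 1\<^sub>m d) = poly (det P) z \<cdot>\<^sub>m 1\<^sub>m d"
    unfolding ev_def by (rule eq_matI) auto
  ultimately have "ev (adj_mat P) * ev P = poly (det P) z \<cdot>\<^sub>m 1\<^sub>m d"
    by (simp only: adj_mat(3)[OF P])
  moreover have "((1 / poly (det P) z) \<cdot>\<^sub>m ev (adj_mat P)) * ev P =
      (1 / poly (det P) z) \<cdot>\<^sub>m (ev (adj_mat P) * ev P)"
    using adj_mat(1)[OF P] P unfolding ev_def by (intro mult_smult_assoc_mat) auto
  ultimately show ?thesis using z by (auto intro!: eq_matI)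
qed

lemma smult_mat_inverse:
  fixes M :: "complex mat"
  assumes "M \<in> carrier_mat n n" "J \<in> carrier_mat n n" "M * J = 1\<^sub>m n" "c \<noteq> 0"
  shows "(c \<cdot>\<^sub>m M) * ((1 / c) \<cdot>\<^sub>m J) = 1\<^sub>m n"
proof -
  have "(c \<cdot>\<^sub>m M) * ((1 / c) \<cdot>\<^sub>m J) = (1 / c) \<cdot>\<^sub>m (c \<cdot>\<^sub>m (M * J))"
    using assms(1,2) by (simp add: mult_smult_assoc_mat[of _ n n _ n] mult_smult_distrib[of _ n n _ n])
  then show ?thesis using assms(3,4) by (auto intro!: eq_matI)
qed

text \<open>The polynomials witness that the curve \<open>u\<close> and its inverse \<open>v\<close>
  are rational with the common denominator \<open>r\<close>. The inverse is recorded because the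
  conjugation action uses it, and away from real parameters it is no longer the adjoint.\<close>

definition unitary_curve :: "nat \<Rightarrow> complex mat \<Rightarrow> complex poly \<Rightarrow> (nat \<Rightarrow> nat \<Rightarrow> complex poly) \<Rightarrow>
    (nat \<Rightarrow> nat \<Rightarrow> complex poly) \<Rightarrow> (complex \<Rightarrow> complex mat) \<Rightarrow> (complex \<Rightarrow> complex mat) \<Rightarrow> bool" where
  "unitary_curve d B r s s' u v \<longleftrightarrow> poly r \<i> \<noteq> 0 \<and> u \<i> = B \<and>
    (\<forall>z. poly r z \<noteq> 0 \<longrightarrow> u z \<in> carrier_mat d d \<and> v z \<in> carrier_mat d d \<and> u z * v z = 1\<^sub>m d \<and>
      (\<forall>a<d. \<forall>b<d. u z $$ (a, b) * poly r z = poly (s a b) z \<and> v z $$ (a, b) * poly r z = poly (s' a b) z)) \<and>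
    (\<forall>x. poly r (complex_of_real x) \<noteq> 0 \<longrightarrow> u (complex_of_real x) \<in> U d)"

text \<open>With \<open>A = (B - 1)(B + 1)\<^sup>-\<^sup>1 = S + i T\<close> for skew-Hermitian \<open>S\<close> and \<open>T\<close>, the Cayley transforms of
  \<open>S + z T\<close> form a rational curve that is unitary for real \<open>z\<close> and passes through \<open>B\<close> at \<open>z = i\<close>.\<close>

lemma cayley_curve:
  assumes B: "B \<in> GL d" and nz: "det (1\<^sub>m d + B) \<noteq> 0"
  shows "\<exists>r s s' u v. unitary_curve d B r s s' u v"
proof -
  have Bc: "B \<in> carrier_mat d d" using B by (simp add: GL_iff)
  have B1: "1\<^sub>m d + B \<in> carrier_mat d d" using Bc by simp
  obtain J where J: "J \<in> carrier_mat d d" "(1\<^sub>m d + B) * J = 1\<^sub>m d" "J * (1\<^sub>m d + B) = 1\<^sub>m d"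
    using det_nonzero_inverse[OF B1 nz] by blast
  obtain Bi where Bi: "Bi \<in> carrier_mat d d" "B * Bi = 1\<^sub>m d" using B by (auto simp: GL_iff)
  \<comment> \<open>This is \<open>(B - 1) * (B + 1)\<close> with the second factor inverted, as
    \<open>B - 1 = (B + 1) - 2\<close>.\<close>
  define A where "A = 1\<^sub>m d - 2 \<cdot>\<^sub>m J"
  have A: "A \<in> carrier_mat d d" using J(1) unfolding A_def by (intro minus_carrier_mat smult_carrier_mat)
  \<comment> \<open>\<open>S\<close> is the skew-Hermitian part of \<open>A\<close>, and
    \<open>T\<close> is \<open>-\<i>\<close> times the Hermitian part; both are skew-Hermitian and
    \<open>A = S + \<i> T\<close>.\<close>
  define S where "S a b = (A $$ (a, b) - cnj (A $$ (b, a))) / 2" for a b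
  define T where "T a b = - \<i> * (A $$ (a, b) + cnj (A $$ (b, a))) / 2" for a b
  define PM where "PM = Matrix.mat d d (\<lambda>(a, b). [:(if a = b then 1 else 0) - S a b, - T a b:])"
  define PP where "PP = Matrix.mat d d (\<lambda>(a, b). [:(if a = b then 1 else 0) + S a b, T a b:])"
  define ev where "ev z = map_mat (\<lambda>p. poly p z)" for z :: complex
  define Mm where "Mm z = ev z PM" for z
  define Mp where "Mp z = ev z PP" for z
  define Im where "Im z = (1 / poly (det PM) z) \<cdot>\<^sub>m ev z (adj_mat PM)" for z
  define Ip where "Ip z = (1 / poly (det PP) z) \<cdot>\<^sub>m ev z (adj_mat PP)" for z
  \<comment> \<open>Both determinants are needed: \<open>PM\<close> is inverted in \<open>u\<close>
    and \<open>PP\<close> in \<open>v\<close>.\<close>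
  define r where "r = det PM * det PP"
  have PMc: "PM \<in> carrier_mat d d" and PPc: "PP \<in> carrier_mat d d" by (simp_all add: PM_def PP_def)
  have c: "Mm z \<in> carrier_mat d d" "Mp z \<in> carrier_mat d d" "Im z \<in> carrier_mat d d" "Ip z \<in> carrier_mat d d" for z
    using PMc PPc adj_mat(1)[OF PMc] adj_mat(1)[OF PPc] by (auto simp: Mm_def Mp_def Im_def Ip_def ev_def)
  have left: "Im z * Mm z = 1\<^sub>m d" "Ip z * Mp z = 1\<^sub>m d" if "poly r z \<noteq> 0" for z
    using poly_mat_inverse[OF PMc, of z] poly_mat_inverse[OF PPc, of z] that
    by (auto simp: r_def Im_def Ip_def Mm_def Mp_def ev_def)
  have right: "Mm z * Im z = 1\<^sub>m d" "Mp z * Ip z = 1\<^sub>m d" if "poly r z \<noteq> 0" for z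
    using left[OF that] mat_mult_left_right_inverse[OF c(3,1)] mat_mult_left_right_inverse[OF c(4,2)] by blast+
  have ev_mult: "ev z (X * Y) = ev z X * ev z Y" if "X \<in> carrier_mat d d" "Y \<in> carrier_mat d d" for z X Y
    unfolding ev_def using that by (rule semiring_hom.mat_hom_mult[OF semiring_hom_poly_eval])
  have det_ev: "det (ev z X) = poly (det X) z" for z X
    unfolding ev_def by (rule comm_ring_hom.hom_det[OF comm_ring_hom_poly_eval])
  note one = left_mult_one_mat[of _ d d] right_mult_one_mat[of _ d d]
  define u where "u z = Im z * Mp z" for z
  define v where "v z = Ip z * Mm z" for z
  have uc: "u z \<in> carrier_mat d d" "v z \<in> carrier_mat d d" for z
    unfolding u_def v_def by (intro square_mult_carrier c)+
  have uv: "u z * v z = 1\<^sub>m d" if "poly r z \<noteq> 0" for z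
  proof -
    have "u z * v z = Im z * ((Mp z * Ip z) * Mm z)"
      unfolding u_def v_def using c by (simp add: square_assoc[of _ d] square_mult_carrier[of _ d])
    then show ?thesis using left[OF that] right[OF that] c by (simp add: one)
  qed
  define s where "s a b = (adj_mat PM * PP) $$ (a, b) * det PP" for a b
  define s' where "s' a b = (adj_mat PP * PM) $$ (a, b) * det PM" for a b
  have entries: "u z $$ (a, b) * poly r z = poly (s a b) z" "v z $$ (a, b) * poly r z = poly (s' a b) z"
    if z: "poly r z \<noteq> 0" and ab: "a < d" "b < d" for z a b
  proof -
    have adj: "adj_mat PM \<in> carrier_mat d d" "adj_mat PP \<in> carrier_mat d d"
      using adj_mat(1)[OF PMc] adj_mat(1)[OF PPc] .
    have "u z = (1 / poly (det PM) z) \<cdot>\<^sub>m (ev z (adj_mat PM) * Mp z)"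
      unfolding u_def Im_def using adj c by (intro mult_smult_assoc_mat[of _ d d _ d]) (auto simp: ev_def)
    then have "u z = (1 / poly (det PM) z) \<cdot>\<^sub>m ev z (adj_mat PM * PP)"
      unfolding Mp_def by (simp add: ev_mult adj PPc)
    then have "u z $$ (a, b) = poly ((adj_mat PM * PP) $$ (a, b)) z / poly (det PM) z"
      using ab adj PPc by (simp add: ev_def del: index_mult_mat(1))
    then show "u z $$ (a, b) * poly r z = poly (s a b) z" using z by (simp add: s_def r_def)
    have "v z = (1 / poly (det PP) z) \<cdot>\<^sub>m (ev z (adj_mat PP) * Mm z)"
      unfolding v_def Ip_def using adj c by (intro mult_smult_assoc_mat[of _ d d _ d]) (auto simp: ev_def)
    then have "v z = (1 / poly (det PP) z) \<cdot>\<^sub>m ev z (adj_mat PP * PM)"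
      unfolding Mm_def by (simp add: ev_mult adj PMc)
    then have "v z $$ (a, b) = poly ((adj_mat PP * PM) $$ (a, b)) z / poly (det PP) z"
      using ab adj PMc by (simp add: ev_def del: index_mult_mat(1))
    then show "v z $$ (a, b) * poly r z = poly (s' a b) z" using z by (simp add: s'_def r_def)
  qed
  have Mm_entry: "Mm z $$ (a, b) = (if a = b then 1 else 0) - (S a b + z * T a b)"
    and Mp_entry: "Mp z $$ (a, b) = (if a = b then 1 else 0) + (S a b + z * T a b)"
    if "a < d" "b < d" for z a b
    using that by (simp_all add: Mm_def Mp_def ev_def PM_def PP_def)
  have ST: "S a b + \<i> * T a b = A $$ (a, b)" for a b
    by (simp add: S_def T_def field_simps)
  \<comment> \<open>At \<open>\<i>\<close> the two factors are \<open>1 - A = 2 J\<close> and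
    \<open>1 + A = 2 B J\<close>, both invertible, and their quotient is \<open>B\<close>.\<close>
  have Mm_i: "Mm \<i> = 2 \<cdot>\<^sub>m J"
    using J c(1)[of \<i>] by (intro eq_matI) (auto simp: Mm_entry ST A_def)
  have Mp_i: "Mp \<i> = 2 \<cdot>\<^sub>m (B * J)"
  proof -
    have "B * J = (1\<^sub>m d + B) * J - J"
      using Bc J(1) by (simp add: add_mult_distrib_mat[of _ d d]) (auto intro!: eq_matI)
    then have BJ: "B * J = 1\<^sub>m d - J" by (simp add: J(2))
    show ?thesis
      unfolding BJ using J(1) c(2)[of \<i>] by (intro eq_matI) (auto simp: Mp_entry ST A_def)
  qed
  have BJc: "B * J \<in> carrier_mat d d" "(1\<^sub>m d + B) * Bi \<in> carrier_mat d d"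
    by (intro square_mult_carrier Bc J(1) B1 Bi(1))+
  have BJi: "(B * J) * ((1\<^sub>m d + B) * Bi) = 1\<^sub>m d"
  proof -
    have "(B * J) * ((1\<^sub>m d + B) * Bi) = B * ((J * (1\<^sub>m d + B)) * Bi)"
      using Bc J(1) Bi(1) B1 by (simp only: square_assoc[of _ d] square_mult_carrier[of _ d])
    then show ?thesis using Bi J(3) by (simp add: one)
  qed
  have r_i: "poly r \<i> \<noteq> 0"
  proof -
    have "det (Mm \<i>) \<noteq> 0"
      unfolding Mm_i
      by (rule inverse_det_nonzero[OF _ _ smult_mat_inverse[OF J(1) B1 J(3)]]) (use J B1 in auto)
    moreover have "det (Mp \<i>) \<noteq> 0"
      unfolding Mp_i
      by (rule inverse_det_nonzero[OF _ _ smult_mat_inverse[OF BJc BJi]]) (use BJc in auto)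
    ultimately show ?thesis by (simp add: r_def Mm_def Mp_def det_ev)
  qed
  have u_i: "u \<i> = B"
  proof -
    have "Im \<i> = (1 / 2) \<cdot>\<^sub>m (1\<^sub>m d + B)"
    proof (rule inverse_mat_unique[symmetric])
      show "Mm \<i> * ((1 / 2) \<cdot>\<^sub>m (1\<^sub>m d + B)) = 1\<^sub>m d"
        unfolding Mm_i by (rule smult_mat_inverse[OF J(1) B1 J(3)]) simp
      show "Im \<i> * Mm \<i> = 1\<^sub>m d" by (rule left[OF r_i])
    qed (use c B1 in auto)
    then have "u \<i> = (1 / 2) \<cdot>\<^sub>m (1\<^sub>m d + B) * (2 \<cdot>\<^sub>m (B * J))" by (simp add: u_def Mp_i)
    also have "\<dots> = (1\<^sub>m d + B) * (B * J)"
      using B1 BJc by (simp add: mult_smult_assoc_mat[of _ d d _ d] mult_smult_distrib[of _ d d _ d])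
        (auto intro!: eq_matI)
    also have "\<dots> = ((1\<^sub>m d + B) * B) * J" by (rule square_assoc[OF B1 Bc J(1), symmetric])
    also have "(1\<^sub>m d + B) * B = B * (1\<^sub>m d + B)"
      using Bc by (simp add: add_mult_distrib_mat[of _ d d] mult_add_distrib_mat[of _ d d _ d])
    also have "B * (1\<^sub>m d + B) * J = B * ((1\<^sub>m d + B) * J)" by (rule square_assoc[OF Bc B1 J(1)])
    finally show ?thesis using Bc J(2) by (simp add: one)
  qed
  have unitary: "u (of_real x) \<in> U d" if x: "poly r (of_real x) \<noteq> 0" for x :: real
  proof -
    let ?z = "complex_of_real x"
    have skew: "cnj (S a b) = - S b a" "cnj (T a b) = - T b a" for a b
      by (simp_all add: S_def T_def field_simps)
    have Mm_adj: "mat_adjoint (Mm ?z) = Mp ?z" and Mp_adj: "mat_adjoint (Mp ?z) = Mm ?z"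
      using c[of ?z] by (auto intro!: eq_matI simp: dim_mat_adjoint index_mat_adjoint Mm_entry Mp_entry skew)
    note a = mat_adjoint_carrier[OF c(3)] mat_adjoint_carrier[OF c(1)] mat_adjoint_carrier[OF c(2)]
    have "Mp ?z * mat_adjoint (Im ?z) = mat_adjoint (Im ?z * Mm ?z)"
      by (simp add: mat_adjoint_mult[OF c(3,1)] Mm_adj)
    then have "mat_adjoint (Im ?z) = Ip ?z"
      using left[OF x] by (intro inverse_mat_unique[OF c(2) a(1) c(4)]) (simp_all add: mat_adjoint_one)
    then have u_adj: "mat_adjoint (u ?z) = Mm ?z * Ip ?z"
      by (simp add: u_def mat_adjoint_mult[OF c(3,2)] Mp_adj)
    \<comment> \<open>At a real parameter \<open>1 - Az\<close> and \<open>1 + Az\<close> are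
      adjoint to each other. They commute, so the adjoint of \<open>u\<close> becomes its
      inverse.\<close>
    define Az where "Az = Matrix.mat d d (\<lambda>(a, b). S a b + ?z * T a b)"
    have Az: "Az \<in> carrier_mat d d" by (simp add: Az_def)
    have MA: "Mm ?z = 1\<^sub>m d - Az" "Mp ?z = 1\<^sub>m d + Az"
      using c[of ?z] by (auto intro!: eq_matI simp: Az_def Mm_entry Mp_entry)
    have comm: "Mp ?z * Mm ?z = Mm ?z * Mp ?z"
    proof -
      have Y: "1\<^sub>m d - Az \<in> carrier_mat d d" using Az by (rule minus_carrier_mat)
      have "(1\<^sub>m d + Az) * (1\<^sub>m d - Az) = (1\<^sub>m d - Az) + (Az - Az * Az)"
        by (simp add: add_mult_distrib_mat[OF one_carrier_mat Az Y] mult_minus_distrib_mat[OF Az one_carrier_mat Az]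
            left_mult_one_mat[OF Y] right_mult_one_mat[OF Az])
      moreover have "(1\<^sub>m d - Az) * (1\<^sub>m d + Az) = (1\<^sub>m d - Az) + (Az - Az * Az)"
        by (simp add: mult_add_distrib_mat[OF Y one_carrier_mat Az] minus_mult_distrib_mat[OF one_carrier_mat Az Az]
            right_mult_one_mat[OF Y] left_mult_one_mat[OF Az])
      ultimately show ?thesis unfolding MA by simp
    qed
    have "Ip ?z * (Mm ?z * Mp ?z) * Ip ?z = (Ip ?z * Mm ?z) * (Mp ?z * Ip ?z)"
      using c by (simp add: square_assoc[of _ d] square_mult_carrier[of _ d])
    also have "\<dots> = Ip ?z * Mm ?z" using right[OF x] c[of ?z] by (simp add: square_mult_carrier[of _ d] one)
    finally have 1: "Ip ?z * (Mm ?z * Mp ?z) * Ip ?z = Ip ?z * Mm ?z" .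
    have "Ip ?z * (Mp ?z * Mm ?z) * Ip ?z = (Ip ?z * Mp ?z) * (Mm ?z * Ip ?z)"
      using c by (simp add: square_assoc[of _ d] square_mult_carrier[of _ d])
    also have "\<dots> = Mm ?z * Ip ?z" using left[OF x] c[of ?z] by (simp add: square_mult_carrier[of _ d] one)
    finally have "mat_adjoint (u ?z) = Ip ?z * Mm ?z" using 1 comm u_adj by simp
    then have "mat_adjoint (u ?z) * u ?z = Ip ?z * ((Mm ?z * Im ?z) * Mp ?z)"
      unfolding u_def using c by (simp add: square_assoc[of _ d] square_mult_carrier[of _ d])
    then have "mat_adjoint (u ?z) * u ?z = 1\<^sub>m d" using right[OF x] left[OF x] c[of ?z] by (simp add: one)
    then show ?thesis using uc by (simp add: U_def)
  qed
  have "unitary_curve d B r s s' u v"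
    unfolding unitary_curve_def
    by (intro conjI allI impI r_i u_i uc uv entries unitary)
  then show ?thesis by blast
qed

text \<open>A Cayley transform misses the eigenvalue \<open>-1\<close>. The product of the
  polynomials \<open>det (1 + z g)\<close> is nonzero at \<open>z = 0\<close>, so it has finitely
  many roots, and some point of the unit circle avoids this eigenvalue in all factors
  simultaneously.\<close>

lemma unit_circle_det_nonzero:
  assumes sq: "gs \<in> square_mats ds"
  shows "\<exists>\<omega>. norm \<omega> = 1 \<and> (\<forall>i<length ds. det (1\<^sub>m (ds ! i) + \<omega> \<cdot>\<^sub>m gs ! i) \<noteq> 0)"
proof -
  define P where "P i = Matrix.mat (ds ! i) (ds ! i) (\<lambda>(a, b). [:if a = b then 1 else 0, gs ! i $$ (a, b):])" for i
  have ev: "poly (det (P i)) z = det (1\<^sub>m (ds ! i) + z \<cdot>\<^sub>m gs ! i)" if "i < length ds" for i z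
  proof (rule poly_det_cong)
    have "gs ! i \<in> carrier_mat (ds ! i) (ds ! i)" using sq that by (auto simp: square_mats_nth)
    then show "poly (P i $$ (a, b)) z = (1\<^sub>m (ds ! i) + z \<cdot>\<^sub>m gs ! i) $$ (a, b)"
      if "a < ds ! i" "b < ds ! i" for a b using that by (auto simp: P_def)
    show "1\<^sub>m (ds ! i) + z \<cdot>\<^sub>m gs ! i \<in> carrier_mat (ds ! i) (ds ! i)"
      using \<open>gs ! i \<in> _\<close> by (intro add_carrier_mat smult_carrier_mat)
  qed (simp add: P_def)
  define q where "q = (\<Prod>i<length ds. det (P i))"
  have "poly q 0 \<noteq> 0"
  proof -
    have "1\<^sub>m (ds ! i) + 0 \<cdot>\<^sub>m gs ! i = 1\<^sub>m (ds ! i)" if "i < length ds" for i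
      using sq that by (auto simp: square_mats_nth intro!: eq_matI)
    then show ?thesis by (simp add: q_def poly_prod ev)
  qed
  then have "finite {z. poly q z = 0}" by (intro poly_roots_finite) auto
  moreover have "infinite (cis ` {0..1})"
  proof
    assume fin: "finite (cis ` {0..1})"
    \<comment> \<open>The interval lies in \<open>{0..pi}\<close>, where the cosine is
      injective.\<close>
    have "inj_on cis {0..1}"
    proof (rule inj_onI)
      fix x y :: real assume xy: "x \<in> {0..1}" "y \<in> {0..1}" "cis x = cis y"
      then have "cos x = cos y" by (metis cis.sel(1))
      moreover have "0 \<le> x" "x \<le> pi" "0 \<le> y" "y \<le> pi" using xy(1,2) pi_ge_two by auto
      ultimately show "x = y" by (simp add: cos_inj_pi)
    qed
    then have "finite {0..1::real}" using fin finite_imageD by blast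
    then show False by (simp add: infinite_Icc)
  qed
  ultimately obtain t where "poly q (cis t) \<noteq> 0"
    by (metis (mono_tags, lifting) finite_subset image_subsetI mem_Collect_eq)
  then show ?thesis
    by (intro exI[of _ "cis t"]) (auto simp: q_def poly_prod ev)
qed

text \<open>Move all tensor factors along Cayley curves with one common parameter. Along this
  product curve \<open>f\<close> is rational in the parameter and vanishes at all real points where
  the curve is defined, hence vanishes at \<open>\<i>\<close> too, where the curve reaches the given
  group element.\<close>

lemma unitary_dense:
  assumes f: "f \<in> poly_ring ds m" and X: "X \<in> End_V_tuples ds m"
    and zero: "\<And>us. us \<in> U_prod ds \<Longrightarrow> f (tact us X) = 0" and gs: "gs \<in> GL_prod ds"
  shows "f (tact gs X) = 0"
proof -
  let ?n = "length ds" and ?N = "prod_list ds"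
  have sq: "gs \<in> square_mats ds" using gs U_prod_subset by blast
  obtain \<omega> where \<omega>: "norm \<omega> = 1" "\<And>i. i < ?n \<Longrightarrow> det (1\<^sub>m (ds ! i) + \<omega> \<cdot>\<^sub>m gs ! i) \<noteq> 0"
    using unit_circle_det_nonzero[OF sq] by blast
  have \<omega>0: "\<omega> \<noteq> 0" using \<omega>(1) by auto
  \<comment> \<open>The rotation by \<open>\<omega>\<close> makes the Cayley transforms exist. The
    unitary scalars \<open>cs\<close> undo it and are absorbed into the tuple, which becomes
    \<open>X'\<close>.\<close>
  define Bs where "Bs = map (\<lambda>g. \<omega> \<cdot>\<^sub>m g) gs"
  define cs where "cs = map (\<lambda>d. cnj \<omega> \<cdot>\<^sub>m 1\<^sub>m d) ds"
  have \<omega>1: "\<omega> * cnj \<omega> = 1" using \<omega>(1) by (simp add: complex_norm_square[symmetric])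
  have cs: "cs \<in> U_prod ds"
  proof -
    have "mat_adjoint (cnj \<omega> \<cdot>\<^sub>m 1\<^sub>m d) * (cnj \<omega> \<cdot>\<^sub>m 1\<^sub>m d) = 1\<^sub>m d" for d
    proof -
      have "mat_adjoint (cnj \<omega> \<cdot>\<^sub>m 1\<^sub>m d) = \<omega> \<cdot>\<^sub>m 1\<^sub>m d"
        by (rule eq_matI) (auto simp: dim_mat_adjoint index_mat_adjoint)
      then have "mat_adjoint (cnj \<omega> \<cdot>\<^sub>m 1\<^sub>m d) * (cnj \<omega> \<cdot>\<^sub>m 1\<^sub>m d) = \<omega> \<cdot>\<^sub>m (cnj \<omega> \<cdot>\<^sub>m 1\<^sub>m d)"
        by (simp add: mult_smult_assoc_mat[of _ d d _ d])
      also have "\<dots> = 1\<^sub>m d" using \<omega>1 by (intro eq_matI) auto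
      finally show ?thesis .
    qed
    then show ?thesis by (simp add: U_prod_nth cs_def U_def)
  qed
  have BGL: "Bs ! i \<in> GL (ds ! i)" if i: "i < ?n" for i
  proof -
    obtain h where h: "gs ! i \<in> carrier_mat (ds ! i) (ds ! i)" "h \<in> carrier_mat (ds ! i) (ds ! i)" "gs ! i * h = 1\<^sub>m (ds ! i)"
      using gs i by (auto simp: GL_prod_nth GL_iff)
    have "(\<omega> \<cdot>\<^sub>m gs ! i) * ((1 / \<omega>) \<cdot>\<^sub>m h) = 1\<^sub>m (ds ! i)" by (rule smult_mat_inverse[OF h \<omega>0])
    then show ?thesis
      using h i sq by (auto simp: GL_iff Bs_def square_mats_nth intro!: bexI[of _ "(1 / \<omega>) \<cdot>\<^sub>m h"])
  qed
  have Bs: "Bs \<in> GL_prod ds" using BGL sq by (simp add: GL_prod_nth Bs_def square_mats_nth)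
  have Bcs: "gmul Bs cs = gs"
  proof (rule nth_equalityI)
    fix i assume "i < length (gmul Bs cs)"
    then have i: "i < ?n" using sq by (simp add: length_gmul Bs_def cs_def square_mats_nth)
    have g: "gs ! i \<in> carrier_mat (ds ! i) (ds ! i)" using sq i by (auto simp: square_mats_nth)
    have "gmul Bs cs ! i = (\<omega> \<cdot>\<^sub>m gs ! i) * (cnj \<omega> \<cdot>\<^sub>m 1\<^sub>m (ds ! i))"
      using i sq by (simp add: gmul_nth Bs_def cs_def square_mats_nth)
    also have "\<dots> = cnj \<omega> \<cdot>\<^sub>m (\<omega> \<cdot>\<^sub>m (gs ! i))"
      using g by (simp add: mult_smult_distrib[of _ "ds ! i" "ds ! i" _ "ds ! i"] right_mult_one_mat[of _ "ds ! i" "ds ! i"])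
    also have "\<dots> = gs ! i" using g \<omega>1 by (intro eq_matI) (auto simp: mult.assoc[symmetric] mult.commute)
    finally show "gmul Bs cs ! i = gs ! i" .
  qed (use sq in \<open>auto simp: length_gmul Bs_def cs_def square_mats_nth\<close>)
  define X' where "X' = tact cs X"
  have csGL: "cs \<in> GL_prod ds" using cs U_prod_subset by blast
  have X': "X' \<in> End_V_tuples ds m" unfolding X'_def by (rule tact_tuples[OF csGL X])
  have zero': "f (tact us X') = 0" if us: "us \<in> U_prod ds" for us
  proof -
    have "us \<in> GL_prod ds" using us U_prod_subset by blast
    then have "tact us X' = tact (gmul us cs) X" unfolding X'_def by (simp add: tact_gmul[OF _ csGL X])
    then show ?thesis using zero U_prod_gmul[OF us cs] by simp
  qed
  have "\<exists>r s s' u v. unitary_curve (ds ! i) (Bs ! i) r s s' u v" if i: "i < ?n" for i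
  proof (rule cayley_curve[OF BGL[OF i]])
    show "det (1\<^sub>m (ds ! i) + Bs ! i) \<noteq> 0"
      using \<omega>(2)[OF i] i sq by (simp add: Bs_def square_mats_nth)
  qed
  then obtain r s s' u v where
    curve: "\<And>i. i < ?n \<Longrightarrow> unitary_curve (ds ! i) (Bs ! i) (r i) (s i) (s' i) (u i) (v i)"
    by metis
  note curve' = curve[unfolded unitary_curve_def]
  have ri: "poly (r i) \<i> \<noteq> 0" and ui: "u i \<i> = Bs ! i" if "i < ?n" for i
    using curve'[OF that] by simp_all
  have uv: "u i z \<in> carrier_mat (ds ! i) (ds ! i) \<and> v i z \<in> carrier_mat (ds ! i) (ds ! i) \<and>
      u i z * v i z = 1\<^sub>m (ds ! i)" if "i < ?n" "poly (r i) z \<noteq> 0" for i z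
    using curve'[OF that(1)] that(2) by simp
  have entries: "u i z $$ (a, b) * poly (r i) z = poly (s i a b) z \<and>
      v i z $$ (a, b) * poly (r i) z = poly (s' i a b) z"
    if "i < ?n" "poly (r i) z \<noteq> 0" "a < ds ! i" "b < ds ! i" for i z a b
    using curve'[OF that(1)] that(2,3,4) by simp
  have uU: "u i (complex_of_real x) \<in> U (ds ! i)" if "i < ?n" "poly (r i) (complex_of_real x) \<noteq> 0" for i x
    using curve'[OF that(1)] that(2) by simp
  \<comment> \<open>A common denominator for all factors; it does not vanish at
    \<open>\<i>\<close>.\<close>
  define q where "q = (\<Prod>i<?n. r i)"
  have qr: "r i dvd q" if "i < ?n" for i unfolding q_def using that by (intro dvd_prodI) auto
  have qr0: "poly (r i) z \<noteq> 0" if "i < ?n" "poly q z \<noteq> 0" for i z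
    using qr[OF that(1)] that(2) by (auto elim!: dvdE)
  define us where "us z = map (\<lambda>i. u i z) [0..<?n]" for z
  define vs where "vs z = map (\<lambda>i. v i z) [0..<?n]" for z
  have usq: "us z \<in> square_mats ds" "vs z \<in> square_mats ds" if "poly q z \<noteq> 0" for z
    using uv qr0 that by (simp_all add: square_mats_nth us_def vs_def)
  have usvs: "gmul (us z) (vs z) = map 1\<^sub>m ds" if "poly q z \<noteq> 0" for z
    using uv qr0 that by (intro nth_equalityI) (auto simp: gmul_nth length_gmul us_def vs_def)
  have ratl_tensor: "rational_off q (\<lambda>z. tensor (us z) $$ (k, l)) \<and> rational_off q (\<lambda>z. tensor (vs z) $$ (k, l))"
    if kl: "k < ?N" "l < ?N" for k l
  proof -
    obtain a b where ab: "\<And>i. i < ?n \<Longrightarrow> a i < ds ! i \<and> b i < ds ! i"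
      and T: "\<And>gs. gs \<in> square_mats ds \<Longrightarrow> tensor gs $$ (k, l) = (\<Prod>i<?n. gs ! i $$ (a i, b i))"
      using tensor_entry[OF kl] by blast
    have "rational_off q (\<lambda>z. u i z $$ (a i, b i))" if i: "i < ?n" for i
      by (rule rational_off_quotient[OF qr[OF i], where s = "s i (a i) (b i)"]) (use entries ab i in blast)
    then have u: "rational_off q (\<lambda>z. \<Prod>i<?n. u i z $$ (a i, b i))" by (intro rational_off_prod) simp
    have "rational_off q (\<lambda>z. v i z $$ (a i, b i))" if i: "i < ?n" for i
      by (rule rational_off_quotient[OF qr[OF i], where s = "s' i (a i) (b i)"]) (use entries ab i in blast)
    then have v: "rational_off q (\<lambda>z. \<Prod>i<?n. v i z $$ (a i, b i))" by (intro rational_off_prod) simp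
    show ?thesis
    proof
      show "rational_off q (\<lambda>z. tensor (us z) $$ (k, l))"
        by (rule rational_off_cong[OF u]) (simp add: T[OF usq(1)], simp add: us_def)
      show "rational_off q (\<lambda>z. tensor (vs z) $$ (k, l))"
        by (rule rational_off_cong[OF v]) (simp add: T[OF usq(2)], simp add: vs_def)
    qed
  qed
  have "rational_off q (\<lambda>z. f (tact (us z) X'))"
    using f
  proof (induction rule: poly_ring.induct)
    case (coord k i j)
    have Xk: "X' ! k \<in> carrier_mat ?N ?N" "length X' = m" using X' coord(1) by (auto simp: End_V_tuples_def End_V_def)
    have "rational_off q (\<lambda>z. \<Sum>b<?N. \<Sum>a<?N. tensor (us z) $$ (i, a) * X' ! k $$ (a, b) * tensor (vs z) $$ (b, j))"
      using ratl_tensor coord by (intro rational_off_sum rational_off_mult rational_off_const) auto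
    then show ?case
    proof (rule rational_off_cong)
      fix z assume z: "poly q z \<noteq> 0"
      show "(\<Sum>b<?N. \<Sum>a<?N. tensor (us z) $$ (i, a) * X' ! k $$ (a, b) * tensor (vs z) $$ (b, j)) =
          tact (us z) X' ! k $$ (i, j)"
        using coord Xk triple_mult_entry[OF tensor_carrier[OF usq(1)[OF z]] Xk(1) tensor_carrier[OF usq(2)[OF z]]]
        by (simp add: tact_def conj_act_inverse[OF usq[OF z] usvs[OF z]] del: index_mult_mat(1))
    qed
  qed (auto intro: rational_off_const rational_off_add rational_off_mult)
  then obtain p e where p: "\<And>z. poly q z \<noteq> 0 \<Longrightarrow> f (tact (us z) X') * poly q z ^ e = poly p z"
    by (auto simp: rational_off_def)
  have qi: "poly q \<i> \<noteq> 0" using ri by (simp add: q_def poly_prod)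
  then have q0: "q \<noteq> 0" by auto
  have "poly p (of_real x) = 0" if x: "poly q (of_real x) \<noteq> 0" for x :: real
  proof -
    have "us (of_real x) \<in> U_prod ds" using uU qr0 x by (simp add: U_prod_nth us_def)
    then show ?thesis using p[OF x] zero' by simp
  qed
  \<comment> \<open>The factor \<open>q\<close> takes care of the real points where the curve is
    undefined, so the product vanishes on the whole real line.\<close>
  then have "poly (p * q) (of_real x) = 0" for x :: real by (cases "poly q (of_real x) = 0") auto
  then have "range complex_of_real \<subseteq> {z. poly (p * q) z = 0}" by auto
  moreover have "infinite (range complex_of_real)"
    using infinite_UNIV_char_0 finite_imageD inj_of_real by blast
  ultimately have "p * q = 0" using poly_roots_finite finite_subset by blast
  then have "poly p \<i> = 0" using q0 by simp
  then have "f (tact (us \<i>) X') = 0" using p[OF qi] qi by simp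
  moreover have "us \<i> = Bs"
    using ui sq by (intro nth_equalityI) (auto simp: us_def Bs_def square_mats_nth)
  moreover have "tact Bs X' = tact gs X" unfolding X'_def by (simp add: tact_gmul[OF Bs csGL X, symmetric] Bcs)
  ultimately show ?thesis by simp
qed

section \<open>Separation of Hermitian tuples\<close>

definition herm_tuples :: "nat list \<Rightarrow> nat \<Rightarrow> complex mat list set" where
  "herm_tuples ds m = {X \<in> End_V_tuples ds m. \<forall>A\<in>set X. hermitian A}"

text \<open>This is \<open>\<Sum>\<^sub>k tr (X\<^sub>k - Y\<^sub>k)\<^sup>2\<close>: a squared distance only on Hermitian tuples, but a polynomial.\<close>

definition sqdist :: "nat list \<Rightarrow> nat \<Rightarrow> complex mat list \<Rightarrow> complex mat list \<Rightarrow> complex" where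
  "sqdist ds m X Y = (\<Sum>k<m. \<Sum>p<prod_list ds. \<Sum>q<prod_list ds.
     (X ! k $$ (p, q) - Y ! k $$ (p, q)) * (X ! k $$ (q, p) - Y ! k $$ (q, p)))"

lemma mat_trace_mult:
  assumes "A \<in> carrier_mat n n" "B \<in> carrier_mat n n"
  shows "mat_trace (A * B) = (\<Sum>p<n. \<Sum>q<n. A $$ (p, q) * B $$ (q, p))"
  using assms unfolding mat_trace_def
  by (simp add: index_mult_mat_sum[OF assms] del: index_mult_mat(1))

lemma mat_trace_comm:
  assumes "A \<in> carrier_mat n n" "B \<in> carrier_mat n n"
  shows "mat_trace (A * B) = mat_trace (B * A)"
  unfolding mat_trace_mult[OF assms] mat_trace_mult[OF assms(2,1)]
  by (subst sum.swap) (simp add: mult.commute)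

lemma tuple_nth: "X \<in> End_V_tuples ds m \<Longrightarrow> k < m \<Longrightarrow> X ! k \<in> carrier_mat (prod_list ds) (prod_list ds)"
  and tuple_length: "X \<in> End_V_tuples ds m \<Longrightarrow> length X = m"
  by (auto simp: End_V_tuples_def End_V_def)

lemma tact_nth: "k < length X \<Longrightarrow> tact gs X ! k = conj_act gs (X ! k)"
  by (simp add: tact_def)

lemma sqdist_trace:
  assumes "X \<in> End_V_tuples ds m" "Y \<in> End_V_tuples ds m"
  shows "sqdist ds m X Y = (\<Sum>k<m. mat_trace ((X ! k - Y ! k) * (X ! k - Y ! k)))"
  unfolding sqdist_def
proof (intro sum.cong refl)
  fix k assume "k \<in> {..<m}"
  then have c: "X ! k \<in> carrier_mat (prod_list ds) (prod_list ds)" "Y ! k \<in> carrier_mat (prod_list ds) (prod_list ds)"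
    using assms tuple_nth by auto
  show "(\<Sum>p<prod_list ds. \<Sum>q<prod_list ds. (X ! k $$ (p, q) - Y ! k $$ (p, q)) * (X ! k $$ (q, p) - Y ! k $$ (q, p))) =
      mat_trace ((X ! k - Y ! k) * (X ! k - Y ! k))"
    unfolding mat_trace_mult[OF minus_carrier_mat[OF c(2), of "X ! k"] minus_carrier_mat[OF c(2), of "X ! k"]]
    using c by (intro sum.cong refl) auto
qed

text \<open>The difference of the moved tuples is the conjugated difference, and the trace of its
  square does not change, by cyclicity.\<close>

lemma sqdist_tact:
  assumes us: "us \<in> U_prod ds" and X: "X \<in> End_V_tuples ds m" and Y: "Y \<in> End_V_tuples ds m"
  shows "sqdist ds m (tact us X) (tact us Y) = sqdist ds m X Y"
proof -
  let ?N = "prod_list ds"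
  define T where "T = tensor us"
  have usGL: "us \<in> GL_prod ds" using us U_prod_subset by blast
  have T: "T \<in> carrier_mat ?N ?N" unfolding T_def by (rule tensor_carrier[OF U_prod_square[OF us]])
  note T' = mat_adjoint_carrier[OF T]
  have TT: "mat_adjoint T * T = 1\<^sub>m ?N"
    using tensor_gmul[OF U_prod_square[OF U_prod_inverse(1)[OF us]] U_prod_square[OF us]] U_prod_inverse(3)[OF us]
    by (simp add: T_def tensor_adjoint tensor_ones)
  have tr: "mat_trace ((T * A * mat_adjoint T - T * B * mat_adjoint T) * (T * A * mat_adjoint T - T * B * mat_adjoint T)) =
      mat_trace ((A - B) * (A - B))" if A: "A \<in> carrier_mat ?N ?N" and B: "B \<in> carrier_mat ?N ?N" for A B
  proof -
    have M: "A - B \<in> carrier_mat ?N ?N" using B by (rule minus_carrier_mat)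
    have "T * A * mat_adjoint T - T * B * mat_adjoint T = (T * A - T * B) * mat_adjoint T"
      by (rule minus_mult_distrib_mat[OF _ _ T', symmetric]) (use T A B in auto)
    also have "T * A - T * B = T * (A - B)" by (rule mult_minus_distrib_mat[OF T A B, symmetric])
    finally have eq: "T * A * mat_adjoint T - T * B * mat_adjoint T = T * (A - B) * mat_adjoint T" .
    have "(T * (A - B) * mat_adjoint T) * (T * (A - B) * mat_adjoint T) =
        T * ((A - B) * (mat_adjoint T * T) * (A - B) * mat_adjoint T)"
      using T T' M by (simp only: square_assoc[of _ ?N] square_mult_carrier[of _ ?N])
    also have "\<dots> = T * ((A - B) * (A - B) * mat_adjoint T)"
      unfolding TT right_mult_one_mat[OF M] ..
    finally have "mat_trace ((T * (A - B) * mat_adjoint T) * (T * (A - B) * mat_adjoint T)) =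
        mat_trace (T * ((A - B) * (A - B) * mat_adjoint T))" by simp
    also have "\<dots> = mat_trace (((A - B) * (A - B) * mat_adjoint T) * T)"
      by (rule mat_trace_comm[OF T]) (intro square_mult_carrier M T')
    also have "((A - B) * (A - B) * mat_adjoint T) * T = (A - B) * (A - B) * (mat_adjoint T * T)"
      by (rule square_assoc[OF square_mult_carrier[OF M M] T' T])
    also have "\<dots> = (A - B) * (A - B)"
      unfolding TT by (rule right_mult_one_mat[OF square_mult_carrier[OF M M]])
    finally show ?thesis unfolding eq .
  qed
  show ?thesis
    unfolding sqdist_trace[OF X Y] sqdist_trace[OF tact_tuples[OF usGL X] tact_tuples[OF usGL Y]]
    using X Y by (intro sum.cong refl)
      (simp add: tact_nth tuple_length[OF X] tuple_length[OF Y] conj_act_U[OF us] tr[unfolded T_def] tuple_nth)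
qed

lemma herm_entry:
  assumes "X \<in> herm_tuples ds m" "k < m" "p < prod_list ds" "q < prod_list ds"
  shows "X ! k $$ (q, p) = cnj (X ! k $$ (p, q))"
proof -
  have X: "X \<in> End_V_tuples ds m" using assms(1) by (simp add: herm_tuples_def)
  have "hermitian (X ! k)" using assms(1,2) tuple_length[OF X] by (auto simp: herm_tuples_def)
  then have "mat_adjoint (X ! k) $$ (q, p) = X ! k $$ (q, p)" by (simp add: hermitian_def)
  then show ?thesis using tuple_nth[OF X assms(2)] assms(3,4) by (simp add: index_mat_adjoint)
qed

lemma sqdist_herm:
  assumes "X \<in> herm_tuples ds m" "Y \<in> herm_tuples ds m"
  shows "sqdist ds m X Y = complex_of_real (\<Sum>k<m. \<Sum>p<prod_list ds. \<Sum>q<prod_list ds.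
     (norm (X ! k $$ (p, q) - Y ! k $$ (p, q)))\<^sup>2)"
  unfolding sqdist_def of_real_sum
proof (intro sum.cong refl)
  fix k p q assume "k \<in> {..<m}" "p \<in> {..<prod_list ds}" "q \<in> {..<prod_list ds}"
  then have pq: "k < m" "p < prod_list ds" "q < prod_list ds" by simp_all
  show "(X ! k $$ (p, q) - Y ! k $$ (p, q)) * (X ! k $$ (q, p) - Y ! k $$ (q, p)) =
      complex_of_real ((norm (X ! k $$ (p, q) - Y ! k $$ (p, q)))\<^sup>2)"
    unfolding herm_entry[OF assms(1) pq] herm_entry[OF assms(2) pq] complex_norm_square complex_cnj_diff ..
qed

lemma sqdist_herm_real:
  assumes "X \<in> herm_tuples ds m" "Y \<in> herm_tuples ds m"
  shows "sqdist ds m X Y = complex_of_real (Re (sqdist ds m X Y))" "Re (sqdist ds m X Y) \<ge> 0"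
  unfolding sqdist_herm[OF assms] by (auto intro!: sum_nonneg)

lemma sqdist_herm_entry:
  assumes "X \<in> herm_tuples ds m" "Y \<in> herm_tuples ds m" "k < m" "p < prod_list ds" "q < prod_list ds"
  shows "(norm (X ! k $$ (p, q) - Y ! k $$ (p, q)))\<^sup>2 \<le> Re (sqdist ds m X Y)"
proof -
  have "(norm (X ! k $$ (p, q) - Y ! k $$ (p, q)))\<^sup>2 \<le> (\<Sum>q<prod_list ds. (norm (X ! k $$ (p, q) - Y ! k $$ (p, q)))\<^sup>2)"
    using assms(5) by (intro member_le_sum) auto
  also have "\<dots> \<le> (\<Sum>p<prod_list ds. \<Sum>q<prod_list ds. (norm (X ! k $$ (p, q) - Y ! k $$ (p, q)))\<^sup>2)"
    using assms(4) by (intro member_le_sum[of p _ "\<lambda>p. \<Sum>q<prod_list ds. (norm (X ! k $$ (p, q) - Y ! k $$ (p, q)))\<^sup>2"]) (auto intro: sum_nonneg)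
  also have "\<dots> \<le> (\<Sum>k<m. \<Sum>p<prod_list ds. \<Sum>q<prod_list ds. (norm (X ! k $$ (p, q) - Y ! k $$ (p, q)))\<^sup>2)"
    using assms(3) by (intro member_le_sum[of k _ "\<lambda>k. \<Sum>p<prod_list ds. \<Sum>q<prod_list ds. (norm (X ! k $$ (p, q) - Y ! k $$ (p, q)))\<^sup>2"]) (auto intro!: sum_nonneg)
  finally show ?thesis unfolding sqdist_herm[OF assms(1,2)] by simp
qed

lemma tuples_eqI:
  assumes X: "X \<in> End_V_tuples ds m" and Y: "Y \<in> End_V_tuples ds m"
    and eq: "\<And>k p q. k < m \<Longrightarrow> p < prod_list ds \<Longrightarrow> q < prod_list ds \<Longrightarrow> X ! k $$ (p, q) = Y ! k $$ (p, q)"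
  shows "X = Y"
proof (rule nth_equalityI)
  fix k assume "k < length X"
  then have k: "k < m" using tuple_length[OF X] by simp
  show "X ! k = Y ! k"
    using tuple_nth[OF X k] tuple_nth[OF Y k] eq[OF k] by (intro eq_matI) auto
qed (simp add: tuple_length[OF X] tuple_length[OF Y])

lemma sqdist_herm_zero:
  assumes "X \<in> herm_tuples ds m" "Y \<in> herm_tuples ds m" "Re (sqdist ds m X Y) \<le> 0"
  shows "X = Y"
proof (rule tuples_eqI[of _ ds m])
  fix k p q assume "k < m" "p < prod_list ds" "q < prod_list ds"
  from sqdist_herm_entry[OF assms(1,2) this] show "X ! k $$ (p, q) = Y ! k $$ (p, q)"
    using assms(3) by (smt (verit) eq_iff_diff_eq_0 norm_eq_zero power2_eq_square zero_less_power2)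
qed (use assms in \<open>simp_all add: herm_tuples_def\<close>)

lemma tact_herm:
  assumes us: "us \<in> U_prod ds" and X: "X \<in> herm_tuples ds m"
  shows "tact us X \<in> herm_tuples ds m"
proof -
  let ?N = "prod_list ds"
  have T: "tensor us \<in> carrier_mat ?N ?N" by (rule tensor_carrier[OF U_prod_square[OF us]])
  have "hermitian (conj_act us A)" if A: "A \<in> carrier_mat ?N ?N" "hermitian A" for A
  proof -
    have "mat_adjoint (tensor us * A * mat_adjoint (tensor us)) = tensor us * (mat_adjoint A * mat_adjoint (tensor us))"
      using T A(1) mat_adjoint_mult[OF square_mult_carrier[OF T A(1)] mat_adjoint_carrier[OF T]] mat_adjoint_mult[OF T A(1)]
      by (simp add: mat_adjoint_adjoint)
    also have "\<dots> = tensor us * A * mat_adjoint (tensor us)"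
      using A(2) square_assoc[OF T A(1) mat_adjoint_carrier[OF T]] by (simp add: hermitian_def)
    finally show ?thesis by (simp add: hermitian_def conj_act_U[OF us])
  qed
  moreover have "tact us X \<in> End_V_tuples ds m"
    using X us U_prod_subset by (intro tact_tuples) (auto simp: herm_tuples_def)
  ultimately show ?thesis
    using X by (auto simp: herm_tuples_def tact_def End_V_tuples_def End_V_def)
qed

section \<open>Representative functions up to equality on the unitary group\<close>

text \<open>Expressions in \<open>tact us \<rho>\<close> agree with members of \<open>reg\<close>
  only on unitary tuples, where the inverse is the adjoint. The invariant mean does not see the
  difference.\<close>

definition regU :: "nat list \<Rightarrow> (complex mat list \<Rightarrow> complex) set" where
  "regU ds = {f. \<exists>h\<in>reg ds. \<forall>us\<in>U_prod ds. f us = h us}"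

lemma regU_reg: "f \<in> reg ds \<Longrightarrow> f \<in> regU ds"
  by (auto simp: regU_def)

lemma fun_alg_regU: "fun_alg (regU ds)"
  unfolding fun_alg_def
proof (intro conjI allI ballI)
  fix f g assume "f \<in> regU ds" "g \<in> regU ds"
  then obtain f' g' where *: "f' \<in> reg ds" "g' \<in> reg ds" "\<forall>us\<in>U_prod ds. f us = f' us" "\<forall>us\<in>U_prod ds. g us = g' us"
    by (auto simp: regU_def)
  show "(\<lambda>us. f us + g us) \<in> regU ds" "(\<lambda>us. f us * g us) \<in> regU ds"
    unfolding regU_def using * reg.add[OF *(1,2)] reg.mult[OF *(1,2)] by (auto intro!: bexI)
qed (intro regU_reg reg.const)

lemma regU_bounded:
  assumes "f \<in> regU ds"
  shows "bounded (f ` U_prod ds)"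
proof -
  obtain h where h: "h \<in> reg ds" "\<forall>us\<in>U_prod ds. f us = h us" using assms by (auto simp: regU_def)
  then have "f ` U_prod ds = h ` U_prod ds" by (intro image_cong) auto
  then show ?thesis using reg_bounded[OF h(1)] by simp
qed

lemma regU_gram:
  assumes "f \<in> regU ds"
  shows "gram_fun gmul (U_prod ds) f"
proof -
  obtain h where h: "h \<in> reg ds" "\<forall>us\<in>U_prod ds. f us = h us" using assms by (auto simp: regU_def)
  obtain ps where "gram_inv gmul (U_prod ds) (map snd ps)" "\<forall>us\<in>U_prod ds. h us = (\<Sum>(a, v)\<leftarrow>ps. a * v us)"
    using reg_gram[OF h(1)] unfolding gram_fun_def by blast
  then show ?thesis using h(2) unfolding gram_fun_def by (intro exI[of _ ps]) simp
qed

lemma sep_regU: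
  assumes "sep A (reg ds) X (U_prod ds) F" "x \<in> X"
  shows "F x \<in> regU ds"
proof -
  obtain ps where ps: "set ps \<subseteq> A \<times> reg ds" "\<forall>us\<in>U_prod ds. F x us = (\<Sum>(a, b)\<leftarrow>ps. a x * b us)"
    using assms by (auto simp: sep_def)
  have "(\<lambda>us. \<Sum>i\<leftarrow>ps. fst i x * snd i us) \<in> reg ds"
    using ps(1) by (intro fun_alg_sum_list[OF fun_alg_reg] fun_alg_cmult[OF fun_alg_reg]) auto
  then show ?thesis using ps(2) unfolding regU_def
    by (intro CollectI bexI[of _ "\<lambda>us. \<Sum>i\<leftarrow>ps. fst i x * snd i us"]) (simp_all add: case_prod_unfold)
qed

lemma sqdist_sep:
  assumes r: "\<rho> \<in> End_V_tuples ds m"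
  shows "sep (poly_ring ds m) (reg ds) (End_V_tuples ds m) (U_prod ds) (\<lambda>X us. sqdist ds m X (tact us \<rho>))"
proof -
  have sep_diff: "sep (poly_ring ds m) (reg ds) (End_V_tuples ds m) (U_prod ds)
      (\<lambda>X us. X ! k $$ (p, q) - tact us \<rho> ! k $$ (p, q))"
    if kpq: "k < m" "p < prod_list ds" "q < prod_list ds" for k p q
  proof -
    obtain h where h: "h \<in> reg ds" "\<forall>us\<in>U_prod ds. tact us \<rho> ! k $$ (p, q) = h us"
      using tact_reg[OF poly_ring.coord[OF kpq] r] by blast
    have "sep (poly_ring ds m) (reg ds) (End_V_tuples ds m) (U_prod ds) (\<lambda>X us. X ! k $$ (p, q) + -1 * h us)"
      by (intro sep_add sep_left[OF poly_ring.coord[OF kpq] fun_alg_reg] sep_right[OF fun_alg_cmult[OF fun_alg_reg h(1)] fun_alg_poly_ring])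
    then show ?thesis by (rule sep_cong) (use h(2) in simp)
  qed
  show ?thesis unfolding sqdist_def
    by (intro sep_sum sep_mult fun_alg_reg fun_alg_poly_ring sep_diff) auto
qed

text \<open>The concentration argument in its barest form: a smaller base loses against a larger one
  whatever the constant.\<close>

lemma power_ratio:
  fixes a b J :: real
  assumes "0 \<le> a" "a < b"
  shows "\<exists>N. J * a ^ N < b ^ N"
proof -
  have J: "\<bar>J\<bar> + 1 > 0" by linarith
  moreover have "a / b < 1" using assms by simp
  ultimately obtain N where "(a / b) ^ N < 1 / (\<bar>J\<bar> + 1)"
    using real_arch_pow_inv[of "1 / (\<bar>J\<bar> + 1)" "a / b"] by auto
  then have "(\<bar>J\<bar> + 1) * a ^ N < b ^ N"
    using assms J by (simp add: power_divide field_simps)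
  moreover have "J * a ^ N \<le> (\<bar>J\<bar> + 1) * a ^ N" using assms by (intro mult_right_mono) auto
  ultimately show ?thesis by (intro exI[of _ N]) linarith
qed

section \<open>Concentrating kernels\<close>

text \<open>With \<open>C\<close> above the squared distances that occur, the values at Hermitian
  \<open>X\<close> lie between \<open>0\<close> and \<open>1\<close>, and powers concentrate where
  \<open>tact us \<rho>\<close> is near \<open>X\<close>. Being polynomial in \<open>X\<close>, it
  serves as an algebraic substitute for a delta function.\<close>

definition dist_kernel :: "nat list \<Rightarrow> nat \<Rightarrow> complex mat list \<Rightarrow> real \<Rightarrow> complex mat list \<Rightarrow> complex mat list \<Rightarrow> complex" where
  "dist_kernel ds m \<rho> C X us = 1 - sqdist ds m X (tact us \<rho>) / of_real C"

context
  fixes ds :: "nat list" and m :: nat and \<rho> :: "complex mat list" and C :: real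
    and M :: "(complex mat list \<Rightarrow> complex) \<Rightarrow> complex"
  assumes rho: "\<rho> \<in> herm_tuples ds m" and C: "C > 0"
    and M: "invariant_mean gmul (U_prod ds) M"
begin

lemma rho_tuple: "\<rho> \<in> End_V_tuples ds m"
  using rho by (simp add: herm_tuples_def)

lemma kernel_sep: "sep (poly_ring ds m) (reg ds) (End_V_tuples ds m) (U_prod ds) (dist_kernel ds m \<rho> C)"
proof -
  have "sep (poly_ring ds m) (reg ds) (End_V_tuples ds m) (U_prod ds)
      (\<lambda>X us. 1 + (- 1 / of_real C) * sqdist ds m X (tact us \<rho>))"
    by (intro sep_add sep_mult sep_const sqdist_sep[OF rho_tuple] fun_alg_reg fun_alg_poly_ring)
  then show ?thesis by (rule sep_cong) (simp add: dist_kernel_def)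
qed

lemma kernel_regU: "X \<in> End_V_tuples ds m \<Longrightarrow> dist_kernel ds m \<rho> C X \<in> regU ds"
  by (rule sep_regU[OF kernel_sep])

lemma kernel_gmul:
  assumes "X \<in> End_V_tuples ds m" "us \<in> U_prod ds" "vs \<in> U_prod ds"
  shows "dist_kernel ds m \<rho> C (tact us X) (gmul us vs) = dist_kernel ds m \<rho> C X vs"
proof -
  have GL: "us \<in> GL_prod ds" "vs \<in> GL_prod ds" using assms U_prod_subset by blast+
  show ?thesis
    unfolding dist_kernel_def tact_gmul[OF GL rho_tuple]
    by (simp add: sqdist_tact[OF assms(2,1) tact_tuples[OF GL(2) rho_tuple]])
qed

text \<open>The kernel is invariant when both arguments are translated, so a translation of
  \<open>X\<close> can be shifted to the weight \<open>g\<close>. Weight \<open>1\<close> gives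
  invariance of the mean; a general weight is used to average relations.\<close>

lemma mean_kernel_translate:
  assumes X: "X \<in> End_V_tuples ds m" and us: "us \<in> U_prod ds" and g: "g \<in> regU ds"
  shows "M (\<lambda>vs. dist_kernel ds m \<rho> C (tact us X) vs ^ n * g vs) =
    M (\<lambda>vs. dist_kernel ds m \<rho> C X vs ^ n * g (gmul us vs))"
proof -
  let ?f = "\<lambda>vs. dist_kernel ds m \<rho> C (tact us X) vs ^ n * g vs"
  have GL: "us \<in> GL_prod ds" using us U_prod_subset by blast
  have f: "?f \<in> regU ds"
    by (intro fun_alg_mult[OF fun_alg_regU] fun_alg_power[OF fun_alg_regU] kernel_regU tact_tuples[OF GL X] g)
  have "M ?f = M (\<lambda>vs. ?f (gmul us vs))"
    by (rule mean_translate[OF M regU_gram[OF f] regU_bounded[OF f] us, symmetric])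
  also have "\<dots> = M (\<lambda>vs. dist_kernel ds m \<rho> C X vs ^ n * g (gmul us vs))"
  proof (rule mean_cong[OF M])
    have "(\<lambda>vs. ?f (gmul us vs)) ` U_prod ds \<subseteq> ?f ` U_prod ds" using U_prod_gmul[OF us] by blast
    then show "bounded ((\<lambda>vs. ?f (gmul us vs)) ` U_prod ds)" using regU_bounded[OF f] bounded_subset by blast
  qed (simp add: kernel_gmul[OF X us])
  finally show ?thesis .
qed

lemma mean_kernel_invariant:
  assumes "X \<in> End_V_tuples ds m" "us \<in> U_prod ds"
  shows "M (\<lambda>vs. dist_kernel ds m \<rho> C (tact us X) vs ^ n) = M (\<lambda>vs. dist_kernel ds m \<rho> C X vs ^ n)"
  using mean_kernel_translate[OF assms fun_alg_const[OF fun_alg_regU], of n 1] by simp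

lemma kernel_real:
  assumes "X \<in> herm_tuples ds m" "us \<in> U_prod ds" "Re (sqdist ds m X (tact us \<rho>)) \<le> C"
  shows "dist_kernel ds m \<rho> C X us = of_real (1 - Re (sqdist ds m X (tact us \<rho>)) / C)"
    "0 \<le> 1 - Re (sqdist ds m X (tact us \<rho>)) / C" "1 - Re (sqdist ds m X (tact us \<rho>)) / C \<le> 1"
proof -
  note * = sqdist_herm_real[OF assms(1) tact_herm[OF assms(2) rho]]
  show "dist_kernel ds m \<rho> C X us = of_real (1 - Re (sqdist ds m X (tact us \<rho>)) / C)"
    unfolding dist_kernel_def by (subst *(1)) simp
  show "0 \<le> 1 - Re (sqdist ds m X (tact us \<rho>)) / C" "1 - Re (sqdist ds m X (tact us \<rho>)) / C \<le> 1"
    using *(2) assms(3) C by (simp_all add: field_simps)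
qed

text \<open>Finitely many translates of the set where the kernel exceeds \<open>b\<close> cover the unitary group, so
  the mean of the \<open>n\<close>-th power of the kernel decays at most like \<open>b\<^sup>n\<close>.\<close>

lemma mean_kernel_lower:
  assumes bound: "\<And>us vs. us \<in> U_prod ds \<Longrightarrow> vs \<in> U_prod ds \<Longrightarrow> Re (sqdist ds m (tact us \<rho>) (tact vs \<rho>)) \<le> C"
    and b: "0 < b" "b < 1"
  shows "\<exists>J>0. \<forall>n. b ^ n \<le> J * Re (M (\<lambda>vs. dist_kernel ds m \<rho> C \<rho> vs ^ n))"
proof -
  let ?K = "\<lambda>us. dist_kernel ds m \<rho> C (tact us \<rho>)"
  have herm: "tact us \<rho> \<in> herm_tuples ds m" if "us \<in> U_prod ds" for us using tact_herm[OF that rho] .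
  have "\<forall>us. \<exists>h. us \<in> U_prod ds \<longrightarrow> h \<in> reg ds \<and> (\<forall>vs\<in>U_prod ds. ?K us vs = h vs)"
    using kernel_regU herm unfolding regU_def herm_tuples_def by blast
  then obtain h where h: "\<And>us. us \<in> U_prod ds \<Longrightarrow> h us \<in> reg ds"
    "\<And>us vs. us \<in> U_prod ds \<Longrightarrow> vs \<in> U_prod ds \<Longrightarrow> ?K us vs = h us vs" by metis
  \<comment> \<open>The kernel equals \<open>1\<close> where the two tuples coincide, so every
    unitary tuple is covered by its own set.\<close>
  have hb: "Re (h us us) > b" if "us \<in> U_prod ds" for us
    using b h(2)[OF that that] by (simp add: dist_kernel_def sqdist_def)
  then obtain S where S: "finite S" "S \<subseteq> U_prod ds" "\<And>vs. vs \<in> U_prod ds \<Longrightarrow> \<exists>us\<in>S. Re (h us vs) > b"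
    using reg_finite_cover[of ds h b, OF h(1) hb] by blast
  have KregU: "(\<lambda>vs. ?K us vs ^ n) \<in> regU ds" if "us \<in> U_prod ds" for us n
    using herm[OF that] by (intro fun_alg_power[OF fun_alg_regU] kernel_regU) (simp add: herm_tuples_def)
  have "b ^ n \<le> (real (card S) + 1) * Re (M (\<lambda>vs. dist_kernel ds m \<rho> C \<rho> vs ^ n))" for n
  proof -
    let ?c = "M (\<lambda>vs. dist_kernel ds m \<rho> C \<rho> vs ^ n)"
    have real_power: "\<exists>k. ?K us vs = of_real k \<and> 0 \<le> k" if "us \<in> U_prod ds" "vs \<in> U_prod ds" for us vs
      using kernel_real[OF herm[OF that(1)] that(2) bound[OF that]] by blast
    have "norm (M (\<lambda>_. of_real (b ^ n))) \<le> Re (M (\<lambda>vs. \<Sum>us\<in>S. ?K us vs ^ n))"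
    proof (rule mean_norm_le[OF M])
      show "bounded ((\<lambda>vs. \<Sum>us\<in>S. ?K us vs ^ n) ` U_prod ds)"
        using S(2) KregU by (intro regU_bounded fun_alg_sum[OF fun_alg_regU]) blast
      fix vs assume vs: "vs \<in> U_prod ds"
      then obtain us where us: "us \<in> S" "Re (h us vs) > b" using S(3) by blast
      have nn: "Re (?K us' vs ^ n) \<ge> 0" if us': "us' \<in> S" for us'
      proof -
        obtain k where "?K us' vs = of_real k" "0 \<le> k" using real_power[of us' vs] us' S(2) vs by blast
        then show ?thesis by (simp flip: of_real_power)
      qed
      obtain k where k: "?K us vs = of_real k" using real_power[of us vs] us(1) S(2) vs by blast
      have "h us vs = of_real k" using h(2)[of us vs] us(1) S(2) vs k by auto
      then have "k > b" using us(2) by simp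
      then have "b ^ n \<le> Re (?K us vs ^ n)"
        using b by (simp add: k power_mono flip: of_real_power)
      also have "\<dots> \<le> (\<Sum>us\<in>S. Re (?K us vs ^ n))" using us(1) nn S(1) by (intro member_le_sum) auto
      finally show "norm (complex_of_real (b ^ n)) \<le> Re (\<Sum>us\<in>S. ?K us vs ^ n)"
        using b by (simp add: norm_power)
    qed (rule bounded_image_const)
    \<comment> \<open>By unitary invariance all summands have the same mean as the kernel at
      \<open>\<rho>\<close>.\<close>
    also have "M (\<lambda>vs. \<Sum>us\<in>S. ?K us vs ^ n) = (\<Sum>us\<in>S. ?c)"
      using S(1,2)
    proof (induction S)
      case (insert us S)
      have "M (\<lambda>vs. ?K us vs ^ n + (\<Sum>us\<in>S. ?K us vs ^ n)) = M (\<lambda>vs. ?K us vs ^ n) + M (\<lambda>vs. \<Sum>us\<in>S. ?K us vs ^ n)"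
        using insert.prems KregU by (intro mean_add[OF M] regU_bounded fun_alg_sum[OF fun_alg_regU]) auto
      then show ?case
        using insert mean_kernel_invariant[OF rho_tuple, of us n] by (simp add: distrib_right)
    qed (simp add: mean_const[OF M])
    finally have 1: "b ^ n \<le> real (card S) * Re ?c" using b by (simp add: mean_const[OF M] norm_power)
    \<comment> \<open>Nonnegativity allows the factor to grow by one, which makes it visibly
      positive.\<close>
    then have "Re ?c \<ge> 0" 
      using b zero_less_power[of b n] mult_nonneg_nonpos[of "real (card S)" "Re ?c"] by linarith
    then show ?thesis using 1 by (simp add: distrib_right)
  qed
  then show ?thesis by (intro exI[of _ "real (card S) + 1"]) auto
qed

end

text \<open>Invariance reduces the two group elements to the single element
  \<open>gmul us' vs\<close>, with \<open>us'\<close> inverse to \<open>us\<close>; in one group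
  variable the distance is a representative function and so bounded.\<close>

lemma sqdist_bounded:
  assumes "\<sigma> \<in> End_V_tuples ds m" "\<rho> \<in> End_V_tuples ds m"
  shows "\<exists>B. \<forall>us\<in>U_prod ds. \<forall>vs\<in>U_prod ds. Re (sqdist ds m (tact us \<sigma>) (tact vs \<rho>)) \<le> B"
proof -
  have "bounded ((\<lambda>vs. sqdist ds m \<sigma> (tact vs \<rho>)) ` U_prod ds)"
    by (rule regU_bounded[OF sep_regU[OF sqdist_sep[OF assms(2)] assms(1)]])
  then obtain B where B: "\<And>vs. vs \<in> U_prod ds \<Longrightarrow> norm (sqdist ds m \<sigma> (tact vs \<rho>)) \<le> B"
    by (auto simp: bounded_iff)
  have "Re (sqdist ds m (tact us \<sigma>) (tact vs \<rho>)) \<le> B" if us: "us \<in> U_prod ds" and vs: "vs \<in> U_prod ds" for us vs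
  proof -
    define us' where "us' = map mat_adjoint us"
    have us': "us' \<in> U_prod ds" "gmul us us' = map 1\<^sub>m ds" using U_prod_inverse[OF us] by (simp_all add: us'_def)
    define ws where "ws = gmul us' vs"
    have ws: "ws \<in> U_prod ds" using U_prod_gmul[OF us'(1) vs] by (simp add: ws_def)
    have GL: "us \<in> GL_prod ds" "us' \<in> GL_prod ds" "vs \<in> GL_prod ds" "ws \<in> GL_prod ds"
      using us us'(1) vs ws U_prod_subset by blast+
    have "tact us (tact ws \<rho>) = tact us (tact us' (tact vs \<rho>))"
      unfolding ws_def by (simp add: tact_gmul[OF GL(2,3) assms(2)])
    also have "\<dots> = tact vs \<rho>"
      using tact_gmul[OF GL(1,2) tact_tuples[OF GL(3) assms(2)]] tact_ones[OF tact_tuples[OF GL(3) assms(2)]]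
      by (simp add: us'(2))
    finally have "sqdist ds m (tact us \<sigma>) (tact vs \<rho>) = sqdist ds m \<sigma> (tact ws \<rho>)"
      using sqdist_tact[OF us assms(1) tact_tuples[OF GL(4) assms(2)]] by simp
    then show ?thesis using B[OF ws] complex_Re_le_cmod order_trans by metis
  qed
  then show ?thesis by blast
qed

lemma unitary_mean: "\<exists>M. invariant_mean gmul (U_prod ds) M"
  by (rule invariant_mean_exists) (use ones_U_prod U_prod_gmul in blast)+

text \<open>Equal invariants make the kernel means at both tuples agree for every power. If
  \<open>\<sigma>\<close> kept a positive distance from the unitary orbit of \<open>\<rho>\<close>,
  the mean at \<open>\<sigma>\<close> would decay faster than the mean at \<open>\<rho>\<close>
  can.\<close>

theorem hermitian_separation:
  assumes rho: "\<rho> \<in> herm_tuples ds m" and sigma: "\<sigma> \<in> herm_tuples ds m"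
    and inv: "\<And>f. f \<in> GL_invariants ds m \<Longrightarrow> f \<rho> = f \<sigma>"
  shows "\<exists>us\<in>U_prod ds. tact us \<rho> = \<sigma>"
proof (rule ccontr)
  assume no: "\<not> ?thesis"
  have tuples: "\<rho> \<in> End_V_tuples ds m" "\<sigma> \<in> End_V_tuples ds m" using rho sigma by (auto simp: herm_tuples_def)
  obtain h where h: "h \<in> reg ds" "\<And>vs. vs \<in> U_prod ds \<Longrightarrow> sqdist ds m \<sigma> (tact vs \<rho>) = h vs"
    using sep_regU[OF sqdist_sep[OF tuples(1)] tuples(2)] by (auto simp: regU_def)
  obtain s where s: "s \<in> U_prod ds" "\<And>vs. vs \<in> U_prod ds \<Longrightarrow> Re (h s) \<le> Re (h vs)"
    using reg_attains_inf[OF h(1)] by blast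
  define \<eta> where "\<eta> = Re (h s)"
  \<comment> \<open>Compactness matters here: the least distance is attained, and distance zero
    between Hermitian tuples means equality.\<close>
  have "\<eta> > 0"
    using sqdist_herm_zero[OF sigma tact_herm[OF s(1) rho]] no s(1) by (force simp: \<eta>_def h(2)[OF s(1)])
  have \<eta>: "\<eta> \<le> Re (sqdist ds m \<sigma> (tact vs \<rho>))" if "vs \<in> U_prod ds" for vs
    using s(2)[OF that] by (simp add: \<eta>_def h(2)[OF that])
  obtain B where B: "\<And>us vs. us \<in> U_prod ds \<Longrightarrow> vs \<in> U_prod ds \<Longrightarrow> Re (sqdist ds m (tact us \<rho>) (tact vs \<rho>)) \<le> B"
    using sqdist_bounded[OF tuples(1,1)] by blast
  obtain B' where B': "\<And>us vs. us \<in> U_prod ds \<Longrightarrow> vs \<in> U_prod ds \<Longrightarrow> Re (sqdist ds m (tact us \<sigma>) (tact vs \<rho>)) \<le> B'"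
    using sqdist_bounded[OF tuples(2,1)] by blast
  \<comment> \<open>One constant above the distances from both orbits; the \<open>1\<close> makes it
    positive.\<close>
  define C where "C = max 1 (max B B')"
  have C: "C > 0" and bound: "\<And>us vs. us \<in> U_prod ds \<Longrightarrow> vs \<in> U_prod ds \<Longrightarrow> Re (sqdist ds m (tact us \<rho>) (tact vs \<rho>)) \<le> C"
    using B by (force simp: C_def)+
  have bound': "Re (sqdist ds m \<sigma> (tact vs \<rho>)) \<le> C" if "vs \<in> U_prod ds" for vs
    using B'[OF ones_U_prod that] by (simp add: C_def tact_ones[OF tuples(2)])
  have "\<eta> \<le> C" using \<eta>[OF s(1)] bound'[OF s(1)] by linarith
  obtain M where M: "invariant_mean gmul (U_prod ds) M" using unitary_mean by blast
  let ?K = "dist_kernel ds m \<rho> C"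
  have eq: "M (\<lambda>vs. ?K \<rho> vs ^ n) = M (\<lambda>vs. ?K \<sigma> vs ^ n)" for n
  proof -
    have "sep (poly_ring ds m) (reg ds) (End_V_tuples ds m) (U_prod ds) (\<lambda>X vs. ?K X vs ^ n)"
      by (intro sep_power fun_alg_poly_ring fun_alg_reg kernel_sep[OF rho C M])
    from mean_sep[OF M fun_alg_poly_ring reg_bounded this]
    obtain F where F: "F \<in> poly_ring ds m" "\<And>X. X \<in> End_V_tuples ds m \<Longrightarrow> M (\<lambda>vs. ?K X vs ^ n) = F X" by auto
    \<comment> \<open>The mean is a polynomial known to be invariant under unitary tuples only;
      Zariski density extends this to \<open>GL_prod ds\<close>.\<close>
    have "F (tact gs X) = F X" if gs: "gs \<in> GL_prod ds" and X: "X \<in> End_V_tuples ds m" for gs X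
    proof -
      have "(\<lambda>Y. F Y - F X) \<in> poly_ring ds m"
        by (intro fun_alg_diff[OF fun_alg_poly_ring] F(1) fun_alg_const[OF fun_alg_poly_ring])
      moreover have "F (tact us X) - F X = 0" if us: "us \<in> U_prod ds" for us
      proof -
        have "tact us X \<in> End_V_tuples ds m" using us U_prod_subset tact_tuples[OF _ X] by blast
        then show ?thesis using mean_kernel_invariant[OF rho C M X us, of n] by (simp add: F(2)[symmetric] X)
      qed
      ultimately have "F (tact gs X) - F X = 0" using unitary_dense[OF _ X _ gs, of "\<lambda>Y. F Y - F X"] by blast
      then show ?thesis by simp
    qed
    then have "F \<in> GL_invariants ds m" using F(1) by (simp add: GL_invariants_def tact_def)
    then show ?thesis using inv by (simp add: F(2) tuples)
  qed
  \<comment> \<open>\<open>a\<close> bounds the kernel at \<open>\<sigma>\<close> uniformly;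
    \<open>b\<close>, at half that distance from \<open>1\<close>, is a level that the kernel at
    \<open>\<rho>\<close> exceeds near its maximum.\<close>
  define a where "a = 1 - \<eta> / C"
  define b where "b = 1 - \<eta> / (2 * C)"
  have ab: "0 \<le> a" "a < b" "0 < b" "b < 1"
    using \<open>\<eta> > 0\<close> \<open>\<eta> \<le> C\<close> C by (auto simp: a_def b_def field_simps)
  obtain J where J: "J > 0" "\<And>n. b ^ n \<le> J * Re (M (\<lambda>vs. ?K \<rho> vs ^ n))"
    using mean_kernel_lower[OF rho C M bound ab(3,4)] by blast
  have upper: "Re (M (\<lambda>vs. ?K \<sigma> vs ^ n)) \<le> a ^ n" for n
  proof -
    have "norm (M (\<lambda>vs. ?K \<sigma> vs ^ n)) \<le> Re (M (\<lambda>_. of_real (a ^ n)))"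
    proof (rule mean_norm_le[OF M])
      show "bounded ((\<lambda>vs. ?K \<sigma> vs ^ n) ` U_prod ds)"
        by (intro regU_bounded fun_alg_power[OF fun_alg_regU] kernel_regU[OF rho C M tuples(2)])
      fix vs assume vs: "vs \<in> U_prod ds"
      define k where "k = 1 - Re (sqdist ds m \<sigma> (tact vs \<rho>)) / C"
      have k: "?K \<sigma> vs = of_real k" "0 \<le> k"
        using kernel_real[OF rho C M sigma vs bound'[OF vs]] by (simp_all add: k_def)
      have "k \<le> a" using \<eta>[OF vs] C by (simp add: k_def a_def divide_right_mono)
      then show "norm (?K \<sigma> vs ^ n) \<le> Re (complex_of_real (a ^ n))"
        using k by (simp add: norm_power power_mono)
    qed (rule bounded_image_const)
    then show ?thesis using complex_Re_le_cmod order_trans by (fastforce simp: mean_const[OF M])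
  qed
  obtain N where "J * a ^ N < b ^ N" using power_ratio[OF ab(1,2)] by blast
  moreover have "b ^ N \<le> J * a ^ N"
    using J(2)[of N] upper[of N] J(1) unfolding eq by (meson mult_left_mono less_imp_le order_trans)
  ultimately show False by linarith
qed

section \<open>Closed orbits\<close>

definition monomial :: "(bool \<times> nat \<times> nat \<times> nat) list \<Rightarrow> complex mat list \<Rightarrow> complex" where
  "monomial w gs = (\<Prod>(c, i, a, b)\<leftarrow>w. if c then cnj (gs ! i $$ (a, b)) else gs ! i $$ (a, b))"

lemma span_monomials_mult:
  assumes f: "f \<in> fs.span (range monomial)" and g: "g \<in> fs.span (range monomial)"
  shows "(\<lambda>x. f x * g x) \<in> fs.span (range monomial)"
  using f
proof (induction rule: fs.span_induct_alt)
  case base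
  then show ?case using fs.span_zero by (simp add: zero_fun_def)
next
  case (step c v f)
  then obtain w where v: "v = monomial w" by blast
  have "(\<lambda>x. monomial w x * g x) \<in> fs.span (range monomial)"
    using g
  proof (induction rule: fs.span_induct_alt)
    case base
    then show ?case using fs.span_zero by (simp add: zero_fun_def)
  next
    case (step c' v' g')
    then obtain w' where v': "v' = monomial w'" by blast
    have "(\<lambda>x. c' * monomial (w @ w') x) + (\<lambda>x. monomial w x * g' x) \<in> fs.span (range monomial)"
      by (intro fs.span_add fs.span_scale[OF fs.span_base] step.IH) blast
    also have "(\<lambda>x. c' * monomial (w @ w') x) + (\<lambda>x. monomial w x * g' x) =
        (\<lambda>x. monomial w x * ((\<lambda>x. c' * v' x) + g') x)"
      by (simp add: fun_eq_iff v' monomial_def algebra_simps)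
    finally show ?case .
  qed
  then have "(\<lambda>x. c * (monomial w x * g x)) + (\<lambda>x. f x * g x) \<in> fs.span (range monomial)"
    using step.IH by (intro fs.span_add fs.span_scale)
  also have "(\<lambda>x. c * (monomial w x * g x)) + (\<lambda>x. f x * g x) = (\<lambda>x. ((\<lambda>x. c * v x) + f) x * g x)"
    by (simp add: fun_eq_iff v algebra_simps)
  finally show ?case .
qed

lemma reg_span_monomials: "reg ds \<subseteq> fs.span (range monomial)"
proof
  fix f assume "f \<in> reg ds"
  then show "f \<in> fs.span (range monomial)"
  proof (induction rule: reg.induct)
    case (const c)
    have "(\<lambda>x. c * monomial [] x) \<in> fs.span (range monomial)" by (intro fs.span_scale[OF fs.span_base]) blast
    also have "(\<lambda>x. c * monomial [] x) = (\<lambda>gs. c)" by (simp add: fun_eq_iff monomial_def)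
    finally show ?case .
  next
    case (entry i a b)
    have "monomial [(False, i, a, b)] \<in> fs.span (range monomial)" by (rule fs.span_base) blast
    also have "monomial [(False, i, a, b)] = (\<lambda>gs. gs ! i $$ (a, b))" by (simp add: fun_eq_iff monomial_def)
    finally show ?case .
  next
    case (cnj_entry i a b)
    have "monomial [(True, i, a, b)] \<in> fs.span (range monomial)" by (rule fs.span_base) blast
    also have "monomial [(True, i, a, b)] = (\<lambda>gs. cnj (gs ! i $$ (a, b)))" by (simp add: fun_eq_iff monomial_def)
    finally show ?case .
  next
    case (add f g)
    then have "f + g \<in> fs.span (range monomial)" by (intro fs.span_add)
    then show ?case by (simp add: plus_fun_def)
  next
    case (mult f g)
    then show ?case by (intro span_monomials_mult)
  qed
qed

section \<open>The ideal of a tuple and the characters that vanish on it\<close>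

text \<open>The ideal generated by the \<open>Mf i\<close>, enlarged by all functions that vanish on
  \<open>U_prod ds\<close>. A character that kills it therefore depends only on values at unitary
  tuples.\<close>

lemma reg_relation_ideal:
  assumes "\<And>i. i \<in> Idx \<Longrightarrow> Mf i \<in> reg ds"
  shows "alg_ideal (reg ds) {f \<in> reg ds. \<exists>h. (\<forall>i\<in>Idx. h i \<in> reg ds) \<and>
    (\<forall>us\<in>U_prod ds. f us = (\<Sum>i\<in>Idx. Mf i us * h i us))}" (is "alg_ideal _ ?I")
  unfolding alg_ideal_def
proof (intro conjI ballI)
  show "(\<lambda>_. 0) \<in> ?I"
    by (intro CollectI conjI exI[of _ "\<lambda>i us. 0"]) (simp_all add: reg.const)
next
  fix f g assume "f \<in> ?I" "g \<in> ?I"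
  then obtain h h' where *: "f \<in> reg ds" "g \<in> reg ds" "\<forall>i\<in>Idx. h i \<in> reg ds" "\<forall>i\<in>Idx. h' i \<in> reg ds"
    "\<forall>us\<in>U_prod ds. f us = (\<Sum>i\<in>Idx. Mf i us * h i us)" "\<forall>us\<in>U_prod ds. g us = (\<Sum>i\<in>Idx. Mf i us * h' i us)"
    by auto
  show "(\<lambda>x. f x + g x) \<in> ?I"
    using * by (intro CollectI conjI exI[of _ "\<lambda>i us. h i us + h' i us"])
      (simp_all add: reg.add distrib_left sum.distrib)
next
  fix f g assume "f \<in> reg ds" "g \<in> ?I"
  then obtain h where *: "f \<in> reg ds" "g \<in> reg ds" "\<forall>i\<in>Idx. h i \<in> reg ds"
    "\<forall>us\<in>U_prod ds. g us = (\<Sum>i\<in>Idx. Mf i us * h i us)"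
    by auto
  show "(\<lambda>x. f x * g x) \<in> ?I"
    using * by (intro CollectI conjI exI[of _ "\<lambda>i us. f us * h i us"])
      (simp_all add: reg.mult sum_distrib_left mult_ac)
qed blast

definition tuple_index :: "nat list \<Rightarrow> nat \<Rightarrow> (nat \<times> nat \<times> nat) set" where
  "tuple_index ds m = {..<m} \<times> {..<prod_list ds} \<times> {..<prod_list ds}"

definition entry :: "nat \<times> nat \<times> nat \<Rightarrow> complex mat list \<Rightarrow> complex" where
  "entry = (\<lambda>(k, p, q) X. X ! k $$ (p, q))"

lemma finite_tuple_index: "finite (tuple_index ds m)"
  by (simp add: tuple_index_def)

lemma entry_poly_ring: "i \<in> tuple_index ds m \<Longrightarrow> entry i \<in> poly_ring ds m"
  by (auto simp: tuple_index_def entry_def intro: poly_ring.coord)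

text \<open>A character of the algebra of representative functions is evaluation at a point of the
  complexification of the unitary group: the images of the entries and of their conjugates form
  mutually inverse matrices.\<close>

lemma character_point:
  assumes phi_const: "\<And>c. \<phi> (\<lambda>_. c) = c"
    and phi_add: "\<And>f g. f \<in> reg ds \<Longrightarrow> g \<in> reg ds \<Longrightarrow> \<phi> (\<lambda>x. f x + g x) = \<phi> f + \<phi> g"
    and phi_mult: "\<And>f g. f \<in> reg ds \<Longrightarrow> g \<in> reg ds \<Longrightarrow> \<phi> (\<lambda>x. f x * g x) = \<phi> f * \<phi> g"
    and phi_cong: "\<And>f g. f \<in> reg ds \<Longrightarrow> g \<in> reg ds \<Longrightarrow> (\<And>us. us \<in> U_prod ds \<Longrightarrow> f us = g us) \<Longrightarrow> \<phi> f = \<phi> g"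
    and rho: "\<rho> \<in> End_V_tuples ds m"
  shows "\<exists>gs\<in>GL_prod ds. \<forall>i\<in>tuple_index ds m. \<forall>f\<in>reg ds.
    (\<forall>us\<in>U_prod ds. entry i (tact us \<rho>) = f us) \<longrightarrow> \<phi> f = entry i (tact gs \<rho>)"
proof -
  let ?n = "length ds" and ?N = "prod_list ds"
  note alg = fun_alg_reg[of ds]
  have phi_sum: "\<phi> (\<lambda>x. \<Sum>i\<in>I. f i x) = (\<Sum>i\<in>I. \<phi> (f i))" if "finite I" "\<And>i. i \<in> I \<Longrightarrow> f i \<in> reg ds"
    for I :: "nat set" and f
    using that
  proof (induction I)
    case (insert i I)
    then show ?case using phi_add[of "f i" "\<lambda>x. \<Sum>i\<in>I. f i x"] fun_alg_sum[OF alg, of I f] by simp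
  qed (simp add: phi_const)
  have phi_prod: "\<phi> (\<lambda>x. \<Prod>i\<in>I. f i x) = (\<Prod>i\<in>I. \<phi> (f i))" if "finite I" "\<And>i. i \<in> I \<Longrightarrow> f i \<in> reg ds"
    for I :: "nat set" and f
    using that
  proof (induction I)
    case (insert i I)
    then show ?case using phi_mult[of "f i" "\<lambda>x. \<Prod>i\<in>I. f i x"] fun_alg_prod[OF alg, of I f] by simp
  qed (simp add: phi_const)
  define gs where "gs = map (\<lambda>i. Matrix.mat (ds ! i) (ds ! i) (\<lambda>(a, b). \<phi> (\<lambda>us. us ! i $$ (a, b)))) [0..<?n]"
  \<comment> \<open>The image of the entries of the adjoint, which become those of an
    inverse.\<close>
  define hs where "hs = map (\<lambda>i. Matrix.mat (ds ! i) (ds ! i) (\<lambda>(a, b). \<phi> (\<lambda>us. cnj (us ! i $$ (b, a))))) [0..<?n]"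
  have sq: "gs \<in> square_mats ds" "hs \<in> square_mats ds" by (simp_all add: gs_def hs_def square_mats_nth)
  have inv: "gs ! i * hs ! i = 1\<^sub>m (ds ! i)" if i: "i < ?n" for i
  proof (rule eq_matI)
    have c: "gs ! i \<in> carrier_mat (ds ! i) (ds ! i)" "hs ! i \<in> carrier_mat (ds ! i) (ds ! i)"
      using sq i by (auto simp: square_mats_nth)
    fix a c assume "a < dim_row (1\<^sub>m (ds ! i) :: complex mat)" "c < dim_col (1\<^sub>m (ds ! i) :: complex mat)"
    then have ac: "a < ds ! i" "c < ds ! i" by auto
    have "(gs ! i * hs ! i) $$ (a, c) = (\<Sum>b<ds ! i. gs ! i $$ (a, b) * hs ! i $$ (b, c))"
      by (rule index_mult_mat_sum[OF c ac])
    also have "\<dots> = (\<Sum>b<ds ! i. \<phi> (\<lambda>us. us ! i $$ (a, b) * cnj (us ! i $$ (c, b))))"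
      using i ac by (intro sum.cong refl) (simp add: gs_def hs_def phi_mult reg.entry reg.cnj_entry)
    also have "\<dots> = \<phi> (\<lambda>us. \<Sum>b<ds ! i. us ! i $$ (a, b) * cnj (us ! i $$ (c, b)))"
      using i ac by (intro phi_sum[symmetric] reg.mult reg.entry reg.cnj_entry) auto
    also have "\<dots> = \<phi> (\<lambda>us. if a = c then 1 else 0)"
    proof (rule phi_cong)
      show "(\<lambda>us. \<Sum>b<ds ! i. us ! i $$ (a, b) * cnj (us ! i $$ (c, b))) \<in> reg ds"
        using i ac by (intro fun_alg_sum[OF alg] reg.mult reg.entry reg.cnj_entry) auto
      fix us assume "us \<in> U_prod ds"
      \<comment> \<open>Orthonormality of the rows is needed, and the rows are the conjugated
        columns of the adjoint.\<close>
      then have "map mat_adjoint us ! i \<in> U (ds ! i)" "length us = ?n" "us ! i \<in> carrier_mat (ds ! i) (ds ! i)"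
        using i U_prod_inverse(1)[of us ds] by (auto simp: U_prod_nth U_def)
      from U_column_sum[OF this(1) ac] this(2,3)
      show "(\<Sum>b<ds ! i. us ! i $$ (a, b) * cnj (us ! i $$ (c, b))) = (if a = c then 1 else 0)"
        using i ac by (simp add: index_mat_adjoint)
    qed (rule reg.const)
    also have "\<dots> = 1\<^sub>m (ds ! i) $$ (a, c)" using ac by (simp add: phi_const)
    finally show "(gs ! i * hs ! i) $$ (a, c) = 1\<^sub>m (ds ! i) $$ (a, c)" .
  qed (use sq i in \<open>auto simp: square_mats_nth\<close>)
  have gsGL: "gs \<in> GL_prod ds"
    using sq inv by (auto simp: GL_prod_nth GL_iff square_mats_nth)
  have gshs: "gmul gs hs = map 1\<^sub>m ds"
    using sq inv by (intro nth_equalityI) (auto simp: gmul_nth length_gmul square_mats_nth)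
  have "\<forall>p q. \<exists>f. p < ?N \<longrightarrow> q < ?N \<longrightarrow> f \<in> reg ds \<and> (\<forall>us\<in>square_mats ds. tensor us $$ (p, q) = f us) \<and>
      \<phi> f = tensor gs $$ (p, q) \<and> \<phi> (\<lambda>us. cnj (f us)) = tensor hs $$ (q, p)"
  proof (intro allI)
    fix p q
    show "\<exists>f. p < ?N \<longrightarrow> q < ?N \<longrightarrow> f \<in> reg ds \<and> (\<forall>us\<in>square_mats ds. tensor us $$ (p, q) = f us) \<and>
      \<phi> f = tensor gs $$ (p, q) \<and> \<phi> (\<lambda>us. cnj (f us)) = tensor hs $$ (q, p)"
    proof (cases "p < ?N \<and> q < ?N")
      case True
      then obtain a b where ab: "\<And>i. i < ?n \<Longrightarrow> a i < ds ! i \<and> b i < ds ! i"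
        and T: "\<And>us. us \<in> square_mats ds \<Longrightarrow> tensor us $$ (p, q) = (\<Prod>i<?n. us ! i $$ (a i, b i))"
        using tensor_entry[of p ds q] by blast
      let ?f = "\<lambda>us :: complex mat list. \<Prod>i<?n. us ! i $$ (a i, b i)"
      have f: "?f \<in> reg ds" using ab by (intro fun_alg_prod[OF alg] reg.entry) auto
      have "\<phi> ?f = (\<Prod>i<?n. \<phi> (\<lambda>us. us ! i $$ (a i, b i)))"
        using ab by (intro phi_prod reg.entry) auto
      also have "\<dots> = tensor gs $$ (p, q)"
        unfolding T[OF sq(1)] using ab by (intro prod.cong refl) (simp add: gs_def)
      finally have 1: "\<phi> ?f = tensor gs $$ (p, q)" .
      have "\<phi> (\<lambda>us. cnj (?f us)) = \<phi> (\<lambda>us. \<Prod>i<?n. cnj (us ! i $$ (a i, b i)))" by simp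
      also have "\<dots> = (\<Prod>i<?n. \<phi> (\<lambda>us. cnj (us ! i $$ (a i, b i))))"
        using ab by (intro phi_prod reg.cnj_entry) auto
      \<comment> \<open>Passing to adjoints transposes the positions, so the formula
        \<open>T\<close> for the entry \<open>(p, q)\<close> also computes the entry
        \<open>(q, p)\<close> for \<open>hs\<close>.\<close>
      also have "\<dots> = (\<Prod>i<?n. cnj (map mat_adjoint hs ! i $$ (a i, b i)))"
        using ab by (intro prod.cong refl) (simp add: hs_def index_mat_adjoint)
      also have "\<dots> = cnj (tensor (map mat_adjoint hs) $$ (p, q))"
        using sq(2) by (subst T) (auto simp: square_mats_nth mat_adjoint_carrier)
      also have "\<dots> = tensor hs $$ (q, p)"
        using True tensor_carrier[OF sq(2)] by (simp add: tensor_adjoint index_mat_adjoint)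
      finally show ?thesis using f T 1 by (intro exI[of _ ?f]) simp
    qed auto
  qed
  then obtain T where T: "\<And>p q. p < ?N \<Longrightarrow> q < ?N \<Longrightarrow> T p q \<in> reg ds"
    "\<And>p q us. p < ?N \<Longrightarrow> q < ?N \<Longrightarrow> us \<in> square_mats ds \<Longrightarrow> tensor us $$ (p, q) = T p q us"
    "\<And>p q. p < ?N \<Longrightarrow> q < ?N \<Longrightarrow> \<phi> (T p q) = tensor gs $$ (p, q)"
    "\<And>p q. p < ?N \<Longrightarrow> q < ?N \<Longrightarrow> \<phi> (\<lambda>us. cnj (T p q us)) = tensor hs $$ (q, p)"
    unfolding choice_iff by blast
  have "\<phi> f = entry i (tact gs \<rho>)"
    if i: "i \<in> tuple_index ds m" and f: "f \<in> reg ds" "\<And>us. us \<in> U_prod ds \<Longrightarrow> entry i (tact us \<rho>) = f us" for i f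
  proof -
    obtain k p q where kpq: "i = (k, p, q)" "k < m" "p < ?N" "q < ?N" using i by (auto simp: tuple_index_def)
    note R = tuple_nth[OF rho kpq(2)]
    let ?e = "\<lambda>us. \<Sum>b<?N. \<Sum>a<?N. T p a us * \<rho> ! k $$ (a, b) * cnj (T q b us)"
    have summand: "(\<lambda>us. T p a us * \<rho> ! k $$ (a, b) * cnj (T q b us)) \<in> reg ds" if "a < ?N" "b < ?N" for a b
      using that kpq by (intro reg.mult reg.const T(1) reg_cnj)
    have "\<phi> f = \<phi> ?e"
    proof (rule phi_cong[OF f(1)])
      show "?e \<in> reg ds" by (intro fun_alg_sum[OF alg] summand) auto
      fix us assume us: "us \<in> U_prod ds"
      show "f us = ?e us"
        using f(2)[OF us] conj_act_U_entry[OF us _ kpq(3,4), of "\<rho> ! k"] R T(2) U_prod_square[OF us] kpq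
        by (simp add: entry_def tact_nth tuple_length[OF rho] End_V_def)
    qed
    also have "\<dots> = (\<Sum>b<?N. \<Sum>a<?N. \<phi> (\<lambda>us. T p a us * \<rho> ! k $$ (a, b) * cnj (T q b us)))"
      by (subst phi_sum) (auto intro!: fun_alg_sum[OF alg] summand phi_sum sum.cong)
    also have "\<dots> = (\<Sum>b<?N. \<Sum>a<?N. tensor gs $$ (p, a) * \<rho> ! k $$ (a, b) * tensor hs $$ (b, q))"
    proof (intro sum.cong refl)
      fix b a assume "b \<in> {..<?N}" "a \<in> {..<?N}"
      then have ab: "a < ?N" "b < ?N" by auto
      have "\<phi> (\<lambda>us. T p a us * \<rho> ! k $$ (a, b) * cnj (T q b us)) =
          \<phi> (\<lambda>us. T p a us * \<rho> ! k $$ (a, b)) * \<phi> (\<lambda>us. cnj (T q b us))"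
        using kpq ab by (intro phi_mult reg.mult reg.const T(1) reg_cnj)
      also have "\<phi> (\<lambda>us. T p a us * \<rho> ! k $$ (a, b)) = \<phi> (T p a) * \<phi> (\<lambda>us. \<rho> ! k $$ (a, b))"
        using kpq ab by (intro phi_mult reg.const T(1))
      finally show "\<phi> (\<lambda>us. T p a us * \<rho> ! k $$ (a, b) * cnj (T q b us)) =
          tensor gs $$ (p, a) * \<rho> ! k $$ (a, b) * tensor hs $$ (b, q)"
        using kpq ab T(3,4) by (simp add: phi_const)
    qed
    also have "\<dots> = (tensor gs * \<rho> ! k * tensor hs) $$ (p, q)"
      by (rule triple_mult_entry[OF tensor_carrier[OF sq(1)] R tensor_carrier[OF sq(2)] kpq(3,4), symmetric])
    also have "\<dots> = entry i (tact gs \<rho>)"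
      using kpq by (simp add: entry_def tact_nth tuple_length[OF rho] conj_act_inverse[OF sq gshs])
    finally show ?thesis .
  qed
  then show ?thesis using gsGL by blast
qed

section \<open>Averaged relations and closedness of Hermitian orbits\<close>

lemma span_sum_pointwise:
  assumes "\<And>i. i \<in> I \<Longrightarrow> f i \<in> fs.span B"
  shows "(\<lambda>x. \<Sum>i\<in>I. f i x) \<in> fs.span B"
proof -
  have "(\<Sum>i\<in>I. f i) \<in> fs.span B" using assms by (rule fs.span_sum)
  also have "(\<Sum>i\<in>I. f i) = (\<lambda>x. \<Sum>i\<in>I. f i x)" by (simp add: fun_eq_iff sum_fun_apply)
  finally show ?thesis .
qed

lemma span_sum_list_pointwise:
  assumes "\<And>i. i \<in> set is \<Longrightarrow> f i \<in> fs.span B"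
  shows "(\<lambda>x. \<Sum>i\<leftarrow>is. f i x) \<in> fs.span B"
  using assms
proof (induction "is")
  case Nil
  then show ?case using fs.span_zero by (simp add: zero_fun_def)
next
  case (Cons i "is")
  then have "f i + (\<lambda>x. \<Sum>i\<leftarrow>is. f i x) \<in> fs.span B" by (intro fs.span_add) auto
  then show ?case by (simp add: plus_fun_def)
qed

lemma mean_regU_sum:
  assumes M: "invariant_mean gmul (U_prod ds) M" and "finite I" "\<And>i. i \<in> I \<Longrightarrow> f i \<in> regU ds"
  shows "M (\<lambda>t. \<Sum>i\<in>I. f i t) = (\<Sum>i\<in>I. M (f i))"
  using assms(2,3)
proof (induction I)
  case (insert i I)
  then have "M (\<lambda>t. f i t + (\<Sum>i\<in>I. f i t)) = M (f i) + M (\<lambda>t. \<Sum>i\<in>I. f i t)"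
    by (intro mean_add[OF M] regU_bounded fun_alg_sum[OF fun_alg_regU]) auto
  then show ?case using insert by simp
qed (simp add: mean_const[OF M])

text \<open>Averaging a relation \<open>\<Sum>\<^sub>i (\<rho>\<^sub>i - X\<^sub>i) h\<^sub>i = 1\<close> on the unitary orbit against powers of the kernel
  replaces the coefficients \<open>h\<^sub>i\<close> by polynomials, up to an arbitrarily small error and within a fixed
  finite-dimensional space of functions; since that space is closed, the error can be removed.\<close>

lemma relation_polynomial:
  assumes rho: "\<rho> \<in> herm_tuples ds m" and X: "X \<in> End_V_tuples ds m"
    and h: "\<And>i. i \<in> tuple_index ds m \<Longrightarrow> h i \<in> reg ds"
    and rel: "\<And>us. us \<in> U_prod ds \<Longrightarrow> (\<Sum>i\<in>tuple_index ds m. (entry i (tact us \<rho>) - entry i X) * h i us) = 1"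
  shows "\<exists>G\<in>poly_ring ds m. G X = 0 \<and> (\<forall>us\<in>U_prod ds. G (tact us \<rho>) = 1)"
proof -
  let ?Idx = "tuple_index ds m"
  have rho': "\<rho> \<in> End_V_tuples ds m" using rho by (simp add: herm_tuples_def)
  have tuple: "tact us \<rho> \<in> End_V_tuples ds m" if "us \<in> U_prod ds" for us
    using tact_herm[OF that rho] by (simp add: herm_tuples_def)
  have "\<forall>i. \<exists>ps. i \<in> ?Idx \<longrightarrow> set ps \<subseteq> reg ds \<times> reg ds \<and>
      (\<forall>s\<in>U_prod ds. \<forall>t\<in>U_prod ds. h i (gmul s t) = (\<Sum>(a, b)\<leftarrow>ps. a s * b t))"
    using reg_comult[OF h] unfolding sep_def by blast
  then obtain ps where ps: "\<And>i. i \<in> ?Idx \<Longrightarrow> set (ps i) \<subseteq> reg ds \<times> reg ds"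
      "\<And>i s t. i \<in> ?Idx \<Longrightarrow> s \<in> U_prod ds \<Longrightarrow> t \<in> U_prod ds \<Longrightarrow> h i (gmul s t) = (\<Sum>(a, b)\<leftarrow>ps i. a s * b t)"
    by metis
  define e where "e i us = entry i (tact us \<rho>) - entry i X" for i us
  \<comment> \<open>Finite and chosen before any error bound: the products of the \<open>e i\<close>
    with the left factors in the coproducts of the \<open>h i\<close>. All approximations will lie
    in its span.\<close>
  define B0 where "B0 = (\<Union>i\<in>?Idx. (\<lambda>(a, b) us. e i us * a us) ` set (ps i))"
  have "finite B0" unfolding B0_def using finite_tuple_index by auto
  \<comment> \<open>Those functions in the span that come from a polynomial vanishing at
    \<open>X\<close>. The goal is a member of \<open>V\<close> equal to \<open>1\<close> on the
    unitary group.\<close>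
  define V where "V = {w \<in> fs.span B0. \<exists>G\<in>poly_ring ds m. G X = 0 \<and> (\<forall>us\<in>U_prod ds. w us = G (tact us \<rho>))}"
  have V: "fs.subspace V"
  proof (rule fs.subspaceI)
    have "0 \<in> fs.span B0" by (rule fs.span_zero)
    then show "0 \<in> V" unfolding V_def by (intro CollectI conjI bexI[of _ "\<lambda>_. 0"] poly_ring.const) auto
  next
    fix w w' assume "w \<in> V" "w' \<in> V"
    then obtain G G' where *: "w \<in> fs.span B0" "w' \<in> fs.span B0" "G \<in> poly_ring ds m" "G' \<in> poly_ring ds m"
      "G X = 0" "G' X = 0" "\<forall>us\<in>U_prod ds. w us = G (tact us \<rho>)" "\<forall>us\<in>U_prod ds. w' us = G' (tact us \<rho>)"
      unfolding V_def by blast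
    show "w + w' \<in> V"
      unfolding V_def using * fs.span_add[OF *(1,2)]
      by (intro CollectI conjI bexI[of _ "\<lambda>X. G X + G' X"] poly_ring.add) auto
  next
    fix c w assume "w \<in> V"
    then obtain G where *: "w \<in> fs.span B0" "G \<in> poly_ring ds m" "G X = 0" "\<forall>us\<in>U_prod ds. w us = G (tact us \<rho>)"
      unfolding V_def by blast
    show "(\<lambda>x. c * w x) \<in> V"
      unfolding V_def using * fs.span_scale[OF *(1), of c]
      by (intro CollectI conjI bexI[of _ "\<lambda>X. c * G X"] poly_ring.mult poly_ring.const) auto
  qed
  obtain M where M: "invariant_mean gmul (U_prod ds) M" using unitary_mean by blast
  obtain B where B: "\<And>us vs. us \<in> U_prod ds \<Longrightarrow> vs \<in> U_prod ds \<Longrightarrow> Re (sqdist ds m (tact us \<rho>) (tact vs \<rho>)) \<le> B"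
    using sqdist_bounded[OF rho' rho'] by blast
  define C where "C = max 1 B"
  have C: "C > 0" and bound: "\<And>us vs. us \<in> U_prod ds \<Longrightarrow> vs \<in> U_prod ds \<Longrightarrow> Re (sqdist ds m (tact us \<rho>) (tact vs \<rho>)) \<le> C"
    using B by (force simp: C_def)+
  have "\<forall>i. \<exists>b. i \<in> ?Idx \<longrightarrow> (\<forall>us\<in>U_prod ds. norm (h i us) \<le> b)"
    using reg_bounded[OF h] unfolding bounded_iff by blast
  then obtain b0 where b0: "\<And>i us. i \<in> ?Idx \<Longrightarrow> us \<in> U_prod ds \<Longrightarrow> norm (h i us) \<le> b0 i" by metis
  \<comment> \<open>A Lipschitz constant; the added one allows division by it.\<close>
  define L where "L = (\<Sum>i\<in>?Idx. \<bar>b0 i\<bar>) + 1"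
  have L: "L > 0" unfolding L_def by (smt (verit) sum_nonneg abs_ge_zero)
  \<comment> \<open>At equal arguments the relation gives exactly \<open>1\<close>. Shifting only
    the factors \<open>e i\<close> costs at most \<open>L\<close> times the distance of the two
    moved tuples.\<close>
  have lip: "norm (\<Sum>i\<in>?Idx. (e i us - e i vs) * h i vs) \<le> L * sqrt (Re (sqdist ds m (tact us \<rho>) (tact vs \<rho>)))"
    if us: "us \<in> U_prod ds" and vs: "vs \<in> U_prod ds" for us vs
  proof -
    let ?D = "sqrt (Re (sqdist ds m (tact us \<rho>) (tact vs \<rho>)))"
    have D: "?D \<ge> 0" using sqdist_herm_real(2)[OF tact_herm[OF us rho] tact_herm[OF vs rho]] by simp
    have "norm (\<Sum>i\<in>?Idx. (e i us - e i vs) * h i vs) \<le> (\<Sum>i\<in>?Idx. ?D * \<bar>b0 i\<bar>)"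
    proof (rule sum_norm_le)
      fix i assume i: "i \<in> ?Idx"
      then obtain k p q where kpq: "i = (k, p, q)" "k < m" "p < prod_list ds" "q < prod_list ds"
        by (auto simp: tuple_index_def)
      have "norm (e i us - e i vs) \<le> ?D"
        using sqdist_herm_entry[OF tact_herm[OF us rho] tact_herm[OF vs rho] kpq(2-4)]
        by (intro real_le_rsqrt) (simp add: e_def entry_def kpq(1))
      moreover have "norm (h i vs) \<le> \<bar>b0 i\<bar>" using b0[OF i vs] by linarith
      ultimately show "norm ((e i us - e i vs) * h i vs) \<le> ?D * \<bar>b0 i\<bar>"
        unfolding norm_mult using D by (intro mult_mono) auto
    qed
    also have "\<dots> = (\<Sum>i\<in>?Idx. \<bar>b0 i\<bar>) * ?D" by (simp add: sum_distrib_right mult.commute)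
    also have "\<dots> \<le> L * ?D" using D by (simp add: L_def distrib_right)
    finally show ?thesis .
  qed
  have approx: "\<exists>w\<in>V. \<forall>us\<in>U_prod ds. norm (w us - 1) \<le> \<epsilon>" if \<epsilon>: "\<epsilon> > 0" for \<epsilon> :: real
  proof -
    \<comment> \<open>Group elements within distance \<open>\<theta>\<close> contribute an error of
      at most \<open>\<epsilon> / 2\<close>; the other half is left for the far ones.\<close>
    define \<theta> where "\<theta> = \<epsilon> / (2 * L)"
    have \<theta>: "\<theta> > 0" "L * \<theta> = \<epsilon> / 2" using \<epsilon> L by (auto simp: \<theta>_def)
    define t where "t = \<theta>\<^sup>2 / C"
    have t: "t > 0" using \<theta>(1) C by (simp add: t_def)
    \<comment> \<open>\<open>a\<close> bounds the kernel beyond distance \<open>\<theta>\<close>;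
      the maximum covers \<open>t > 1\<close>. The minimum in \<open>b\<close> keeps it positive and
      strictly between \<open>a\<close> and \<open>1\<close>.\<close>
    define a where "a = max 0 (1 - t)"
    define b where "b = 1 - min (t / 2) (1 / 2)"
    have ab: "0 \<le> a" "a < b" "0 < b" "b < 1" using t by (auto simp: a_def b_def min_def)
    obtain J where J: "J > 0" "\<And>n. b ^ n \<le> J * Re (M (\<lambda>vs. dist_kernel ds m \<rho> C \<rho> vs ^ n))"
      using mean_kernel_lower[OF rho C M bound ab(3,4)] by blast
    \<comment> \<open>Exactly what makes the far contribution at most \<open>\<epsilon> / 2\<close>
      times the mean \<open>c\<close> of the kernel, via the lower bound with
      \<open>J\<close>.\<close>
    obtain N where N: "(2 * L * sqrt C * J / \<epsilon>) * a ^ N < b ^ N" using power_ratio[OF ab(1,2)] by blast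
    let ?K = "dist_kernel ds m \<rho> C"
    define c where "c = M (\<lambda>vs. ?K \<rho> vs ^ N)"
    have "0 < b ^ N" using ab(3) by simp
    then have c: "Re c > 0" using J(2)[of N] J(1) unfolding c_def[symmetric] by (smt (verit) mult_nonneg_nonpos)
    then have c0: "c \<noteq> 0" by auto
    have small: "L * sqrt C * a ^ N \<le> \<epsilon> / 2 * Re c"
    proof -
      have "(2 * L * sqrt C * J / \<epsilon>) * a ^ N \<le> J * Re c" using N J(2)[of N] by (simp add: c_def)
      then have "J * (2 * L * sqrt C * a ^ N) \<le> J * (\<epsilon> * Re c)" using \<epsilon> by (simp add: field_simps)
      then show ?thesis using J(1) by simp
    qed
    have "\<exists>H\<in>poly_ring ds m. \<forall>Y\<in>End_V_tuples ds m. M (\<lambda>vs. ?K Y vs ^ N * h i vs) = H Y" if i: "i \<in> ?Idx" for i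
    proof -
      have "sep (poly_ring ds m) (reg ds) (End_V_tuples ds m) (U_prod ds) (\<lambda>Y vs. ?K Y vs ^ N * h i vs)"
        by (intro sep_mult sep_power kernel_sep[OF rho C M] sep_right[OF h[OF i]] fun_alg_poly_ring fun_alg_reg)
      from mean_sep[OF M fun_alg_poly_ring reg_bounded this] show ?thesis by blast
    qed
    then have "\<forall>i. \<exists>H. i \<in> ?Idx \<longrightarrow> H \<in> poly_ring ds m \<and> (\<forall>Y\<in>End_V_tuples ds m. M (\<lambda>vs. ?K Y vs ^ N * h i vs) = H Y)"
      by blast
    then obtain H where H: "\<And>i. i \<in> ?Idx \<Longrightarrow> H i \<in> poly_ring ds m"
        "\<And>i Y. i \<in> ?Idx \<Longrightarrow> Y \<in> End_V_tuples ds m \<Longrightarrow> M (\<lambda>vs. ?K Y vs ^ N * h i vs) = H i Y"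
      by metis
    \<comment> \<open>The relation with each \<open>h i\<close> replaced by its normalised kernel
      average. The factors \<open>entry i Y - entry i X\<close> make it vanish at
      \<open>X\<close>.\<close>
    define G where "G Y = (\<Sum>i\<in>?Idx. (entry i Y - entry i X) * (H i Y * (1 / c)))" for Y
    have G: "G \<in> poly_ring ds m" "G X = 0"
    proof -
      have "(\<lambda>Y. \<Sum>i\<in>?Idx. (entry i Y - entry i X) * (H i Y * (1 / c))) \<in> poly_ring ds m"
        by (intro fun_alg_sum[OF fun_alg_poly_ring] poly_ring.mult fun_alg_diff[OF fun_alg_poly_ring]
            poly_ring.const entry_poly_ring H(1))
      then show "G \<in> poly_ring ds m" unfolding G_def .
      show "G X = 0" by (simp add: G_def)
    qed
    have KregU: "(\<lambda>vs. ?K Y vs ^ N) \<in> regU ds" if "Y \<in> End_V_tuples ds m" for Y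
      by (intro fun_alg_power[OF fun_alg_regU] kernel_regU[OF rho C M that])
    \<comment> \<open>The values of \<open>G\<close> on the unitary orbit, written out in
      \<open>B0\<close> with the help of the coproducts.\<close>
    define w where "w us = (\<Sum>i\<in>?Idx. \<Sum>p\<leftarrow>ps i. (M (\<lambda>vs. ?K \<rho> vs ^ N * snd p vs) / c) * (e i us * fst p us))" for us
    have "(\<lambda>us. \<Sum>i\<in>?Idx. \<Sum>p\<leftarrow>ps i. (M (\<lambda>vs. ?K \<rho> vs ^ N * snd p vs) / c) * (e i us * fst p us)) \<in> fs.span B0"
    proof (intro span_sum_pointwise span_sum_list_pointwise fs.span_scale fs.span_base)
      fix i p assume "i \<in> ?Idx" "p \<in> set (ps i)"
      then show "(\<lambda>us. e i us * fst p us) \<in> B0" unfolding B0_def by (auto simp: case_prod_unfold)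
    qed
    then have "w \<in> fs.span B0" unfolding w_def .
    moreover have wG: "w us = G (tact us \<rho>)" if us: "us \<in> U_prod ds" for us
    proof -
      have "H i (tact us \<rho>) = (\<Sum>p\<leftarrow>ps i. fst p us * M (\<lambda>vs. ?K \<rho> vs ^ N * snd p vs))" if i: "i \<in> ?Idx" for i
      proof -
        have bR: "(\<lambda>vs. ?K \<rho> vs ^ N * snd p vs) \<in> regU ds" if "p \<in> set (ps i)" for p
          using ps(1)[OF i] that by (intro fun_alg_mult[OF fun_alg_regU] KregU[OF rho'] regU_reg) auto
        \<comment> \<open>Translation moves \<open>us\<close> from the kernel into
          \<open>h i\<close>, where the coproduct splits it off the averaged variable.\<close>
        have "H i (tact us \<rho>) = M (\<lambda>vs. ?K \<rho> vs ^ N * h i (gmul us vs))"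
          using H(2)[OF i tuple[OF us]] mean_kernel_translate[OF rho C M rho' us regU_reg[OF h[OF i]], of N] by simp
        also have "\<dots> = M (\<lambda>vs. \<Sum>p\<leftarrow>ps i. fst p us * (?K \<rho> vs ^ N * snd p vs))"
        proof (rule mean_cong[OF M, symmetric])
          show "bounded ((\<lambda>vs. \<Sum>p\<leftarrow>ps i. fst p us * (?K \<rho> vs ^ N * snd p vs)) ` U_prod ds)"
            by (intro regU_bounded fun_alg_sum_list[OF fun_alg_regU] fun_alg_cmult[OF fun_alg_regU] bR)
          show "(\<Sum>p\<leftarrow>ps i. fst p us * (?K \<rho> vs ^ N * snd p vs)) = ?K \<rho> vs ^ N * h i (gmul us vs)"
            if "vs \<in> U_prod ds" for vs
            by (simp add: ps(2)[OF i us that] case_prod_unfold sum_list_const_mult[symmetric] mult_ac)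
        qed
        also have "\<dots> = (\<Sum>p\<leftarrow>ps i. M (\<lambda>vs. fst p us * (?K \<rho> vs ^ N * snd p vs)))"
          using mean_sum_list[OF M, of "ps i" "\<lambda>p vs. fst p us * (?K \<rho> vs ^ N * snd p vs)"]
            regU_bounded[OF fun_alg_cmult[OF fun_alg_regU bR]] by blast
        also have "\<dots> = (\<Sum>p\<leftarrow>ps i. fst p us * M (\<lambda>vs. ?K \<rho> vs ^ N * snd p vs))"
          using mean_cmult[OF M regU_bounded[OF bR]] by (intro arg_cong[where f = sum_list] map_cong refl) blast
        finally show ?thesis .
      qed
      then show ?thesis
        unfolding w_def G_def
        by (intro sum.cong refl) (simp add: e_def sum_list_const_mult[symmetric] sum_list_mult_const[symmetric] mult_ac)
    qed
    ultimately have "w \<in> V" unfolding V_def using G by blast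
    moreover have "norm (w us - 1) \<le> \<epsilon>" if us: "us \<in> U_prod ds" for us
    proof -
      let ?Ku = "\<lambda>vs. ?K (tact us \<rho>) vs ^ N"
      note KuR = KregU[OF tuple[OF us]]
      have c_eq: "c = M ?Ku" unfolding c_def by (rule mean_kernel_invariant[OF rho C M rho' us, symmetric])
      have eKh: "(\<lambda>vs. e i us * (?Ku vs * h i vs)) \<in> regU ds" if "i \<in> ?Idx" for i
        by (intro fun_alg_cmult[OF fun_alg_regU] fun_alg_mult[OF fun_alg_regU] KuR regU_reg h that)
      \<comment> \<open>Since the relation equals \<open>1\<close> at every \<open>vs\<close>, the
        error is the mean of the kernel times the deviation estimated in \<open>lip\<close>.\<close>
      have "c * (w us - 1) = (\<Sum>i\<in>?Idx. e i us * H i (tact us \<rho>)) - c"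
        unfolding wG[OF us] G_def e_def using c0 by (simp add: right_diff_distrib sum_distrib_left mult_ac)
      also have "(\<Sum>i\<in>?Idx. e i us * H i (tact us \<rho>)) = (\<Sum>i\<in>?Idx. M (\<lambda>vs. e i us * (?Ku vs * h i vs)))"
        using H(2)[OF _ tuple[OF us]] mean_cmult[OF M] 
        by (intro sum.cong refl) (simp add: regU_bounded fun_alg_mult[OF fun_alg_regU KuR] regU_reg h)
      also have "\<dots> = M (\<lambda>vs. \<Sum>i\<in>?Idx. e i us * (?Ku vs * h i vs))"
        by (rule mean_regU_sum[OF M finite_tuple_index eKh, symmetric])
      also have "\<dots> - c = M (\<lambda>vs. (\<Sum>i\<in>?Idx. e i us * (?Ku vs * h i vs)) - ?Ku vs)"
        unfolding c_eq
        by (intro mean_diff[OF M, symmetric] regU_bounded fun_alg_sum[OF fun_alg_regU] eKh KuR)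
      finally have eq: "c * (w us - 1) = M (\<lambda>vs. (\<Sum>i\<in>?Idx. e i us * (?Ku vs * h i vs)) - ?Ku vs)" .
      \<comment> \<open>The first term accounts for near group elements, the constant for far ones;
        their sum is valid everywhere.\<close>
      let ?g = "\<lambda>vs. of_real (\<epsilon> / 2) * ?Ku vs + of_real (L * sqrt C * a ^ N)"
      have "norm (M (\<lambda>vs. (\<Sum>i\<in>?Idx. e i us * (?Ku vs * h i vs)) - ?Ku vs)) \<le> Re (M ?g)"
      proof (rule mean_norm_le[OF M])
        show "bounded ((\<lambda>vs. (\<Sum>i\<in>?Idx. e i us * (?Ku vs * h i vs)) - ?Ku vs) ` U_prod ds)"
          by (intro regU_bounded fun_alg_diff[OF fun_alg_regU] fun_alg_sum[OF fun_alg_regU] eKh KuR)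
        show "bounded (?g ` U_prod ds)"
          by (intro regU_bounded fun_alg_add[OF fun_alg_regU] fun_alg_cmult[OF fun_alg_regU] fun_alg_const[OF fun_alg_regU] KuR)
        fix vs assume vs: "vs \<in> U_prod ds"
        let ?D = "Re (sqdist ds m (tact us \<rho>) (tact vs \<rho>))"
        define k where "k = 1 - ?D / C"
        have k: "?K (tact us \<rho>) vs = of_real k" "0 \<le> k"
          using kernel_real[OF rho C M tact_herm[OF us rho] vs bound[OF us vs]] by (simp_all add: k_def)
        have D: "0 \<le> ?D" "?D \<le> C" using sqdist_herm_real(2)[OF tact_herm[OF us rho] tact_herm[OF vs rho]] bound[OF us vs] by auto
        have "(\<Sum>i\<in>?Idx. e i us * (?Ku vs * h i vs)) - ?Ku vs = ?Ku vs * ((\<Sum>i\<in>?Idx. e i us * h i vs) - (\<Sum>i\<in>?Idx. e i vs * h i vs))"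
          unfolding rel[OF vs, folded e_def] by (simp add: right_diff_distrib sum_distrib_left mult_ac)
        also have "(\<Sum>i\<in>?Idx. e i us * h i vs) - (\<Sum>i\<in>?Idx. e i vs * h i vs) = (\<Sum>i\<in>?Idx. (e i us - e i vs) * h i vs)"
          by (simp add: left_diff_distrib sum_subtractf)
        finally have "norm ((\<Sum>i\<in>?Idx. e i us * (?Ku vs * h i vs)) - ?Ku vs) =
            k ^ N * norm (\<Sum>i\<in>?Idx. (e i us - e i vs) * h i vs)"
          using k by (simp add: norm_mult norm_power)
        also have "\<dots> \<le> k ^ N * (L * sqrt ?D)" using lip[OF us vs] k(2) by (intro mult_left_mono) auto
        also have "\<dots> \<le> \<epsilon> / 2 * k ^ N + L * sqrt C * a ^ N"
        proof (cases "?D \<le> \<theta>\<^sup>2")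
          case True
          then have "sqrt ?D \<le> \<theta>" using \<theta>(1) by (intro real_le_lsqrt) auto
          then have "L * sqrt ?D \<le> \<epsilon> / 2" using L \<theta>(2) by (metis mult_left_mono less_imp_le)
          then have "k ^ N * (L * sqrt ?D) \<le> k ^ N * (\<epsilon> / 2)" using k(2) by (intro mult_left_mono) auto
          moreover have "0 \<le> L * sqrt C * a ^ N" using L C ab(1) by simp
          ultimately show ?thesis by (simp add: mult.commute)
        next
          case False
          then have "k \<le> a" using C by (simp add: k_def a_def t_def max_def divide_right_mono)
          then have "k ^ N \<le> a ^ N" using k(2) by (intro power_mono)
          moreover have "L * sqrt ?D \<le> L * sqrt C" using D L by simp
          ultimately have "k ^ N * (L * sqrt ?D) \<le> a ^ N * (L * sqrt C)"
            using D L ab(1) by (intro mult_mono) auto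
          moreover have "0 \<le> \<epsilon> / 2 * k ^ N" using \<epsilon> k(2) by simp
          ultimately show ?thesis by (simp add: mult_ac)
        qed
        also have "\<dots> = Re (?g vs)" by (simp add: k flip: of_real_power)
        finally show "norm ((\<Sum>i\<in>?Idx. e i us * (?Ku vs * h i vs)) - ?Ku vs) \<le> Re (?g vs)" .
      qed
      also have "M ?g = of_real (\<epsilon> / 2) * c + of_real (L * sqrt C * a ^ N)"
        unfolding c_eq
        by (subst mean_add[OF M bounded_image_cmult[OF regU_bounded[OF KuR]] bounded_image_const])
          (simp only: mean_cmult[OF M regU_bounded[OF KuR]] mean_const[OF M])
      also have "Re (of_real (\<epsilon> / 2) * c + of_real (L * sqrt C * a ^ N)) = \<epsilon> / 2 * Re c + L * sqrt C * a ^ N"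
        by simp
      also have "\<dots> \<le> \<epsilon> * Re c" using small by simp
      also have "\<dots> \<le> \<epsilon> * norm c" using \<epsilon> complex_Re_le_cmod by (intro mult_left_mono) auto
      finally have "norm c * norm (w us - 1) \<le> norm c * \<epsilon>" unfolding eq[symmetric] by (simp add: norm_mult mult.commute)
      then show ?thesis using c0 by simp
    qed
    ultimately show ?thesis by blast
  qed
  \<comment> \<open>The approximations stay in the fixed finite-dimensional space \<open>V\<close>,
    so their limit \<open>1\<close> is attained there on the unitary group.\<close>
  have "\<forall>n. \<exists>w. w \<in> V \<and> (\<forall>us\<in>U_prod ds. norm (w us - 1) \<le> inverse (real (Suc n)))"
    using approx by (metis inverse_positive_iff_positive of_nat_0_less_iff zero_less_Suc)
  then obtain w where w: "\<And>n. w n \<in> V" "\<And>n us. us \<in> U_prod ds \<Longrightarrow> norm (w n us - 1) \<le> inverse (real (Suc n))"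
    by metis
  have "(\<lambda>n. w n us) \<longlonglongrightarrow> 1" if us: "us \<in> U_prod ds" for us
  proof -
    have "(\<lambda>n. w n us - 1) \<longlonglongrightarrow> 0"
      by (rule Lim_null_comparison[OF _ LIMSEQ_inverse_real_of_nat])
        (intro always_eventually allI w(2)[OF us])
    then show ?thesis by (simp add: LIM_zero_iff)
  qed
  then obtain v where "v \<in> V" "\<forall>us\<in>U_prod ds. v us = 1"
    using finite_dim_closed[OF V \<open>finite B0\<close>, of w "U_prod ds" "\<lambda>_. 1"] w(1) unfolding V_def by blast
  then show ?thesis unfolding V_def by force
qed

theorem hermitian_orbit_closed:
  assumes rho: "\<rho> \<in> herm_tuples ds m" and X: "X \<in> End_V_tuples ds m"
    and closure: "\<And>f. f \<in> poly_ring ds m \<Longrightarrow> (\<And>gs. gs \<in> GL_prod ds \<Longrightarrow> f (tact gs \<rho>) = 0) \<Longrightarrow> f X = 0"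
  shows "\<exists>gs\<in>GL_prod ds. X = tact gs \<rho>"
proof -
  let ?Idx = "tuple_index ds m"
  have rho': "\<rho> \<in> End_V_tuples ds m" using rho by (simp add: herm_tuples_def)
  have "\<forall>i. \<exists>f. i \<in> ?Idx \<longrightarrow> f \<in> reg ds \<and> (\<forall>us\<in>U_prod ds. entry i (tact us \<rho>) = f us)"
    using tact_reg[OF entry_poly_ring rho'] by blast
  then obtain E where E: "\<And>i. i \<in> ?Idx \<Longrightarrow> E i \<in> reg ds"
    "\<And>i us. i \<in> ?Idx \<Longrightarrow> us \<in> U_prod ds \<Longrightarrow> entry i (tact us \<rho>) = E i us" by metis
  define Mf where "Mf i = (\<lambda>us. E i us - entry i X)" for i
  have Mf: "Mf i \<in> reg ds" if "i \<in> ?Idx" for i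
    unfolding Mf_def by (intro fun_alg_diff[OF fun_alg_reg] E(1) that reg.const)
  define I where "I = {f \<in> reg ds. \<exists>h. (\<forall>i\<in>?Idx. h i \<in> reg ds) \<and>
    (\<forall>us\<in>U_prod ds. f us = (\<Sum>i\<in>?Idx. Mf i us * h i us))}"
  have I: "alg_ideal (reg ds) I" unfolding I_def by (rule reg_relation_ideal[OF Mf])
  have "(\<lambda>_. 1) \<notin> I"
  proof
    assume "(\<lambda>_. 1) \<in> I"
    then obtain h where h: "\<And>i. i \<in> ?Idx \<Longrightarrow> h i \<in> reg ds" "\<And>us. us \<in> U_prod ds \<Longrightarrow> 1 = (\<Sum>i\<in>?Idx. Mf i us * h i us)"
      unfolding I_def by auto
    have rel: "(\<Sum>i\<in>?Idx. (entry i (tact us \<rho>) - entry i X) * h i us) = 1" if "us \<in> U_prod ds" for us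
      using h(2)[OF that] E(2)[OF _ that] by (simp add: Mf_def)
    then obtain G where G: "G \<in> poly_ring ds m" "G X = 0" "\<And>us. us \<in> U_prod ds \<Longrightarrow> G (tact us \<rho>) = 1"
      using relation_polynomial[OF rho X h(1) rel] by blast
    \<comment> \<open>This vanishes on the unitary orbit, by density on the whole \<open>GL\<close>
      orbit, hence at \<open>X\<close>, where however \<open>G\<close> is \<open>0\<close>.\<close>
    have G1: "(\<lambda>Y. G Y - 1) \<in> poly_ring ds m"
      by (intro fun_alg_diff[OF fun_alg_poly_ring] G(1) poly_ring.const)
    have "G X - 1 = 0"
      by (rule closure[OF G1], rule unitary_dense[OF G1 rho']) (simp_all add: G(3))
    then show False using G(2) by simp
  qed
  moreover have "countable (range monomial)" by (intro countable_image countableI_type)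
  ultimately obtain \<phi> where phi: "\<And>c. \<phi> (\<lambda>_. c) = c"
    "\<And>f g. f \<in> reg ds \<Longrightarrow> g \<in> reg ds \<Longrightarrow> \<phi> (\<lambda>x. f x + g x) = \<phi> f + \<phi> g"
    "\<And>f g. f \<in> reg ds \<Longrightarrow> g \<in> reg ds \<Longrightarrow> \<phi> (\<lambda>x. f x * g x) = \<phi> f * \<phi> g"
    "\<And>f. f \<in> I \<Longrightarrow> \<phi> f = 0"
    using nullstellensatz[OF fun_alg_reg _ reg_span_monomials I] by blast
  have phi_cong: "\<phi> f = \<phi> g" if fg: "f \<in> reg ds" "g \<in> reg ds" "\<And>us. us \<in> U_prod ds \<Longrightarrow> f us = g us" for f g
  proof -
    have d: "(\<lambda>x. f x - g x) \<in> reg ds" by (rule fun_alg_diff[OF fun_alg_reg fg(1,2)])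
    \<comment> \<open>With all coefficients zero the relation says that the function vanishes on
      unitary tuples.\<close>
    then have "(\<lambda>x. f x - g x) \<in> I"
      unfolding I_def using fg(3) by (intro CollectI conjI exI[of _ "\<lambda>_ _. 0"]) (simp_all add: reg.const)
    then show ?thesis using phi(2)[OF d fg(2)] phi(4) by simp
  qed
  have "\<exists>gs\<in>GL_prod ds. \<forall>i\<in>?Idx. \<forall>f\<in>reg ds.
      (\<forall>us\<in>U_prod ds. entry i (tact us \<rho>) = f us) \<longrightarrow> \<phi> f = entry i (tact gs \<rho>)"
  proof (rule character_point[where \<phi> = \<phi>])
    show "\<phi> f = \<phi> g" if "f \<in> reg ds" "g \<in> reg ds" "\<And>us. us \<in> U_prod ds \<Longrightarrow> f us = g us" for f g
      using that by (rule phi_cong)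
  qed (simp_all add: phi(1-3) rho')
  then obtain gs where gs: "gs \<in> GL_prod ds" "\<And>i. i \<in> ?Idx \<Longrightarrow> \<phi> (E i) = entry i (tact gs \<rho>)"
    using E by blast
  have "entry i X = entry i (tact gs \<rho>)" if i: "i \<in> ?Idx" for i
  proof -
    \<comment> \<open>The generators lie in the ideal, so the character sends the entry functions of
      the orbit to the entries of \<open>X\<close>.\<close>
    have "Mf i \<in> I"
      unfolding I_def using Mf[OF i] i finite_tuple_index[of ds m]
      by (intro CollectI conjI exI[of _ "\<lambda>j us. if j = i then 1 else 0"])
        (simp_all add: reg.const if_distrib[where f = "\<lambda>x. _ * x"] cong: if_cong)
    then have "\<phi> (\<lambda>us. Mf i us + entry i X) = 0 + entry i X"
      using phi(2)[OF Mf[OF i] reg.const] phi(1,4) by simp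
    then show ?thesis using gs(2)[OF i] by (simp add: Mf_def)
  qed
  then have "X = tact gs \<rho>"
    by (intro tuples_eqI[OF X tact_tuples[OF gs(1) rho']]) (auto simp: tuple_index_def entry_def)
  then show ?thesis using gs(1) by blast
qed

section \<open>Orbits as sets, and the conclusion\<close>

lemma GL_prod_tuple_orbit_eq:
  assumes X: "X \<in> End_V_tuples ds m" and gs: "gs \<in> GL_prod ds"
  shows "tuple_orbit (GL_prod ds) (tact gs X) = tuple_orbit (GL_prod ds) X"
proof -
  have sub: "tuple_orbit (GL_prod ds) (tact gs X) \<subseteq> tuple_orbit (GL_prod ds) X"
    if gs: "gs \<in> GL_prod ds" and X: "X \<in> End_V_tuples ds m" for gs X
  proof
    fix Y assume "Y \<in> tuple_orbit (GL_prod ds) (tact gs X)"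
    then obtain hs where hs: "hs \<in> GL_prod ds" "Y = tact hs (tact gs X)"
      by (auto simp: tuple_orbit_def tact_def)
    then have "Y = tact (gmul hs gs) X" by (simp add: tact_gmul[OF hs(1) gs X])
    then show "Y \<in> tuple_orbit (GL_prod ds) X"
      using GL_prod_gmul[OF hs(1) gs] by (auto simp: tuple_orbit_def tact_def)
  qed
  obtain hs where hs: "hs \<in> GL_prod ds" "gmul hs gs = map 1\<^sub>m ds" using GL_prod_inverse[OF gs] by metis
  have "tact hs (tact gs X) = X" using tact_gmul[OF hs(1) gs X] by (simp add: hs(2) tact_ones[OF X])
  then show ?thesis using sub[OF gs X] sub[OF hs(1) tact_tuples[OF gs X]] by auto
qed

lemma orbit_eq_iff:
  assumes G: "\<And>gs hs. gs \<in> G \<Longrightarrow> hs \<in> G \<Longrightarrow> gmul gs hs \<in> G" "map 1\<^sub>m ds \<in> G" "G \<subseteq> GL_prod ds"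
    and inv: "\<And>gs. gs \<in> G \<Longrightarrow> \<exists>hs\<in>G. gmul hs gs = map 1\<^sub>m ds"
    and A: "A \<in> End_V ds" and B: "B \<in> End_V ds"
  shows "orbit G A = orbit G B \<longleftrightarrow> (\<exists>gs\<in>G. B = conj_act gs A)"
proof
  assume "orbit G A = orbit G B"
  moreover have "B \<in> orbit G B" using conj_act_ones[OF B] G(2) unfolding orbit_def by force
  ultimately show "\<exists>gs\<in>G. B = conj_act gs A" by (auto simp: orbit_def)
next
  assume "\<exists>gs\<in>G. B = conj_act gs A"
  then obtain gs where gs: "gs \<in> G" "B = conj_act gs A" by blast
  obtain hs where hs: "hs \<in> G" "gmul hs gs = map 1\<^sub>m ds" using inv[OF gs(1)] by blast
  have sub: "orbit G (conj_act ks C) \<subseteq> orbit G C" if "ks \<in> G" "C \<in> End_V ds" for ks C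
  proof
    fix Y assume "Y \<in> orbit G (conj_act ks C)"
    then obtain ls where ls: "ls \<in> G" "Y = conj_act ls (conj_act ks C)" by (auto simp: orbit_def)
    then have "Y = conj_act (gmul ls ks) C" using conj_act_gmul[of ls ds ks C] that subsetD[OF G(3)] by simp
    then show "Y \<in> orbit G C" using G(1)[OF ls(1) that(1)] by (auto simp: orbit_def)
  qed
  have "conj_act hs B = A"
    using conj_act_gmul[of hs ds gs A] hs gs subsetD[OF G(3)] A conj_act_ones[OF A] by simp
  then show "orbit G A = orbit G B" using sub[OF gs(1) A] sub[OF hs(1) B] gs(2) by auto
qed

theorem corollary4p8:
  fixes ds :: "nat list" and m :: nat
  shows
    "(\<forall>\<rho> \<in> density_tuples ds m. zariski_closed ds m (tuple_orbit (GL_prod ds) \<rho>)) \<and>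
     (\<forall>\<rho> \<in> density_tuples ds m. \<forall>\<sigma> \<in> density_tuples ds m.
        tuple_orbit (GL_prod ds) \<rho> \<noteq> tuple_orbit (GL_prod ds) \<sigma> \<longrightarrow>
        (\<exists>f \<in> GL_invariants ds m. f \<rho> \<noteq> f \<sigma>)) \<and>
     (\<forall>A \<in> End_V ds. \<forall>B \<in> End_V ds. hermitian A \<longrightarrow> hermitian B \<longrightarrow>
        (orbit (GL_prod ds) A = orbit (GL_prod ds) B \<longleftrightarrow>
         orbit (U_prod ds) A = orbit (U_prod ds) B))"
proof (intro conjI ballI impI)
  have herm: "\<rho> \<in> herm_tuples ds m" if "\<rho> \<in> density_tuples ds m" for \<rho>
    using that by (auto simp: density_tuples_def density_matrices_def pos_semidef_def herm_tuples_def End_V_tuples_def)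
  {
    fix \<rho> assume "\<rho> \<in> density_tuples ds m"
    then have rho: "\<rho> \<in> herm_tuples ds m" by (rule herm)
    then have rho': "\<rho> \<in> End_V_tuples ds m" by (simp add: herm_tuples_def)
    \<comment> \<open>The whole vanishing ideal of the orbit, so that its zero set is the Zariski
      closure.\<close>
    let ?F = "{f \<in> poly_ring ds m. \<forall>gs\<in>GL_prod ds. f (tact gs \<rho>) = 0}"
    have "tuple_orbit (GL_prod ds) \<rho> = {X \<in> End_V_tuples ds m. \<forall>f\<in>?F. f X = 0}"
    proof (intro equalityI subsetI)
      fix X assume "X \<in> tuple_orbit (GL_prod ds) \<rho>"
      then obtain gs where "gs \<in> GL_prod ds" "X = tact gs \<rho>" by (auto simp: tuple_orbit_def tact_def)
      then show "X \<in> {X \<in> End_V_tuples ds m. \<forall>f\<in>?F. f X = 0}" using tact_tuples[OF _ rho'] by auto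
    next
      fix X assume "X \<in> {X \<in> End_V_tuples ds m. \<forall>f\<in>?F. f X = 0}"
      then obtain gs where "gs \<in> GL_prod ds" "X = tact gs \<rho>"
        using hermitian_orbit_closed[OF rho, of X] by blast
      then show "X \<in> tuple_orbit (GL_prod ds) \<rho>" by (auto simp: tuple_orbit_def tact_def)
    qed
    then show "zariski_closed ds m (tuple_orbit (GL_prod ds) \<rho>)"
      unfolding zariski_closed_def by (intro exI[of _ ?F]) auto
  next
    fix \<rho> \<sigma> assume rs: "\<rho> \<in> density_tuples ds m" "\<sigma> \<in> density_tuples ds m"
      and ne: "tuple_orbit (GL_prod ds) \<rho> \<noteq> tuple_orbit (GL_prod ds) \<sigma>"
    show "\<exists>f\<in>GL_invariants ds m. f \<rho> \<noteq> f \<sigma>"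
    proof (rule ccontr)
      assume "\<not> ?thesis"
      then obtain us where "us \<in> U_prod ds" "tact us \<rho> = \<sigma>"
        using hermitian_separation[OF herm[OF rs(1)] herm[OF rs(2)]] by blast
      moreover have "\<rho> \<in> End_V_tuples ds m" using herm[OF rs(1)] by (simp add: herm_tuples_def)
      ultimately show False using ne GL_prod_tuple_orbit_eq U_prod_subset(1) by blast
    qed
  next
    fix A B assume AB: "A \<in> End_V ds" "B \<in> End_V ds" "hermitian A" "hermitian B"
    have GL: "orbit (GL_prod ds) A = orbit (GL_prod ds) B \<longleftrightarrow> (\<exists>gs\<in>GL_prod ds. B = conj_act gs A)"
    proof (rule orbit_eq_iff[where ds = ds])
      show "map 1\<^sub>m ds \<in> GL_prod ds" using ones_U_prod U_prod_subset(1) by blast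
      show "\<exists>hs\<in>GL_prod ds. gmul hs gs = map 1\<^sub>m ds" if gs: "gs \<in> GL_prod ds" for gs
        using GL_prod_inverse[OF gs] by metis
    qed (simp_all add: GL_prod_gmul AB)
    have U: "orbit (U_prod ds) A = orbit (U_prod ds) B \<longleftrightarrow> (\<exists>us\<in>U_prod ds. B = conj_act us A)"
    proof (rule orbit_eq_iff[where ds = ds])
      show "\<exists>hs\<in>U_prod ds. gmul hs us = map 1\<^sub>m ds" if us: "us \<in> U_prod ds" for us
        using U_prod_inverse(1,3)[OF us] by blast
    qed (simp_all add: U_prod_gmul ones_U_prod U_prod_subset(1) AB)
    show "orbit (GL_prod ds) A = orbit (GL_prod ds) B \<longleftrightarrow> orbit (U_prod ds) A = orbit (U_prod ds) B"
    proof
      assume "orbit (GL_prod ds) A = orbit (GL_prod ds) B"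
      then obtain gs where gs: "gs \<in> GL_prod ds" "B = conj_act gs A" using GL by blast
      \<comment> \<open>Single matrices are treated as tuples of length one, independently of the
        given \<open>m\<close>.\<close>
      have herm1: "[A] \<in> herm_tuples ds 1" "[B] \<in> herm_tuples ds 1"
        using AB by (auto simp: herm_tuples_def End_V_tuples_def)
      have "f [A] = f [B]" if "f \<in> GL_invariants ds 1" for f
      proof -
        have "f (map (conj_act gs) [A]) = f [A]"
          using that gs(1) herm1(1) unfolding GL_invariants_def herm_tuples_def by blast
        then show ?thesis by (simp add: gs(2))
      qed
      then obtain us where "us \<in> U_prod ds" "tact us [A] = [B]"
        using hermitian_separation[OF herm1] by blast
      then show "orbit (U_prod ds) A = orbit (U_prod ds) B" using U by (auto simp: tact_def)
    next
      assume "orbit (U_prod ds) A = orbit (U_prod ds) B"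
      then show "orbit (GL_prod ds) A = orbit (GL_prod ds) B" using U GL U_prod_subset(1) by blast
    qed
  }
qed

end
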